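(* Let $\Omega\subset\widehat{\mathbb{C}}$ be a domain. The following are equivalent: (1) $\partial\Omega$ is a Peano compactum; (2) $\Omega$ has Property S; (3) every point of $\partial\Omega$ is locally accessible (from $\Omega$); (4) every point of $\partial\Omega$ is locally sequentially accessible; (5) $\Omega$ is finitely connected at the boundary; (6) the completion of $\Omega$ under the Mazurkiewicz distance $d$ is compact.
   Context: A domain is a connected open subset of the extended complex plane $\widehat{\mathbb{C}}$, which is equipped with the spherical metric; $D_r(x)$ is the open disk centered at $x$ with radius $r$; diameters and distances are with respect to this metric. A Peano continuum is the image of $[0,1]$ under a continuous map. A Peano compactum is a compact metrisable space each of whose components is a Peano continuum (possibly a single point), such that for any $C>0$ at most finitely many of the components have diameter $>C$. A metric space $X$ has Property S if for each $\epsilon>0$ the set $X$ is the union of finitely many connected sets of diameter less than $\epsilon$. A point $p\in\partial\Omega$ is locally accessible from $\Omega$ if for any $\epsilon>0$ there is $\delta>0$ such that for any $x\in\Omega$ at distance less than $\delta$ from $p$ there is a simple arc in $\Omega\cup\{p\}$ that joins $x$ to $p$ and has diameter smaller than $\epsilon$. A point $\xi\in\partial\Omega$ is locally sequentially accessible if for each $r>0$ and each sequence $\{\xi_n\}$ of points in $\Omega$ converging to $\xi$, some component of the open set $\Omega\cap D_r(\xi)$ contains infinitely many $\xi_n$ (i.e. contains $\xi_n$ for infinitely many $n$). $\Omega$ is finitely connected at a boundary point $x\in\partial\Omega$ if for any $r>0$ there is an open subset $U_x$ of $\widehat{\mathbb{C}}$ with $x\in U_x\subset D_r(x)$ such that $U_x\cap\Omega$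 has finitely many components; $\Omega$ is finitely connected at the boundary if it is finitely connected at every point of $\partial\Omega$. The Mazurkiewicz distance between $x\neq y$ in $\Omega$ is $d(x,y)=\inf\mathrm{diam}(E)$, where the infimum is taken over all connected sets $E\subset\Omega$ containing both $x$ and $y$ (and $d(x,x)=0$). *)

theory Defs
  imports "HOL-Analysis.Analysis"
begin

section \<open>The extended complex plane with the spherical metric\<close>

datatype ext_complex = Fin complex | Infty

text \<open>
  Inverse stereographic projection onto the unit sphere of
  \<^typ>\<open>complex \<times> real\<close>; the projection centre is the north pole \<open>(0, 1)\<close>.
\<close>

fun to_sphere :: "ext_complex \<Rightarrow> complex \<times> real" where
  "to_sphere (Fin z) =
     ((2 / ((cmod z)\<^sup>2 + 1)) *\<^sub>R z, ((cmod z)\<^sup>2 - 1) / ((cmod z)\<^sup>2 + 1))"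
| "to_sphere Infty = (0, 1)"

lemma norm_to_sphere [simp]: "norm (to_sphere p) = 1"
proof (cases p)
  case (Fin z)
  define r where "r = (cmod z)\<^sup>2"
  have "r + 1 > 0"
    by (simp add: r_def add_nonneg_pos)
  have "(norm (to_sphere p))\<^sup>2 = (2 / (r + 1))\<^sup>2 * r + ((r - 1) / (r + 1))\<^sup>2"
    using \<open>r + 1 > 0\<close> by (simp add: Fin norm_Pair r_def power_mult_distrib power_divide)
  also have "\<dots> = (4 * r + (r - 1)\<^sup>2) / (r + 1)\<^sup>2"
    by (simp add: power_divide add_divide_distrib)
  also have "4 * r + (r - 1)\<^sup>2 = (r + 1)\<^sup>2"
    by (simp add: power2_eq_square algebra_simps)
  finally have "(norm (to_sphere p))\<^sup>2 = 1"
    using \<open>r + 1 > 0\<close> by simp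
  then show ?thesis
    by (metis norm_ge_zero power2_eq_1_iff abs_of_nonneg abs_1 one_neq_neg_one abs_minus_cancel)
qed (simp add: norm_Pair)

lemma inj_to_sphere: "inj to_sphere"
proof (rule injI)
  have fin: "(1 - snd (to_sphere (Fin z))) * ((cmod z)\<^sup>2 + 1) = 2"
    and fst_fin: "((cmod z)\<^sup>2 + 1) *\<^sub>R fst (to_sphere (Fin z)) = 2 *\<^sub>R z" for z
  proof -
    have "(cmod z)\<^sup>2 + 1 \<noteq> 0"
      by (metis add_eq_0_iff_both_eq_0 zero_le_power2 zero_le_one zero_neq_one add_nonneg_eq_0_iff)
    then show "(1 - snd (to_sphere (Fin z))) * ((cmod z)\<^sup>2 + 1) = 2"
      and "((cmod z)\<^sup>2 + 1) *\<^sub>R fst (to_sphere (Fin z)) = 2 *\<^sub>R z"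
      by (simp_all add: field_simps)
  qed
  have Infty: "to_sphere (Fin z) \<noteq> to_sphere Infty" for z
    using fin[of z] by auto
  have Fin: "z = w" if eq: "to_sphere (Fin z) = to_sphere (Fin w)" for z w
  proof -
    have "(1 - snd (to_sphere (Fin z))) * ((cmod z)\<^sup>2 + 1)
        = (1 - snd (to_sphere (Fin z))) * ((cmod w)\<^sup>2 + 1)"
      using fin[of z] fin[of w] unfolding eq by simp
    then have "(cmod z)\<^sup>2 + 1 = (cmod w)\<^sup>2 + 1"
      using fin[of z] mult_left_cancel[of "1 - snd (to_sphere (Fin z))"] by force
    then have "2 *\<^sub>R z = 2 *\<^sub>R w"
      using fst_fin[of z] fst_fin[of w] unfolding eq by metis
    then show ?thesis
      by simp
  qed
  show "p = q" if "to_sphere p = to_sphere q" for p q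
    using that Infty Fin by (cases p; cases q) metis+
qed

lemma arccos_inner_triangle:
  fixes a b c :: "'a::real_inner"
  assumes "norm a = 1" "norm b = 1" "norm c = 1"
  shows "arccos (a \<bullet> c) \<le> arccos (a \<bullet> b) + arccos (b \<bullet> c)"
proof (cases "arccos (a \<bullet> b) + arccos (b \<bullet> c) \<le> pi")
  case True
  have unit: "\<bar>x \<bullet> y\<bar> \<le> 1" if "norm x = 1" "norm y = 1" for x y :: 'a
    using Cauchy_Schwarz_ineq2[of x y] that by simp
  have sqr: "a \<bullet> a = 1" "b \<bullet> b = 1" "c \<bullet> c = 1"
    using assms by (simp_all add: dot_square_norm)
  define s t where "s = a \<bullet> b" and "t = b \<bullet> c"
  have st: "\<bar>s\<bar> \<le> 1" "\<bar>t\<bar> \<le> 1"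
    using unit assms by (auto simp: s_def t_def)
  define u v where "u = a - s *\<^sub>R b" and "v = c - t *\<^sub>R b"
  have "(norm u)\<^sup>2 = 1 - s\<^sup>2" "(norm v)\<^sup>2 = 1 - t\<^sup>2"
    unfolding power2_norm_eq_inner u_def v_def using sqr
    by (simp_all add: inner_diff_left inner_diff_right s_def t_def inner_commute power2_eq_square)
  then have "norm u = sqrt (1 - s\<^sup>2)" "norm v = sqrt (1 - t\<^sup>2)"
    by (metis norm_ge_zero real_sqrt_unique)+
  moreover have "u \<bullet> v = a \<bullet> c - s * t"
    unfolding u_def v_def using sqr
    by (simp add: inner_diff_left inner_diff_right s_def t_def inner_commute)
  moreover have "- (u \<bullet> v) \<le> norm u * norm v"
    using Cauchy_Schwarz_ineq2[of u v] by linarith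
  ultimately have "s * t - sqrt (1 - s\<^sup>2) * sqrt (1 - t\<^sup>2) \<le> a \<bullet> c"
    by simp
  then have "cos (arccos s + arccos t) \<le> a \<bullet> c"
    using st by (simp add: cos_add cos_arccos_abs sin_arccos_abs)
  then have "arccos (a \<bullet> c) \<le> arccos (cos (arccos s + arccos t))"
    using unit[OF assms(1,3)] by (intro arccos_le_arccos) auto
  also have "\<dots> = arccos s + arccos t"
    using True st by (intro arccos_cos) (auto simp: s_def t_def abs_le_iff intro!: add_nonneg_nonneg arccos_lbound)
  finally show ?thesis
    by (simp add: s_def t_def)
next
  case False
  then show ?thesis
    using arccos_ubound[of "a \<bullet> c"] Cauchy_Schwarz_ineq2[of a c] assms by (simp add: abs_le_iff)
qed

instantiation ext_complex :: metric_space
begin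

text \<open>Great-circle distance, the length metric of \<open>2 |dz| / (1 + |z|\<^sup>2)\<close>.\<close>

definition dist_ext_complex :: "ext_complex \<Rightarrow> ext_complex \<Rightarrow> real" where
  "dist_ext_complex p q = arccos (to_sphere p \<bullet> to_sphere q)"

definition uniformity_ext_complex :: "(ext_complex \<times> ext_complex) filter" where
  "uniformity_ext_complex = (INF e\<in>{0 <..}. principal {(x, y). dist x y < e})"

definition open_ext_complex :: "ext_complex set \<Rightarrow> bool" where
  "open_ext_complex U \<longleftrightarrow> (\<forall>x\<in>U. eventually (\<lambda>(x', y). x' = x \<longrightarrow> y \<in> U) uniformity)"

instance
proof
  fix x y z :: ext_complex
  show "dist x y = 0 \<longleftrightarrow> x = y"
  proof
    assume "dist x y = 0"
    moreover have "\<bar>to_sphere x \<bullet> to_sphere y\<bar> \<le> 1"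
      using Cauchy_Schwarz_ineq2[of "to_sphere x" "to_sphere y"] by simp
    ultimately have "to_sphere x \<bullet> to_sphere y = 1"
      unfolding dist_ext_complex_def by (metis cos_arccos_abs cos_zero)
    moreover have "(norm (to_sphere x - to_sphere y))\<^sup>2
        = (norm (to_sphere x))\<^sup>2 - 2 * (to_sphere x \<bullet> to_sphere y) + (norm (to_sphere y))\<^sup>2"
      by (simp only: power2_norm_eq_inner inner_diff_left inner_diff_right inner_commute)
    ultimately have "(norm (to_sphere x - to_sphere y))\<^sup>2 = 0"
      by simp
    then show "x = y"
      using inj_to_sphere by (simp add: inj_eq)
  qed (simp add: dist_ext_complex_def dot_square_norm)
  show "dist x y \<le> dist x z + dist y z"
    using arccos_inner_triangle[of "to_sphere x" "to_sphere z" "to_sphere y"]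
    by (simp add: dist_ext_complex_def inner_commute)
qed (rule uniformity_ext_complex_def open_ext_complex_def)+

end


section \<open>Boundary properties\<close>

definition Peano_continuum :: "'a::metric_space set \<Rightarrow> bool" where
  "Peano_continuum K \<longleftrightarrow> (\<exists>g. path g \<and> path_image g = K)"

definition Peano_compactum :: "'a::metric_space set \<Rightarrow> bool" where
  "Peano_compactum K \<longleftrightarrow>
     compact K \<and>
     (\<forall>C\<in>components K. Peano_continuum C) \<and>
     (\<forall>e>0. finite {C \<in> components K. diameter C > e})"

definition property_S :: "'a::metric_space set \<Rightarrow> bool" where
  "property_S X \<longleftrightarrow>
     (\<forall>e>0. \<exists>\<F>. finite \<F> \<and> \<Union>\<F> = X \<and> (\<forall>E\<in>\<F>. connected E \<and> diameter E < e))"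

definition locally_accessible :: "'a::metric_space set \<Rightarrow> 'a \<Rightarrow> bool" where
  "locally_accessible \<Omega> p \<longleftrightarrow>
     (\<forall>e>0. \<exists>\<delta>>0. \<forall>x\<in>\<Omega>. dist x p < \<delta> \<longrightarrow>
        (\<exists>g. arc g \<and> path_image g \<subseteq> \<Omega> \<union> {p} \<and> pathstart g = x \<and> pathfinish g = p \<and>
             diameter (path_image g) < e))"

definition locally_sequentially_accessible :: "'a::metric_space set \<Rightarrow> 'a \<Rightarrow> bool" where
  "locally_sequentially_accessible \<Omega> p \<longleftrightarrow>
     (\<forall>r>0. \<forall>\<xi>. (\<forall>n. \<xi> n \<in> \<Omega>) \<and> \<xi> \<longlonglongrightarrow> p \<longrightarrow>
        (\<exists>C\<in>components (\<Omega> \<inter> ball p r). infinite {n. \<xi> n \<in> C}))"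

definition finitely_connected_at :: "'a::metric_space set \<Rightarrow> 'a \<Rightarrow> bool" where
  "finitely_connected_at \<Omega> p \<longleftrightarrow>
     (\<forall>r>0. \<exists>U. open U \<and> p \<in> U \<and> U \<subseteq> ball p r \<and> finite (components (U \<inter> \<Omega>)))"

definition finitely_connected_at_boundary :: "'a::metric_space set \<Rightarrow> bool" where
  "finitely_connected_at_boundary \<Omega> \<longleftrightarrow> (\<forall>p\<in>frontier \<Omega>. finitely_connected_at \<Omega> p)"


section \<open>Completion of a metric space\<close>

context Metric_space
begin

definition completion_rel :: "((nat \<Rightarrow> 'a) \<times> (nat \<Rightarrow> 'a)) set" where
  "completion_rel =
     {(\<sigma>, \<tau>). MCauchy \<sigma> \<and> MCauchy \<tau> \<and> (\<lambda>n. d (\<sigma> n) (\<tau> n)) \<longlonglongrightarrow> 0}"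

definition completion_space :: "(nat \<Rightarrow> 'a) set set" where
  "completion_space = Collect MCauchy // completion_rel"

text \<open>
  The value 0 outside the completion only serves the convention of
  \<^locale>\<open>Metric_space\<close> that a distance is nonnegative and symmetric everywhere.
\<close>

definition completion_dist :: "(nat \<Rightarrow> 'a) set \<Rightarrow> (nat \<Rightarrow> 'a) set \<Rightarrow> real" where
  "completion_dist X Y =
     (if X \<in> completion_space \<and> Y \<in> completion_space
      then THE r. \<forall>\<sigma>\<in>X. \<forall>\<tau>\<in>Y. (\<lambda>n. d (\<sigma> n) (\<tau> n)) \<longlonglongrightarrow> r else 0)"

definition completion_embed :: "'a \<Rightarrow> (nat \<Rightarrow> 'a) set" where
  "completion_embed x = completion_rel `` {\<lambda>n. x}"

lemma MCauchy_in: "MCauchy \<sigma> \<Longrightarrow> \<sigma> n \<in> M"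
  by (auto simp: MCauchy_def)

lemma mdist_quad:
  assumes "a \<in> M" "b \<in> M" "a' \<in> M" "b' \<in> M"
  shows "\<bar>d a b - d a' b'\<bar> \<le> d a a' + d b b'"
  using assms triangle[of a a' b] triangle[of a' b' b] triangle[of a' a b'] triangle[of a b b']
    commute[of a a'] commute[of b b']
  by linarith

lemma MCauchy_dist_convergent:
  assumes "MCauchy \<sigma>" "MCauchy \<tau>"
  shows "convergent (\<lambda>n. d (\<sigma> n) (\<tau> n))"
proof (rule Cauchy_convergent, rule metric_CauchyI)
  fix e :: real assume "e > 0"
  then obtain N1 N2 where
    "\<And>n n'. \<lbrakk>N1 \<le> n; N1 \<le> n'\<rbrakk> \<Longrightarrow> d (\<sigma> n) (\<sigma> n') < e/2"
    "\<And>n n'. \<lbrakk>N2 \<le> n; N2 \<le> n'\<rbrakk> \<Longrightarrow> d (\<tau> n) (\<tau> n') < e/2"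
    using assms unfolding MCauchy_def by (metis half_gt_zero)
  then have "dist (d (\<sigma> m) (\<tau> m)) (d (\<sigma> n) (\<tau> n)) < e" if "m \<ge> max N1 N2" "n \<ge> max N1 N2" for m n
    using mdist_quad[of "\<sigma> m" "\<tau> m" "\<sigma> n" "\<tau> n"] assms MCauchy_in that
    by (fastforce simp: dist_real_def)
  then show "\<exists>K. \<forall>m\<ge>K. \<forall>n\<ge>K. dist (d (\<sigma> m) (\<tau> m)) (d (\<sigma> n) (\<tau> n)) < e"
    by blast
qed

lemma equiv_completion_rel: "equiv (Collect MCauchy) completion_rel"
proof (rule equivI)
  show "refl_on (Collect MCauchy) completion_rel"
    by (auto simp: refl_on_def completion_rel_def MCauchy_in)
  show "sym completion_rel"
    by (auto simp: sym_def completion_rel_def commute)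
  show "trans completion_rel"
  proof (rule transI)
    fix \<rho> \<sigma> \<tau> assume *: "(\<rho>, \<sigma>) \<in> completion_rel" "(\<sigma>, \<tau>) \<in> completion_rel"
    then have "(\<lambda>n. d (\<rho> n) (\<sigma> n) + d (\<sigma> n) (\<tau> n)) \<longlonglongrightarrow> 0"
      by (auto simp: completion_rel_def intro: tendsto_add_zero)
    moreover have "d (\<rho> n) (\<tau> n) \<le> d (\<rho> n) (\<sigma> n) + d (\<sigma> n) (\<tau> n)" for n
      using * by (intro triangle) (auto simp: completion_rel_def MCauchy_in)
    ultimately have "(\<lambda>n. d (\<rho> n) (\<tau> n)) \<longlonglongrightarrow> 0"
      by (rule_tac tendsto_sandwich[OF _ _ tendsto_const]) auto
    then show "(\<rho>, \<tau>) \<in> completion_rel"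
      using * by (auto simp: completion_rel_def)
  qed
qed (auto simp: completion_rel_def)

lemma completion_rel_class:
  assumes "X \<in> completion_space" "\<sigma> \<in> X"
  shows "MCauchy \<sigma>" "X = completion_rel `` {\<sigma>}"
proof -
  obtain \<rho> where "MCauchy \<rho>" "X = completion_rel `` {\<rho>}"
    using assms unfolding completion_space_def by (auto elim: quotientE)
  then show "MCauchy \<sigma>" "X = completion_rel `` {\<sigma>}"
    using assms equiv_class_eq[OF equiv_completion_rel] by (auto simp: completion_rel_def)
qed

lemma completion_class:
  assumes "MCauchy \<sigma>"
  shows "completion_rel `` {\<sigma>} \<in> completion_space" "\<sigma> \<in> completion_rel `` {\<sigma>}"
  using assms equiv_class_self[OF equiv_completion_rel]
  by (auto simp: completion_space_def intro: quotientI)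

lemma completion_space_ex:
  assumes "X \<in> completion_space"
  obtains \<sigma> where "\<sigma> \<in> X"
  using assms in_quotient_imp_non_empty[OF equiv_completion_rel] unfolding completion_space_def by blast

lemma completion_dist_lim:
  assumes X: "X \<in> completion_space" "\<sigma> \<in> X" and Y: "Y \<in> completion_space" "\<tau> \<in> Y"
  shows "(\<lambda>n. d (\<sigma> n) (\<tau> n)) \<longlonglongrightarrow> completion_dist X Y"
proof -
  obtain r where r: "(\<lambda>n. d (\<sigma> n) (\<tau> n)) \<longlonglongrightarrow> r"
    using MCauchy_dist_convergent completion_rel_class assms by (meson convergent_def)
  have all: "(\<lambda>n. d (\<sigma>' n) (\<tau>' n)) \<longlonglongrightarrow> r" if "\<sigma>' \<in> X" "\<tau>' \<in> Y" for \<sigma>' \<tau>'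
  proof -
    have "(\<sigma>, \<sigma>') \<in> completion_rel" "(\<tau>, \<tau>') \<in> completion_rel"
      using completion_rel_class assms that by blast+
    then have "(\<lambda>n. d (\<sigma> n) (\<sigma>' n) + d (\<tau> n) (\<tau>' n)) \<longlonglongrightarrow> 0"
      by (auto simp: completion_rel_def intro: tendsto_add_zero)
    moreover have "norm (d (\<sigma> n) (\<tau> n) - d (\<sigma>' n) (\<tau>' n)) \<le> d (\<sigma> n) (\<sigma>' n) + d (\<tau> n) (\<tau>' n)" for n
      using mdist_quad completion_rel_class(1) assms that MCauchy_in by (metis real_norm_def)
    ultimately have "(\<lambda>n. d (\<sigma> n) (\<tau> n) - d (\<sigma>' n) (\<tau>' n)) \<longlonglongrightarrow> 0"
      by (rule_tac Lim_null_comparison[OF always_eventually]) auto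
    from tendsto_diff[OF r this] show ?thesis
      by simp
  qed
  have "(THE r. \<forall>\<sigma>\<in>X. \<forall>\<tau>\<in>Y. (\<lambda>n. d (\<sigma> n) (\<tau> n)) \<longlonglongrightarrow> r) = r"
    using all X Y LIMSEQ_unique by (intro the_equality) blast+
  then show ?thesis
    using r X Y by (simp add: completion_dist_def)
qed

lemma Metric_space_completion: "Metric_space completion_space completion_dist"
proof
  fix X Y Z
  show nn: "0 \<le> completion_dist X Y"
  proof (cases "X \<in> completion_space \<and> Y \<in> completion_space")
    case True
    then obtain \<sigma> \<tau> where "\<sigma> \<in> X" "\<tau> \<in> Y"
      using completion_space_ex by metis
    with True have "(\<lambda>n. d (\<sigma> n) (\<tau> n)) \<longlonglongrightarrow> completion_dist X Y"
      by (blast intro: completion_dist_lim)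
    then show ?thesis
      by (rule LIMSEQ_le_const) simp
  qed (auto simp: completion_dist_def)
  show "completion_dist X Y = completion_dist Y X"
  proof (cases "X \<in> completion_space \<and> Y \<in> completion_space")
    case True
    then obtain \<sigma> \<tau> where "\<sigma> \<in> X" "\<tau> \<in> Y"
      using completion_space_ex by metis
    with True have "(\<lambda>n. d (\<sigma> n) (\<tau> n)) \<longlonglongrightarrow> completion_dist X Y"
      and "(\<lambda>n. d (\<tau> n) (\<sigma> n)) \<longlonglongrightarrow> completion_dist Y X"
      by (blast intro: completion_dist_lim)+
    then show ?thesis
      unfolding commute[of "\<tau> _"] by (rule LIMSEQ_unique)
  qed (auto simp: completion_dist_def)
  assume XY: "X \<in> completion_space" "Y \<in> completion_space"
  then obtain \<sigma> \<tau> where st: "\<sigma> \<in> X" "\<tau> \<in> Y"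
    using completion_space_ex by metis
  note lim = completion_dist_lim[OF XY(1) st(1) XY(2) st(2)]
  have MC: "MCauchy \<sigma>" "MCauchy \<tau>"
    using completion_rel_class(1) XY st by blast+
  have "completion_dist X Y = 0 \<longleftrightarrow> (\<lambda>n. d (\<sigma> n) (\<tau> n)) \<longlonglongrightarrow> 0"
    using lim LIMSEQ_unique[OF lim] by metis
  also have "\<dots> \<longleftrightarrow> (\<sigma>, \<tau>) \<in> completion_rel"
    using MC by (simp add: completion_rel_def)
  also have "\<dots> \<longleftrightarrow> completion_rel `` {\<sigma>} = completion_rel `` {\<tau>}"
    using MC by (intro eq_equiv_class_iff[OF equiv_completion_rel, symmetric]) auto
  also have "\<dots> \<longleftrightarrow> X = Y"
    using completion_rel_class(2)[OF XY(1) st(1)] completion_rel_class(2)[OF XY(2) st(2)] by metis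
  finally show "completion_dist X Y = 0 \<longleftrightarrow> X = Y" .
  assume Z: "Z \<in> completion_space"
  then obtain \<rho> where \<rho>: "\<rho> \<in> Z"
    using completion_space_ex by metis
  have "MCauchy \<rho>"
    using completion_rel_class(1) Z \<rho> by blast
  then have tri: "d (\<sigma> n) (\<rho> n) \<le> d (\<sigma> n) (\<tau> n) + d (\<tau> n) (\<rho> n)" for n
    using MC by (intro triangle MCauchy_in)
  show "completion_dist X Z \<le> completion_dist X Y + completion_dist Y Z"
    using completion_dist_lim[OF XY(1) st(1) Z \<rho>]
      tendsto_add[OF lim completion_dist_lim[OF XY(2) st(2) Z \<rho>]]
    by (rule LIMSEQ_le) (simp add: tri)
qed

lemma completion_embed_space: "x \<in> M \<Longrightarrow> completion_embed x \<in> completion_space"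
  and completion_embed_mem: "x \<in> M \<Longrightarrow> (\<lambda>n. x) \<in> completion_embed x"
  unfolding completion_embed_def by (intro completion_class; simp add: MCauchy_def; fail)+

lemma completion_embed_isometry:
  assumes "x \<in> M" "y \<in> M"
  shows "completion_dist (completion_embed x) (completion_embed y) = d x y"
  using completion_dist_lim[OF completion_embed_space completion_embed_mem
      completion_embed_space completion_embed_mem, OF assms(1,1,2,2)]
  by (simp add: LIMSEQ_const_iff)

lemma completion_embed_tendsto:
  assumes "MCauchy \<sigma>"
  shows "(\<lambda>k. completion_dist (completion_embed (\<sigma> k)) (completion_rel `` {\<sigma>})) \<longlonglongrightarrow> 0"
proof (rule LIMSEQ_I)
  interpret C: Metric_space completion_space completion_dist
    by (rule Metric_space_completion)
  fix e :: real assume "e > 0"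
  then obtain N where N: "\<And>n n'. \<lbrakk>N \<le> n; N \<le> n'\<rbrakk> \<Longrightarrow> d (\<sigma> n) (\<sigma> n') < e/2"
    using assms unfolding MCauchy_def by (metis half_gt_zero)
  have "completion_dist (completion_embed (\<sigma> k)) (completion_rel `` {\<sigma>}) \<le> e/2" if "k \<ge> N" for k
    using that N assms less_imp_le
    by (intro LIMSEQ_le_const2[OF completion_dist_lim[OF completion_embed_space completion_embed_mem
          completion_class]]) (auto simp: MCauchy_in intro!: exI[of _ N])
  then show "\<exists>N. \<forall>k\<ge>N. norm (completion_dist (completion_embed (\<sigma> k)) (completion_rel `` {\<sigma>}) - 0) < e"
    using \<open>e > 0\<close> by (force intro!: exI[of _ N])
qed

lemma completion_dense:
  "Metric_space.mtopology completion_space completion_dist closure_of (completion_embed ` M)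
     = completion_space"
proof -
  interpret C: Metric_space completion_space completion_dist
    by (rule Metric_space_completion)
  have "\<exists>y\<in>completion_embed ` M. y \<in> C.mball X e" if X: "X \<in> completion_space" and "e > 0" for X e
  proof -
    obtain \<sigma> where \<sigma>: "\<sigma> \<in> X"
      using X completion_space_ex by blast
    note cl = completion_rel_class[OF X \<sigma>]
    obtain k where "norm (completion_dist (completion_embed (\<sigma> k)) X) < e"
      using LIMSEQ_D[OF completion_embed_tendsto[OF cl(1)] \<open>e > 0\<close>] cl(2) by auto
    then show ?thesis
      using MCauchy_in[OF cl(1), of k] X completion_embed_space
      by (intro bexI[of _ "completion_embed (\<sigma> k)"]) (auto simp: C.commute)
  qed
  then show ?thesis
    by (auto simp: C.metric_closure_of)
qed

lemma completion_mcomplete: "Metric_space.mcomplete completion_space completion_dist"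
proof -
  interpret C: Metric_space completion_space completion_dist
    by (rule Metric_space_completion)
  have "\<exists>L. limitin C.mtopology X L sequentially" if X: "C.MCauchy X" for X
  proof -
    have Xin: "X k \<in> completion_space" for k
      using X by (rule C.MCauchy_in)
    have "\<exists>x\<in>M. completion_dist (X k) (completion_embed x) < inverse (real (Suc k))" for k
    proof -
      have "X k \<in> C.mtopology closure_of (completion_embed ` M)"
        using Xin completion_dense by simp
      then have "\<exists>y\<in>completion_embed ` M. y \<in> C.mball (X k) (inverse (real (Suc k)))"
        unfolding C.metric_closure_of mem_Collect_eq using inverse_Suc[of k] by blast
      then show ?thesis
        unfolding C.in_mball by blast
    qed
    then obtain x where xM: "\<And>k. x k \<in> M"
      and xX: "\<And>k. completion_dist (X k) (completion_embed (x k)) < inverse (real (Suc k))"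
      by metis
    have close: "(\<lambda>k. completion_dist (X k) (completion_embed (x k))) \<longlonglongrightarrow> 0"
    proof (rule tendsto_sandwich[OF _ _ tendsto_const LIMSEQ_inverse_real_of_nat])
      show "\<forall>\<^sub>F k in sequentially. completion_dist (X k) (completion_embed (x k)) \<le> inverse (real (Suc k))"
        by (intro always_eventually allI less_imp_le xX)
    qed simp
    have "MCauchy x"
      unfolding MCauchy_def
    proof (intro conjI allI impI)
      fix e :: real assume "e > 0"
      then obtain N1 where N1: "\<And>n n'. \<lbrakk>N1 \<le> n; N1 \<le> n'\<rbrakk> \<Longrightarrow> completion_dist (X n) (X n') < e/3"
        using X unfolding C.MCauchy_def by (meson divide_pos_pos zero_less_numeral)
      obtain N2 where N2: "\<And>n. N2 \<le> n \<Longrightarrow> completion_dist (X n) (completion_embed (x n)) < e/3"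
        using LIMSEQ_D[OF close, of "e/3"] \<open>e > 0\<close> by auto
      have "d (x n) (x n') < e" if "n \<ge> max N1 N2" "n' \<ge> max N1 N2" for n n'
      proof -
        have "d (x n) (x n') = completion_dist (completion_embed (x n)) (completion_embed (x n'))"
          by (simp add: completion_embed_isometry xM)
        also have "\<dots> \<le> completion_dist (completion_embed (x n)) (X n) +
            (completion_dist (X n) (X n') + completion_dist (X n') (completion_embed (x n')))"
          using C.triangle[of "completion_embed (x n)" "X n" "completion_embed (x n')"]
            C.triangle[of "X n" "X n'" "completion_embed (x n')"]
          by (simp add: Xin xM completion_embed_space)
        also have "\<dots> < e"
          using N1[of n n'] N2[of n] N2[of n'] that C.commute[of "X n" "completion_embed (x n)"] by linarith
        finally show ?thesis .
      qed
      then show "\<exists>N. \<forall>n n'. N \<le> n \<longrightarrow> N \<le> n' \<longrightarrow> d (x n) (x n') < e"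
        by blast
    qed (use xM in auto)
    define L where "L = completion_rel `` {x}"
    have L: "L \<in> completion_space"
      using \<open>MCauchy x\<close> completion_class by (simp add: L_def)
    have sum: "(\<lambda>k. completion_dist (X k) (completion_embed (x k)) + completion_dist (completion_embed (x k)) L) \<longlonglongrightarrow> 0"
      using close completion_embed_tendsto[OF \<open>MCauchy x\<close>] unfolding L_def by (rule tendsto_add_zero)
    have le: "completion_dist (X k) L
        \<le> completion_dist (X k) (completion_embed (x k)) + completion_dist (completion_embed (x k)) L" for k
      by (intro C.triangle Xin completion_embed_space xM L)
    have lim: "(\<lambda>k. completion_dist (X k) L) \<longlonglongrightarrow> 0"
      by (rule tendsto_sandwich[OF _ _ tendsto_const sum]) (intro always_eventually allI C.nonneg le)+
    have "limitin C.mtopology X L sequentially"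
      unfolding C.limit_metric_sequentially
    proof (intro conjI L allI impI)
      fix e :: real assume "e > 0"
      then obtain N where "\<And>k. k \<ge> N \<Longrightarrow> norm (completion_dist (X k) L - 0) < e"
        using LIMSEQ_D[OF lim] by blast
      then show "\<exists>N. \<forall>n\<ge>N. X n \<in> completion_space \<and> completion_dist (X n) L < e"
        using Xin by (intro exI[of _ N]) simp
    qed
    then show ?thesis ..
  qed
  then show ?thesis
    by (simp add: C.mcomplete_def)
qed

definition compact_completion :: bool where
  "compact_completion \<longleftrightarrow>
     compact_space (Metric_space.mtopology completion_space completion_dist)"

end


section \<open>The Mazurkiewicz distance\<close>

definition mazurkiewicz_dist :: "'a::metric_space set \<Rightarrow> 'a \<Rightarrow> 'a \<Rightarrow> real" where
  "mazurkiewicz_dist \<Omega> x y =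
     (if x \<noteq> y \<and> x \<in> \<Omega> \<and> y \<in> \<Omega>
      then INF E \<in> {E. connected E \<and> E \<subseteq> \<Omega> \<and> x \<in> E \<and> y \<in> E}. diameter E
      else 0)"

lemma Metric_space_mazurkiewicz:
  assumes "connected \<Omega>" "bounded \<Omega>"
  shows "Metric_space \<Omega> (mazurkiewicz_dist \<Omega>)"
proof -
  let ?\<E> = "\<lambda>x y. {E. connected E \<and> E \<subseteq> \<Omega> \<and> x \<in> E \<and> y \<in> E}"
  have lower: "dist x y \<le> diameter E" if "E \<in> ?\<E> x y" for x y E
    using that assms(2) bounded_subset by (intro diameter_bounded_bound) auto
  have bdd: "bdd_below (diameter ` ?\<E> x y)" for x y
    using lower by (meson bdd_belowI2)
  have ne: "?\<E> x y \<noteq> {}" if "x \<in> \<Omega>" "y \<in> \<Omega>" for x y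
    using that assms(1) by blast
  have ge: "dist x y \<le> mazurkiewicz_dist \<Omega> x y" if "x \<in> \<Omega>" "y \<in> \<Omega>" for x y
  proof (cases "x = y")
    case False
    have "dist x y \<le> (INF E \<in> ?\<E> x y. diameter E)"
      using ne[OF that] lower by (rule cINF_greatest)
    with False that show ?thesis
      by (simp add: mazurkiewicz_dist_def)
  qed (simp add: mazurkiewicz_dist_def)
  show ?thesis
  proof
    fix x y z
    show "0 \<le> mazurkiewicz_dist \<Omega> x y"
    proof (cases "x \<in> \<Omega> \<and> y \<in> \<Omega>")
      case True
      then show ?thesis
        using ge[of x y] zero_le_dist[of x y] by linarith
    qed (auto simp: mazurkiewicz_dist_def)
    show "mazurkiewicz_dist \<Omega> x y = mazurkiewicz_dist \<Omega> y x"
    proof -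
      have "?\<E> x y = ?\<E> y x"
        by blast
      then show ?thesis
        unfolding mazurkiewicz_dist_def by metis
    qed
    assume xy: "x \<in> \<Omega>" "y \<in> \<Omega>"
    then show "mazurkiewicz_dist \<Omega> x y = 0 \<longleftrightarrow> x = y"
      using ge[of x y] by (auto simp: mazurkiewicz_dist_def)
    assume z: "z \<in> \<Omega>"
    show "mazurkiewicz_dist \<Omega> x z \<le> mazurkiewicz_dist \<Omega> x y + mazurkiewicz_dist \<Omega> y z"
    proof (cases "x = z \<or> x = y \<or> y = z")
      case True
      have "0 \<le> mazurkiewicz_dist \<Omega> x y" "0 \<le> mazurkiewicz_dist \<Omega> y z"
        using ge[of x y] ge[of y z] xy z zero_le_dist[of x y] zero_le_dist[of y z] by linarith+
      with True show ?thesis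
        by (auto simp: mazurkiewicz_dist_def[of _ x x] mazurkiewicz_dist_def[of _ y y]
            mazurkiewicz_dist_def[of _ z z])
    next
      case False
      have *: "mazurkiewicz_dist \<Omega> x z \<le> diameter E + diameter F"
        if E: "E \<in> ?\<E> x y" and F: "F \<in> ?\<E> y z" for E F
      proof -
        have EF: "bounded E" "bounded F" "bounded (E \<union> F)"
          using E F assms(2) by (auto intro: bounded_subset)
        have "E \<union> F \<in> ?\<E> x z"
          using E F by (auto intro: connected_Un)
        then have "mazurkiewicz_dist \<Omega> x z \<le> diameter (E \<union> F)"
          using False xy z bdd by (auto simp: mazurkiewicz_dist_def intro!: cINF_lower2)
        also have "\<dots> \<le> diameter E + diameter F"
        proof -
          have mix: "dist u v \<le> diameter E + diameter F" if "u \<in> E" "v \<in> F" for u v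
            using diameter_bounded_bound[OF EF(1) that(1), of y] E F
              diameter_bounded_bound[OF EF(2) _ that(2), of y] dist_triangle[of u v y]
            by auto
          have nn: "0 \<le> diameter E" "0 \<le> diameter F"
            using EF by (auto intro: diameter_ge_0)
          have "dist u v \<le> diameter E + diameter F" if "u \<in> E \<union> F" "v \<in> E \<union> F" for u v
            using that diameter_bounded_bound[OF EF(1), of u v]
              diameter_bounded_bound[OF EF(2), of u v] mix[of u v] mix[of v u] nn
            by (auto simp: dist_commute)
          then show ?thesis
            unfolding diameter_def[of "E \<union> F"] using E by (auto intro!: cSUP_least)
        qed
        finally show ?thesis .
      qed
      have "mazurkiewicz_dist \<Omega> x z - diameter F \<le> mazurkiewicz_dist \<Omega> x y" if "F \<in> ?\<E> y z" for F
      proof -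
        have "mazurkiewicz_dist \<Omega> x z - diameter F \<le> (INF E \<in> ?\<E> x y. diameter E)"
          by (intro cINF_greatest ne[OF xy]) (use *[OF _ that] in \<open>simp add: algebra_simps\<close>)
        then show ?thesis
          using False xy by (simp add: mazurkiewicz_dist_def[of _ x y])
      qed
      then have "mazurkiewicz_dist \<Omega> x z - mazurkiewicz_dist \<Omega> x y \<le> (INF F \<in> ?\<E> y z. diameter F)"
        by (intro cINF_greatest ne[OF xy(2) z]) (simp add: algebra_simps)
      then show ?thesis
        using False xy z by (simp add: mazurkiewicz_dist_def[of _ y z])
    qed
  qed
qed


lemma bounded_ext_complex: "bounded (S :: ext_complex set)"
proof -
  have "dist p q \<le> pi" for p q :: ext_complex
    using arccos_ubound[of "to_sphere p \<bullet> to_sphere q"]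
      Cauchy_Schwarz_ineq2[of "to_sphere p" "to_sphere q"]
    by (simp add: dist_ext_complex_def abs_le_iff)
  then show ?thesis
    unfolding bounded_def by blast
qed

end

theory Submission
  imports Defs
begin

text \<open>
  Conditions (2), (4), (5) and (6) are equivalent in every compact, locally connected ambient space,
  and (4) implies (3) by concatenating infinitely many small paths. The implications (1) to (4),
  (3) to (4) and (5) to (1) use the topology of the plane, to which the sphere punctured at a point
  of \<open>\<Omega>\<close> is homeomorphic. In each of them a failure produces infinitely many disjoint continua,
  all of which run from near a point \<open>u\<close> to near a point \<open>v\<close> and pass near a third point \<open>x\<close>.
  The hypothesis at \<open>x\<close> then ties three of them together near \<open>x\<close> without meeting them elsewhere,
  which would embed the graph \<open>K_{3,3}\<close> in the plane.
  For (5) to (1) this yields that the components of the boundary are locally connected,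
  and they are Peano continua by the Hahn-Mazurkiewicz theorem.
\<close>

section \<open>Finite connectedness at the boundary and Property S\<close>

text \<open>The hypothesis cannot be applied at \<open>u\<close> or \<open>v\<close>: a third vertex
  is needed, away from both. Each continuum is connected and so passes points halfway between;
  \<open>x\<close> is a limit of such points. The third vertex must be a connected set that reaches
  three continua without stray contacts. Under (3) it consists of arcs ending at \<open>x\<close>,
  under (5) it comes from a component whose closure contains infinitely many of the halfway points,
  and under (1) it is a small piece of the boundary around \<open>x\<close>. Puncturing at a point
  of \<Omega> makes the boundary compact in the plane and leaves an open set with unbounded
  components only. Hence the components of its trace on a disc cannot stay near the centre, which
  gives the continua that refute (4) their length. The chart does not preserve the metric. Only (4)
  is carried over as an equivalence; (3) is weakened to small continua that stay connected without
  their end point, (1) passes by uniform continuity on a compact set, and (5) is regained from (4)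
  in the plane.\<close>

lemma LIMSEQ_of_dist_less_inverse_Suc:
  assumes "\<And>n. dist p (x n) < inverse (real (Suc n))"
  shows "x \<longlonglongrightarrow> p"
proof (rule metric_LIMSEQ_I)
  fix e :: real assume "e > 0"
  then obtain N where N: "inverse (real (Suc N)) < e"
    using reals_Archimedean by blast
  have "dist (x n) p < e" if "n \<ge> N" for n
  proof -
    have "dist (x n) p < inverse (real (Suc n))"
      using assms[of n] by (simp add: dist_commute)
    also have "\<dots> \<le> inverse (real (Suc N))"
      using that by (simp add: le_imp_inverse_le)
    finally show ?thesis
      using N by simp
  qed
  then show "\<exists>N. \<forall>n\<ge>N. dist (x n) p < e"
    by blast
qed

lemma open_component:
  assumes "locally connected (UNIV :: 'a::metric_space set)" "open S" "C \<in> components (S :: 'a set)"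
  shows "open C"
  using assms locally_connected_open_component[of "UNIV :: 'a set"] by auto

lemma component_between:
  assumes "connected T" "T \<subseteq> S" "C \<in> components S" "T \<inter> C \<noteq> {}"
  shows "T \<subseteq> C"
  using assms components_maximal by blast

text \<open>Finitely many finite fibres cannot cover all indices, so the range is infinite;
  enumerating a transversal of the fibres in increasing order gives the subsequence.\<close>

lemma finite_fibres_subsequence:
  fixes f :: "nat \<Rightarrow> 'b"
  assumes "\<And>m. finite {n. f n = f m}"
  obtains s where "strict_mono (s :: nat \<Rightarrow> nat)" "inj (f \<circ> s)"
proof -
  have "infinite (range f)"
  proof
    assume fin: "finite (range f)"
    have "UNIV = (\<Union>y\<in>range f. {n. f n = y})"
      by auto
    moreover have "finite (\<Union>y\<in>range f. {n. f n = y})"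
      using fin assms by blast
    ultimately show False
      by simp
  qed
  moreover obtain I where I: "inj_on f I" "range f = f ` I"
    using subset_image_inj[of "range f" f UNIV] by auto
  ultimately have inf: "infinite I"
    by auto
  have "inj (f \<circ> enumerate I)"
    using I(1) enumerate_in_set[OF inf] strict_mono_eq[OF strict_mono_enumerate[OF inf]]
    by (intro injI) (metis comp_apply inj_on_def)
  then show thesis
    using that strict_mono_enumerate[OF inf] by blast
qed

text \<open>Open neighbourhoods instead of discs, and connected sets instead of components: together
  with \<open>lsaI\<close> this frees the condition from the metric, so that the chart can transport
  it.\<close>

lemma lsaD:
  assumes lsa: "locally_sequentially_accessible \<Omega> p" and "open V" "p \<in> V" "\<And>n. \<xi> n \<in> \<Omega>" "\<xi> \<longlonglongrightarrow> p"
  obtains C where "connected C" "C \<subseteq> \<Omega> \<inter> V" "infinite {n. \<xi> n \<in> C}"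
proof -
  obtain r where "r > 0" "ball p r \<subseteq> V"
    using assms openE by blast
  then show thesis
    using lsa assms(4,5) that in_components_connected in_components_subset
    unfolding locally_sequentially_accessible_def by (meson dual_order.trans inf_mono subset_refl)
qed

lemma lsaI:
  assumes "\<And>r \<xi>. \<lbrakk>r > 0; \<And>n. \<xi> n \<in> \<Omega>; \<xi> \<longlonglongrightarrow> p\<rbrakk> \<Longrightarrow>
             \<exists>C. connected C \<and> C \<subseteq> \<Omega> \<inter> ball p r \<and> infinite {n. \<xi> n \<in> C}"
  shows "locally_sequentially_accessible \<Omega> p"
  unfolding locally_sequentially_accessible_def
proof (intro allI impI)
  fix r :: real and \<xi> assume "r > 0" and \<xi>: "(\<forall>n. \<xi> n \<in> \<Omega>) \<and> \<xi> \<longlonglongrightarrow> p"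
  then obtain C where C: "connected C" "C \<subseteq> \<Omega> \<inter> ball p r" "infinite {n. \<xi> n \<in> C}"
    using assms by blast
  then have "C \<noteq> {}"
    by auto
  then obtain D where "D \<in> components (\<Omega> \<inter> ball p r)" "C \<subseteq> D"
    using exists_component_superset[OF C(2) _ C(1)] C(2) by auto
  moreover have "{n. \<xi> n \<in> C} \<subseteq> {n. \<xi> n \<in> D}"
    using \<open>C \<subseteq> D\<close> by auto
  ultimately show "\<exists>C\<in>components (\<Omega> \<inter> ball p r). infinite {n. \<xi> n \<in> C}"
    using C(3) infinite_super by blast
qed

text \<open>Each component catches only finitely many terms, so a subsequence visits pairwise
  different components. The last clause expresses this without naming components.\<close>

lemma not_lsa_sequence:
  assumes "\<not> locally_sequentially_accessible \<Omega> p"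
  obtains r \<xi> where "r > 0" "\<And>n. \<xi> n \<in> \<Omega> \<inter> ball p r" "\<xi> \<longlonglongrightarrow> p"
    "\<And>m n S. \<lbrakk>connected S; S \<subseteq> \<Omega> \<inter> ball p r; \<xi> m \<in> S; \<xi> n \<in> S\<rbrakk> \<Longrightarrow> m = n"
proof -
  obtain r \<xi> where "r > 0" and \<xi>: "\<And>n. \<xi> n \<in> \<Omega>" "\<xi> \<longlonglongrightarrow> p"
    and fin: "\<And>C. C \<in> components (\<Omega> \<inter> ball p r) \<Longrightarrow> finite {n. \<xi> n \<in> C}"
    using assms unfolding locally_sequentially_accessible_def by blast
  obtain N where N: "\<And>n. n \<ge> N \<Longrightarrow> \<xi> n \<in> ball p r"
    using metric_LIMSEQ_D[OF \<xi>(2) \<open>r > 0\<close>] by (auto simp: dist_commute)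
  define \<zeta> where "\<zeta> n = \<xi> (n + N)" for n
  have \<zeta>: "\<zeta> n \<in> \<Omega> \<inter> ball p r" for n
    using \<xi> N by (simp add: \<zeta>_def)
  define f where "f n = connected_component_set (\<Omega> \<inter> ball p r) (\<zeta> n)" for n
  have f: "f n \<in> components (\<Omega> \<inter> ball p r)" "\<zeta> n \<in> f n" for n
    using \<zeta> by (auto simp: f_def components_def)
  have "finite {n. f n = f m}" for m
  proof -
    have "(\<lambda>n. n + N) ` {n. f n = f m} \<subseteq> {n. \<xi> n \<in> f m}"
      using f(2) by (auto simp: \<zeta>_def)
    then show ?thesis
      using fin[OF f(1)] finite_subset finite_imageD inj_on_add' by (metis inj_on_subset subset_UNIV)
  qed
  then obtain s where s: "strict_mono (s :: nat \<Rightarrow> nat)" "inj (f \<circ> s)"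
    using finite_fibres_subsequence by blast
  have lim: "(\<lambda>n. \<zeta> (s n)) \<longlonglongrightarrow> p"
    using LIMSEQ_subseq_LIMSEQ[OF LIMSEQ_ignore_initial_segment[OF \<xi>(2), of N] s(1)]
    by (simp add: \<zeta>_def comp_def)
  have "m = n" if "connected S" "S \<subseteq> \<Omega> \<inter> ball p r" "\<zeta> (s m) \<in> S" "\<zeta> (s n) \<in> S" for m n S
  proof -
    have "connected_component (\<Omega> \<inter> ball p r) (\<zeta> (s m)) (\<zeta> (s n))"
      using that by (auto simp: connected_component_def)
    then have "f (s m) = f (s n)"
      unfolding f_def using connected_component_eq by (metis mem_Collect_eq)
    then show "m = n"
      using injD[OF s(2), of m n] by simp
  qed
  with lim \<zeta> \<open>r > 0\<close> show thesis
    using that[of r "\<lambda>n. \<zeta> (s n)"] by blast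
qed

text \<open>Pigeonhole over the finitely many components of \<open>U \<inter> \<Omega>\<close>. That
  \<open>U\<close> may fail to be a disc does no harm, because its components are connected subsets
  of \<open>\<Omega> \<inter> ball p r\<close>.\<close>

lemma finitely_connected_imp_lsa:
  assumes "finitely_connected_at \<Omega> p"
  shows "locally_sequentially_accessible \<Omega> p"
proof (rule lsaI)
  fix r :: real and \<xi> assume "r > 0" and \<xi>: "\<And>n. \<xi> n \<in> \<Omega>" "\<xi> \<longlonglongrightarrow> p"
  then obtain U where U: "open U" "p \<in> U" "U \<subseteq> ball p r" "finite (components (U \<inter> \<Omega>))"
    using assms unfolding finitely_connected_at_def by blast
  have "eventually (\<lambda>n. \<xi> n \<in> U) sequentially"
    using \<xi> U topological_tendstoD by blast
  then obtain N where N: "\<And>n. n \<ge> N \<Longrightarrow> \<xi> n \<in> U"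
    by (auto simp: eventually_sequentially)
  have "{N..} \<subseteq> (\<Union>C\<in>components (U \<inter> \<Omega>). {n. \<xi> n \<in> C})"
  proof
    fix n assume "n \<in> {N..}"
    then have "\<xi> n \<in> U \<inter> \<Omega>"
      using N \<xi> by simp
    then obtain C where "C \<in> components (U \<inter> \<Omega>)" "\<xi> n \<in> C"
      using Union_components by blast
    then show "n \<in> (\<Union>C\<in>components (U \<inter> \<Omega>). {n. \<xi> n \<in> C})"
      by auto
  qed
  moreover have "infinite {N..}"
    by (rule infinite_Ici)
  ultimately have "infinite (\<Union>C\<in>components (U \<inter> \<Omega>). {n. \<xi> n \<in> C})"
    using finite_subset by blast
  then obtain C where "C \<in> components (U \<inter> \<Omega>)" "infinite {n. \<xi> n \<in> C}"
    using U(4) by auto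
  then show "\<exists>C. connected C \<and> C \<subseteq> \<Omega> \<inter> ball p r \<and> infinite {n. \<xi> n \<in> C}"
    using U in_components_connected in_components_subset by (metis inf.commute inf_mono order.trans subset_refl)
qed

text \<open>The neighbourhood demanded by the definition is the small disc enlarged by all
  components of \<open>\<Omega> \<inter> ball p r\<close> that meet it: its trace on \<Omega> is
  exactly the union of these finitely many components, and local connectedness makes it
  open.\<close>

lemma finitely_connected_atI:
  fixes \<Omega> :: "'a::metric_space set"
  assumes lc: "locally connected (UNIV :: 'a set)" and "open \<Omega>"
    and "\<And>r. r > 0 \<Longrightarrow> \<exists>s>0. s \<le> r \<and> finite {C \<in> components (\<Omega> \<inter> ball p r). C \<inter> ball p s \<noteq> {}}"
  shows "finitely_connected_at \<Omega> p"
  unfolding finitely_connected_at_def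
proof (intro allI impI)
  fix r :: real assume "r > 0"
  then obtain s where s: "s > 0" "s \<le> r"
    and fin: "finite {C \<in> components (\<Omega> \<inter> ball p r). C \<inter> ball p s \<noteq> {}}" (is "finite ?F")
    using assms by blast
  define U where "U = ball p s \<union> \<Union>?F"
  have sub: "C \<subseteq> \<Omega> \<inter> ball p r" if "C \<in> ?F" for C
    using that in_components_subset by blast
  have "open C" if "C \<in> ?F" for C
    using that open_component[OF lc] \<open>open \<Omega>\<close> by blast
  then have "open U"
    by (auto simp: U_def)
  moreover have "p \<in> U" "U \<subseteq> ball p r"
    using s sub by (auto simp: U_def)
  moreover have eq: "U \<inter> \<Omega> = \<Union>?F"
  proof
    show "U \<inter> \<Omega> \<subseteq> \<Union>?F"
    proof
      fix x assume x: "x \<in> U \<inter> \<Omega>"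
      show "x \<in> \<Union>?F"
      proof (cases "x \<in> ball p s")
        case True
        then have "x \<in> \<Union>(components (\<Omega> \<inter> ball p r))"
          using x s by simp
        with True show ?thesis
          by blast
      qed (use x in \<open>auto simp: U_def\<close>)
    qed
    show "\<Union>?F \<subseteq> U \<inter> \<Omega>"
      using sub by (auto simp: U_def)
  qed
  have "components (U \<inter> \<Omega>) \<subseteq> ?F"
  proof
    fix D assume D: "D \<in> components (U \<inter> \<Omega>)"
    then obtain x where "x \<in> D"
      using in_components_nonempty by blast
    moreover have "D \<subseteq> \<Union>?F"
      using in_components_subset[OF D] unfolding eq .
    ultimately obtain C where C: "C \<in> ?F" "x \<in> C"
      by blast
    have "C \<subseteq> D"
    proof (rule component_between[OF _ _ D])
      show "connected C"
        using C by (auto intro: in_components_connected)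
      show "C \<subseteq> U \<inter> \<Omega>"
        unfolding eq using C by blast
    qed (use C \<open>x \<in> D\<close> in blast)
    moreover have "D \<subseteq> C"
      using C D \<open>x \<in> D\<close> in_components_connected in_components_subset eq sub
      by (intro component_between[of D "\<Omega> \<inter> ball p r" C]) blast+
    ultimately show "D \<in> ?F"
      using C by auto
  qed
  then have "finite (components (U \<inter> \<Omega>))"
    using fin finite_subset by blast
  ultimately show "\<exists>U. open U \<and> p \<in> U \<and> U \<subseteq> ball p r \<and> finite (components (U \<inter> \<Omega>))"
    by blast
qed

text \<open>Otherwise infinitely many components of \<open>\<Omega> \<inter> ball p r\<close> come
  arbitrarily close to \<open>p\<close>; points taken from a sequence of distinct ones tend to
  \<open>p\<close>, and no component contains two of them.\<close>

lemma lsa_imp_finitely_connected: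
  fixes \<Omega> :: "'a::metric_space set"
  assumes lc: "locally connected (UNIV :: 'a set)" and "open \<Omega>"
    and lsa: "locally_sequentially_accessible \<Omega> p"
  shows "finitely_connected_at \<Omega> p"
proof (rule finitely_connected_atI[OF lc \<open>open \<Omega>\<close>], rule ccontr)
  fix r :: real assume "r > 0"
  assume "\<not> (\<exists>s>0. s \<le> r \<and> finite {C \<in> components (\<Omega> \<inter> ball p r). C \<inter> ball p s \<noteq> {}})"
  then have inf: "infinite {C \<in> components (\<Omega> \<inter> ball p r). C \<inter> ball p s \<noteq> {}}" if "s > 0" "s \<le> r" for s
    using that by blast
  define s where "s n = min r (inverse (real (Suc n)))" for n
  have s: "s n > 0" "s n \<le> r" for n
    using \<open>r > 0\<close> by (auto simp: s_def)
  have pick: "\<exists>C x. C \<in> components (\<Omega> \<inter> ball p r) \<and> x \<in> C \<inter> ball p (s n) \<and> C \<notin> F" if "finite F" for F n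
  proof -
    have "\<exists>C. C \<in> {C \<in> components (\<Omega> \<inter> ball p r). C \<inter> ball p (s n) \<noteq> {}} \<and> C \<notin> F"
      using inf[OF s] that by (meson finite_subset subsetI)
    then show ?thesis
      by blast
  qed
  \<comment> \<open>The choice at stage \<open>n\<close> must avoid all earlier components, hence
    recursion over the whole initial segment.\<close>
  have "\<exists>C. \<forall>n. C n \<in> components (\<Omega> \<inter> ball p r) \<and> C n \<inter> ball p (s n) \<noteq> {} \<and> C n \<notin> C ` {..<n}"
  proof (rule dependent_wellorder_choice)
    fix n :: nat and f g :: "nat \<Rightarrow> 'a set" and C
    assume "\<And>i. i < n \<Longrightarrow> f i = g i"
    then have "f ` {..<n} = g ` {..<n}"
      by auto
    then show "(C \<in> components (\<Omega> \<inter> ball p r) \<and> C \<inter> ball p (s n) \<noteq> {} \<and> C \<notin> f ` {..<n})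
      \<longleftrightarrow> (C \<in> components (\<Omega> \<inter> ball p r) \<and> C \<inter> ball p (s n) \<noteq> {} \<and> C \<notin> g ` {..<n})"
      by simp
  next
    fix n :: nat and f :: "nat \<Rightarrow> 'a set"
    show "\<exists>C. C \<in> components (\<Omega> \<inter> ball p r) \<and> C \<inter> ball p (s n) \<noteq> {} \<and> C \<notin> f ` {..<n}"
      using pick[of "f ` {..<n}" n] by blast
  qed
  then obtain C where C: "\<And>n. C n \<in> components (\<Omega> \<inter> ball p r)" "\<And>n. C n \<inter> ball p (s n) \<noteq> {}"
    "\<And>n. C n \<notin> C ` {..<n}"
    by auto
  then have inj: "inj C"
    by (metis imageI injI lessThan_iff linorder_neqE_nat)
  have "\<forall>n. \<exists>x. x \<in> C n \<inter> ball p (s n)"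
    using C(2) by blast
  then obtain \<xi> where \<xi>: "\<And>n. \<xi> n \<in> C n \<inter> ball p (s n)"
    by metis
  have "\<xi> n \<in> \<Omega>" for n
    using \<xi> C(1) in_components_subset by blast
  moreover have "\<xi> \<longlonglongrightarrow> p"
    using \<xi> by (intro LIMSEQ_of_dist_less_inverse_Suc) (auto simp: s_def)
  ultimately obtain D where D: "D \<in> components (\<Omega> \<inter> ball p r)" "infinite {n. \<xi> n \<in> D}"
    using lsa \<open>r > 0\<close> unfolding locally_sequentially_accessible_def by blast
  have eqD: "C n = D" if "\<xi> n \<in> D" for n
    using that \<xi> D C(1) components_eq by blast
  obtain m where m: "\<xi> m \<in> D"
    using D(2) not_finite_existsD by blast
  obtain n where n: "n > m" "\<xi> n \<in> D"
    using D(2) unfolding infinite_nat_iff_unbounded by blast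
  show False
    using eqD[OF m] eqD[OF n(2)] inj n(1) by (auto dest: injD)
qed

text \<open>A piece of diameter less than \<open>r/3\<close> that meets the disc of radius
  \<open>r/3\<close> stays inside \<open>ball p r\<close> and, being connected, lies in one
  component. So every component that reaches the small disc contains one of the finitely many
  pieces.\<close>

lemma property_S_imp_finitely_connected:
  fixes \<Omega> :: "'a::metric_space set"
  assumes lc: "locally connected (UNIV :: 'a set)" and "open \<Omega>" "bounded \<Omega>" and S: "property_S \<Omega>"
  shows "finitely_connected_at \<Omega> p"
proof (rule finitely_connected_atI[OF lc \<open>open \<Omega>\<close>])
  fix r :: real assume "r > 0"
  then have "r / 3 > 0"
    by simp
  then obtain \<F> where fin: "finite \<F>" and un: "\<Union>\<F> = \<Omega>" and \<F>: "\<And>E. E \<in> \<F> \<Longrightarrow> connected E \<and> diameter E < r/3"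
    using S unfolding property_S_def by metis
  define h where "h E = (SOME C. C \<in> components (\<Omega> \<inter> ball p r) \<and> E \<subseteq> C)" for E
  have "{C \<in> components (\<Omega> \<inter> ball p r). C \<inter> ball p (r/3) \<noteq> {}} \<subseteq> h ` \<F>"
  proof clarify
    fix C assume C: "C \<in> components (\<Omega> \<inter> ball p r)" "C \<inter> ball p (r/3) \<noteq> {}"
    then obtain x where x: "x \<in> C" "x \<in> ball p (r/3)"
      by blast
    then obtain E where E: "E \<in> \<F>" "x \<in> E"
      using un C in_components_subset by blast
    then have "E \<subseteq> \<Omega>" "bounded E"
      using un \<open>bounded \<Omega>\<close> bounded_subset by blast+
    have "E \<subseteq> ball p r"
    proof
      fix y assume "y \<in> E"
      then have "dist x y < r/3"
        using diameter_bounded_bound[OF \<open>bounded E\<close> E(2)] \<F>[OF E(1)] by fastforce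
      then show "y \<in> ball p r"
        using x(2) dist_triangle[of p y x] \<open>r > 0\<close> by auto
    qed
    then have "E \<subseteq> C"
      using E \<open>E \<subseteq> \<Omega>\<close> \<F> x by (intro component_between[OF _ _ C(1)]) blast+
    have "C' = C" if "C' \<in> components (\<Omega> \<inter> ball p r) \<and> E \<subseteq> C'" for C'
      using components_eq[of C' _ C] that C(1) \<open>E \<subseteq> C\<close> E(2) by blast
    then have "h E = C"
      unfolding h_def using C(1) \<open>E \<subseteq> C\<close> by (metis (no_types, lifting) someI_ex)
    then show "C \<in> h ` \<F>"
      using E by blast
  qed
  then have "finite {C \<in> components (\<Omega> \<inter> ball p r). C \<inter> ball p (r/3) \<noteq> {}}"
    using fin finite_surj by blast
  then show "\<exists>s>0. s \<le> r \<and> finite {C \<in> components (\<Omega> \<inter> ball p r). C \<inter> ball p s \<noteq> {}}"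
    using \<open>r > 0\<close> by (intro exI[of _ "r/3"]) auto
qed

lemma diameter_le_of_subset_ball:
  assumes "S \<subseteq> cball p r" "0 \<le> r"
  shows "diameter S \<le> 2 * r"
proof -
  have "dist x y \<le> 2 * r" if "x \<in> S" "y \<in> S" for x y
  proof -
    have "dist p x \<le> r" "dist p y \<le> r"
      using subsetD[OF assms(1) that(1)] subsetD[OF assms(1) that(2)] by simp_all
    then show ?thesis
      using dist_triangle2[of x y p] by (simp only: dist_commute)
  qed
  then show ?thesis
    using assms(2) by (auto simp: diameter_def intro: cSUP_least)
qed

text \<open>Compactness of the closure reduces the claim to small neighbourhoods: near a point of
  \<Omega> one open connected set suffices, near a boundary point the finitely many components do.
  Sets inside a ball of radius \<open>e/3\<close> have diameter at most \<open>2 * e/3\<close>,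
  hence less than \<open>e\<close>.\<close>

lemma finitely_connected_imp_property_S:
  fixes \<Omega> :: "'a::metric_space set"
  assumes lc: "locally connected (UNIV :: 'a set)" and "open \<Omega>" "compact (closure \<Omega>)"
    and fc: "finitely_connected_at_boundary \<Omega>"
  shows "property_S \<Omega>"
  unfolding property_S_def
proof (intro allI impI)
  fix e :: real assume "e > 0"
  define P where "P U \<longleftrightarrow> open U \<and> (\<exists>\<F>. finite \<F> \<and> \<Union>\<F> = U \<inter> \<Omega> \<and> (\<forall>E\<in>\<F>. connected E \<and> diameter E < e))" for U
  have "\<exists>U. p \<in> U \<and> P U" if p: "p \<in> closure \<Omega>" for p
  proof (cases "p \<in> \<Omega>")
    case True
    define C where "C = connected_component_set (\<Omega> \<inter> ball p (e/3)) p"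
    have "p \<in> C" "C \<in> components (\<Omega> \<inter> ball p (e/3))" 
      using True \<open>e > 0\<close> by (auto simp: C_def components_def)
    then have "open C" "connected C"
      using open_component[OF lc _ \<open>C \<in> components _\<close>] \<open>open \<Omega>\<close> in_components_connected by auto
    have "C \<subseteq> \<Omega> \<inter> ball p (e/3)"
      using \<open>C \<in> components _\<close> by (rule in_components_subset)
    then have "C \<subseteq> \<Omega>" "C \<subseteq> cball p (e/3)"
      by auto
    then have "diameter C < e"
      using diameter_le_of_subset_ball[of C p "e/3"] \<open>e > 0\<close> by simp
    have "P C"
      unfolding P_def using \<open>open C\<close> \<open>connected C\<close> \<open>C \<subseteq> \<Omega>\<close> \<open>diameter C < e\<close>
      by (intro conjI exI[of _ "{C}"]) auto
    with \<open>p \<in> C\<close> show ?thesis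
      by blast
  next
    case False
    then have "p \<in> frontier \<Omega>"
      using p \<open>open \<Omega>\<close> by (simp add: frontier_def interior_open)
    then obtain U where U: "open U" "p \<in> U" "U \<subseteq> ball p (e/3)" "finite (components (U \<inter> \<Omega>))"
      using fc \<open>e > 0\<close> unfolding finitely_connected_at_boundary_def finitely_connected_at_def
      by (meson divide_pos_pos zero_less_numeral)
    have "diameter C < e" if "C \<in> components (U \<inter> \<Omega>)" for C
    proof -
      have "C \<subseteq> cball p (e/3)"
        using that U(3) in_components_subset ball_subset_cball by (metis inf.boundedE subset_trans)
      then show ?thesis
        using diameter_le_of_subset_ball[of C p "e/3"] \<open>e > 0\<close> by simp
    qed
    then have "P U"
      using U in_components_connected Union_components[of "U \<inter> \<Omega>"] unfolding P_def by metis
    with U show ?thesis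
      by blast
  qed
  then obtain V where V: "\<And>p. p \<in> closure \<Omega> \<Longrightarrow> p \<in> V p \<and> P (V p)"
    by metis
  then obtain D where D: "D \<subseteq> closure \<Omega>" "finite D" "closure \<Omega> \<subseteq> (\<Union>p\<in>D. V p)"
    using compactE_image[OF assms(3), of "closure \<Omega>" V] by (metis P_def UN_iff subsetI)
  have "\<forall>p\<in>D. \<exists>\<F>. finite \<F> \<and> \<Union>\<F> = V p \<inter> \<Omega> \<and> (\<forall>E\<in>\<F>. connected E \<and> diameter E < e)"
    using D V unfolding P_def by blast
  then obtain \<F> where \<F>: "\<And>p. p \<in> D \<Longrightarrow> finite (\<F> p) \<and> \<Union>(\<F> p) = V p \<inter> \<Omega> \<and> (\<forall>E\<in>\<F> p. connected E \<and> diameter E < e)"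
    by metis
  have "\<Union>(\<Union>p\<in>D. \<F> p) = (\<Union>p\<in>D. \<Union>(\<F> p))"
    by blast
  also have "\<dots> = (\<Union>p\<in>D. V p \<inter> \<Omega>)"
    using \<F> by simp
  also have "\<dots> = \<Omega>"
    using D(3) closure_subset[of \<Omega>] by blast
  finally have "\<Union>(\<Union>p\<in>D. \<F> p) = \<Omega>" .
  moreover have "finite (\<Union>p\<in>D. \<F> p)"
    using \<F> D(2) by simp
  moreover have "\<forall>E\<in>(\<Union>p\<in>D. \<F> p). connected E \<and> diameter E < e"
    using \<F> by simp
  ultimately show "\<exists>\<F>. finite \<F> \<and> \<Union>\<F> = \<Omega> \<and> (\<forall>E\<in>\<F>. connected E \<and> diameter E < e)"
    by metis
qed

section \<open>The Mazurkiewicz completion\<close>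

text \<open>In a complete space compactness means total boundedness, and that passes between a space
  and a dense subset; the dense copy of \<open>M\<close> in its completion is isometric to
  \<open>M\<close>.\<close>

lemma (in Metric_space) compact_completion_iff_mtotally_bounded:
  "compact_completion \<longleftrightarrow> mtotally_bounded M"
proof -
  interpret C: Metric_space completion_space completion_dist
    by (rule Metric_space_completion)
  have emb: "completion_embed ` M \<subseteq> completion_space"
    using completion_embed_space by blast
  have ball: "completion_embed y \<in> C.mball (completion_embed x) e \<longleftrightarrow> y \<in> mball x e" if "x \<in> M" "y \<in> M" for x y e
    using that completion_embed_isometry completion_embed_space by simp
  have "compact_completion \<longleftrightarrow> C.mtotally_bounded completion_space"
    unfolding compact_completion_def C.compact_space_eq_mcomplete_mtotally_bounded
    using completion_mcomplete by simp
  also have "\<dots> \<longleftrightarrow> C.mtotally_bounded (completion_embed ` M)"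
    using C.mtotally_bounded_closure_of_eq[OF emb] completion_dense by simp
  also have "\<dots> \<longleftrightarrow> mtotally_bounded M"
  proof
    assume tb: "C.mtotally_bounded (completion_embed ` M)"
    show "mtotally_bounded M"
      unfolding mtotally_bounded_def
    proof (intro allI impI)
      fix e :: real assume "e > 0"
      then obtain K where K: "finite K" "K \<subseteq> completion_embed ` M"
        "completion_embed ` M \<subseteq> (\<Union>x\<in>K. C.mball x e)"
        using tb[unfolded C.mtotally_bounded_def, rule_format, OF \<open>e > 0\<close>] by metis
      obtain L where L: "finite L" "L \<subseteq> M" "K = completion_embed ` L"
        using finite_subset_image[OF K(1,2)] by blast
      have "M \<subseteq> (\<Union>x\<in>L. mball x e)"
      proof
        fix y assume y: "y \<in> M"
        then obtain x where "x \<in> L" "completion_embed y \<in> C.mball (completion_embed x) e"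
          using K(3) L(3) by blast
        then show "y \<in> (\<Union>x\<in>L. mball x e)"
          using ball[of x y e] y L(2) by blast
      qed
      with L show "\<exists>K. finite K \<and> K \<subseteq> M \<and> M \<subseteq> (\<Union>x\<in>K. mball x e)"
        by blast
    qed
  next
    assume tb: "mtotally_bounded M"
    show "C.mtotally_bounded (completion_embed ` M)"
      unfolding C.mtotally_bounded_def
    proof (intro allI impI)
      fix e :: real assume "e > 0"
      then obtain K where K: "finite K" "K \<subseteq> M" "M \<subseteq> (\<Union>x\<in>K. mball x e)"
        using tb[unfolded mtotally_bounded_def, rule_format, OF \<open>e > 0\<close>] by metis
      have "completion_embed y \<in> (\<Union>x\<in>completion_embed ` K. C.mball x e)" if y: "y \<in> M" for y
      proof -
        obtain x where "x \<in> K" "y \<in> mball x e"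
          using K(3) y by blast
        then have "completion_embed y \<in> C.mball (completion_embed x) e"
          using ball[of x y e] y K(2) by blast
        with \<open>x \<in> K\<close> show ?thesis
          by blast
      qed
      then have "completion_embed ` M \<subseteq> (\<Union>x\<in>completion_embed ` K. C.mball x e)"
        by blast
      moreover have "finite (completion_embed ` K)" "completion_embed ` K \<subseteq> completion_embed ` M"
        using K by auto
      ultimately show "\<exists>K. finite K \<and> K \<subseteq> completion_embed ` M \<and> completion_embed ` M \<subseteq> (\<Union>x\<in>K. C.mball x e)"
        by metis
    qed
  qed
  finally show ?thesis .
qed

text \<open>An infimum lies below \<open>e\<close> exactly when some member does. For
  \<open>x = y\<close> the distance is 0 by convention, and the singleton is the witness on the
  right.\<close>

lemma mazurkiewicz_dist_less_iff:
  fixes \<Omega> :: "'a::metric_space set"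
  assumes "bounded \<Omega>" "connected \<Omega>" "x \<in> \<Omega>" "y \<in> \<Omega>" "e > 0"
  shows "mazurkiewicz_dist \<Omega> x y < e \<longleftrightarrow> (\<exists>E. connected E \<and> E \<subseteq> \<Omega> \<and> x \<in> E \<and> y \<in> E \<and> diameter E < e)"
proof (cases "x = y")
  case True
  then show ?thesis
    using assms by (auto simp: mazurkiewicz_dist_def intro!: exI[of _ "{x}"])
next
  case False
  let ?\<E> = "{E. connected E \<and> E \<subseteq> \<Omega> \<and> x \<in> E \<and> y \<in> E}"
  have "0 \<le> diameter E" if "E \<in> ?\<E>" for E
    using that bounded_subset[OF assms(1)] by (intro diameter_ge_0) auto
  then have "bdd_below (diameter ` ?\<E>)"
    by (meson bdd_belowI2)
  moreover have "?\<E> \<noteq> {}"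
    using assms by blast
  ultimately have "(INF E\<in>?\<E>. diameter E) < e \<longleftrightarrow> (\<exists>E\<in>?\<E>. diameter E < e)"
    by (intro cINF_less_iff)
  then show ?thesis
    using False assms by (auto simp: mazurkiewicz_dist_def)
qed

text \<open>Property S is total boundedness in the Mazurkiewicz metric. A connected piece of
  diameter less than \<open>e\<close> lies in the Mazurkiewicz ball of radius \<open>e\<close>
  around any of its points; conversely such a ball is connected, and its diameter in the original
  metric is at most twice its radius.\<close>

lemma property_S_iff_compact_completion:
  fixes \<Omega> :: "'a::metric_space set"
  assumes "bounded \<Omega>" "connected \<Omega>"
  shows "property_S \<Omega> \<longleftrightarrow> Metric_space.compact_completion \<Omega> (mazurkiewicz_dist \<Omega>)"
proof -
  interpret Metric_space \<Omega> "mazurkiewicz_dist \<Omega>"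
    using assms by (rule Metric_space_mazurkiewicz[rotated])
  note less = mazurkiewicz_dist_less_iff[OF assms]
  have "property_S \<Omega> \<longleftrightarrow> mtotally_bounded \<Omega>"
  proof
    assume S: "property_S \<Omega>"
    show "mtotally_bounded \<Omega>"
      unfolding mtotally_bounded_def
    proof (intro allI impI)
      fix e :: real assume "e > 0"
      then obtain \<F> where \<F>: "finite \<F>" "\<Union>\<F> = \<Omega>" "\<And>E. E \<in> \<F> \<Longrightarrow> connected E \<and> diameter E < e"
        using S unfolding property_S_def by metis
      define c where "c E = (SOME x. x \<in> E)" for E :: "'a set"
      have c: "c E \<in> E" if "E \<noteq> {}" for E
        unfolding c_def using that by (simp add: some_in_eq)
      define K where "K = c ` (\<F> - {{}})"
      have "finite K" "K \<subseteq> \<Omega>"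
        using \<F>(1,2) c by (auto simp: K_def)
      moreover have "\<Omega> \<subseteq> (\<Union>x\<in>K. mball x e)"
      proof
        fix y assume y: "y \<in> \<Omega>"
        then obtain E where E: "E \<in> \<F>" "y \<in> E"
          using \<F>(2) by blast
        then have "c E \<in> K" "c E \<in> E"
          using c by (auto simp: K_def)
        moreover have "mazurkiewicz_dist \<Omega> (c E) y < e"
          using less[of "c E" y e] E \<open>c E \<in> E\<close> \<open>e > 0\<close> \<F> y by blast
        ultimately show "y \<in> (\<Union>x\<in>K. mball x e)"
          using y \<open>K \<subseteq> \<Omega>\<close> by auto
      qed
      ultimately show "\<exists>K. finite K \<and> K \<subseteq> \<Omega> \<and> \<Omega> \<subseteq> (\<Union>x\<in>K. mball x e)"
        by blast
    qed
  next
    assume tb: "mtotally_bounded \<Omega>"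
    show "property_S \<Omega>"
      unfolding property_S_def
    proof (intro allI impI)
      fix e :: real assume "e > 0"
      then obtain K where K: "finite K" "K \<subseteq> \<Omega>" "\<Omega> \<subseteq> (\<Union>x\<in>K. mball x (e/3))"
        using tb unfolding mtotally_bounded_def by (meson divide_pos_pos zero_less_numeral)
      have "connected (mball x (e/3)) \<and> diameter (mball x (e/3)) < e" if "x \<in> K" for x
      proof
        have x: "x \<in> \<Omega>"
          using that K(2) by blast
        have "\<exists>E. connected E \<and> E \<subseteq> \<Omega> \<and> x \<in> E \<and> y \<in> E \<and> diameter E < e/3" if "y \<in> mball x (e/3)" for y
          using that less[OF x, of y "e/3"] \<open>e > 0\<close> by simp
        then obtain E where E: "\<And>y. y \<in> mball x (e/3) \<Longrightarrow> connected (E y) \<and> E y \<subseteq> \<Omega> \<and> x \<in> E y \<and> y \<in> E y \<and> diameter (E y) < e/3"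
          by metis
        \<comment> \<open>The joining sets never leave the ball: each of their points is joined to
          \<open>x\<close> by the same set. So the ball is a union of connected sets through
          \<open>x\<close>.\<close>
        have "mball x (e/3) = (\<Union>y\<in>mball x (e/3). E y)"
        proof (intro equalityI subsetI)
          fix z assume "z \<in> (\<Union>y\<in>mball x (e/3). E y)"
          then obtain y where y: "y \<in> mball x (e/3)" "z \<in> E y"
            by blast
          then have "z \<in> \<Omega>" "mazurkiewicz_dist \<Omega> x z < e/3"
            using E[OF y(1)] less[OF x, of z "e/3"] \<open>e > 0\<close> by auto
          then show "z \<in> mball x (e/3)"
            using x by simp
        qed (use E in blast)
        moreover have "connected (\<Union>y\<in>mball x (e/3). E y)"
          using E by (intro connected_Union) blast+
        ultimately show "connected (mball x (e/3))"
          by simp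
        have "mball x (e/3) \<subseteq> cball x (e/3)"
        proof
          fix y assume y: "y \<in> mball x (e/3)"
          then have "bounded (E y)"
            using E assms(1) bounded_subset by blast
          then show "y \<in> cball x (e/3)"
            using diameter_bounded_bound[of "E y" x y] E[OF y] by simp
        qed
        then show "diameter (mball x (e/3)) < e"
          using diameter_le_of_subset_ball[of "mball x (e/3)" x "e/3"] \<open>e > 0\<close> by simp
      qed
      moreover have "\<Union>((\<lambda>x. mball x (e/3)) ` K) = \<Omega>"
        using K(3) by auto
      ultimately show "\<exists>\<F>. finite \<F> \<and> \<Union>\<F> = \<Omega> \<and> (\<forall>E\<in>\<F>. connected E \<and> diameter E < e)"
        using K(1) by (intro exI[of _ "(\<lambda>x. mball x (e/3)) ` K"]) simp
    qed
  qed
  then show ?thesis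
    by (simp add: compact_completion_iff_mtotally_bounded)
qed

section \<open>Forbidden configurations in the plane\<close>

lemma arc_interior_point:
  assumes "arc g"
  obtains z where "z \<in> path_image g" "z \<noteq> pathstart g" "z \<noteq> pathfinish g"
proof
  show "g (1/2) \<in> path_image g"
    by (auto simp: path_image_def)
  have "inj_on g {0..1}"
    using assms by (simp add: arc_def)
  then show "g (1/2) \<noteq> pathstart g" "g (1/2) \<noteq> pathfinish g"
    unfolding pathstart_def pathfinish_def by (auto dest: inj_onD)
qed

text \<open>
  Let \<open>A i \<subseteq> R i\<close> be arcs from \<open>u\<close> to \<open>v\<close>, and let \<open>V\<close> be the complementary domain of the Jordan
  curve \<open>A 0 \<union> A 1\<close> that misses \<open>w\<close>. Neither \<open>A 0 \<union> A 2\<close> nor \<open>A 1 \<union> A 2\<close> separates \<open>V\<close> from \<open>w\<close>;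
  by Janiszewski's theorem their union does not either, although it contains the boundary of \<open>V\<close>.
\<close>

lemma no_theta_K33:
  fixes R T :: "nat \<Rightarrow> complex set"
  assumes "u \<noteq> v"
    and R: "\<And>i. i < 3 \<Longrightarrow> path_connected (R i)" "\<And>i. i < 3 \<Longrightarrow> u \<in> R i" "\<And>i. i < 3 \<Longrightarrow> v \<in> R i"
    and T: "\<And>i. i < 3 \<Longrightarrow> connected (T i)" "\<And>i. i < 3 \<Longrightarrow> w \<in> T i" "\<And>i. i < 3 \<Longrightarrow> R i - {u, v} \<subseteq> T i"
    and disj: "\<And>i j. \<lbrakk>i < 3; j < 3; i \<noteq> j\<rbrakk> \<Longrightarrow> T i \<inter> R j = {}"
  shows False
proof -
  have "\<exists>g. arc g \<and> path_image g \<subseteq> R i \<and> pathstart g = u \<and> pathfinish g = v" if "i < 3" for i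
    using R[OF that] \<open>u \<noteq> v\<close> by (simp add: path_connected_arcwise)
  then obtain g where g: "\<And>i. i < 3 \<Longrightarrow> arc (g i)" "\<And>i. i < 3 \<Longrightarrow> path_image (g i) \<subseteq> R i"
    "\<And>i. i < 3 \<Longrightarrow> pathstart (g i) = u" "\<And>i. i < 3 \<Longrightarrow> pathfinish (g i) = v"
    by metis
  define A where "A i = path_image (g i)" for i
  have AR: "A i \<subseteq> R i" and compA: "compact (A i)" and conA: "connected (A i)"
    and uv: "u \<in> A i" "v \<in> A i" if "i < 3" for i
    using g[OF that] arc_imp_path[of "g i"] pathstart_in_path_image[of "g i"]
      pathfinish_in_path_image[of "g i"] unfolding A_def
    by (auto simp: compact_path_image connected_path_image)
  have AA: "A i \<inter> A j = {u, v}" if "i < 3" "j < 3" "i \<noteq> j" for i j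
    using AR[OF that(1)] AR[OF that(2)] T(3)[OF that(1)] disj[OF that] uv[OF that(1)] uv[OF that(2)] by blast
  have AT: "A i - {u, v} \<subseteq> T i" if "i < 3" for i
    using AR[OF that] T(3)[OF that] by blast
  have TA: "T i \<inter> A j = {}" if "i < 3" "j < 3" "i \<noteq> j" for i j
    using disj[OF that] AR[OF that(2)] by blast
  define J where "J = g 0 +++ reversepath (g 1)"
  have imJ: "path_image J = A 0 \<union> A 1"
    unfolding J_def A_def using g by (subst path_image_join) auto
  have J: "simple_path J" "pathfinish J = pathstart J"
    unfolding J_def using g AA[of 0 1] unfolding A_def
    by (auto intro!: simple_path_join_loop simp: arc_reversepath)
  note JC = Jordan_inside_outside[OF J, unfolded imJ]
  \<comment> \<open>Both sides of a Jordan curve have the curve as frontier, so the side can be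
    chosen according to the position of \<open>w\<close>.\<close>
  have "\<exists>V. open V \<and> connected V \<and> V \<noteq> {} \<and> w \<notin> V \<and> V \<inter> (A 0 \<union> A 1) = {} \<and> frontier V = A 0 \<union> A 1"
  proof (cases "w \<in> inside (A 0 \<union> A 1)")
    case True
    then have "w \<notin> outside (A 0 \<union> A 1)"
      using JC by blast
    then show ?thesis
      using JC outside_no_overlap[of "A 0 \<union> A 1"] by (intro exI[of _ "outside (A 0 \<union> A 1)"]) auto
  next
    case False
    then show ?thesis
      using JC inside_no_overlap[of "A 0 \<union> A 1"] by (intro exI[of _ "inside (A 0 \<union> A 1)"]) auto
  qed
  then obtain V where V: "open V" "connected V" "V \<noteq> {}" "w \<notin> V" "V \<inter> (A 0 \<union> A 1) = {}"
    and frV: "frontier V = A 0 \<union> A 1"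
    by blast
  obtain a where a: "a \<in> V"
    using V(3) by blast
  \<comment> \<open>\<open>T 2\<close> contains \<open>w\<close>, which is outside \<open>V\<close>,
    and misses the frontier \<open>A 0 \<union> A 1\<close> of \<open>V\<close>; so it cannot enter
    \<open>V\<close>.\<close>
  have "T 2 \<inter> V = {}"
  proof (rule ccontr)
    assume "T 2 \<inter> V \<noteq> {}"
    moreover have "T 2 - V \<noteq> {}"
      using T(2)[of 2] V(4) by auto
    ultimately have "T 2 \<inter> frontier V \<noteq> {}"
      using connected_Int_frontier T(1)[of 2] by auto
    then show False
      using frV TA[of 2 0] TA[of 2 1] by auto
  qed
  then have A2V: "A 2 \<inter> V = {}"
    using AT[of 2] uv[of 0] V(5) by auto
  \<comment> \<open>An inner point \<open>z\<close> of the arc \<open>A k\<close> is a boundary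
    point of \<open>V\<close> and lies in \<open>T k\<close>; through it one passes from
    \<open>V\<close> to \<open>w\<close> without touching the other two arcs.\<close>
  have *: "connected_component (- (A i \<union> A 2)) a w" if i: "i < 2" "k < 2" "i \<noteq> k" for i k
  proof -
    have "arc (g k)" "pathstart (g k) = u" "pathfinish (g k) = v"
      using g i by auto
    then obtain z where z: "z \<in> A k" "z \<noteq> u" "z \<noteq> v"
      unfolding A_def using arc_interior_point by metis
    have k: "k = 0 \<or> k = 1" "i = 0 \<or> i = 1"
      using i by linarith+
    have "z \<in> T k"
      using AT[of k] z i by auto
    have "z \<in> closure V"
      using z frV k closure_Un_frontier[of V] by auto
    then have "connected (insert z V)"
      using V(2) connected_intermediate_closure[of V "insert z V"] closure_subset[of V] by auto
    then have "connected (insert z V \<union> T k)"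
      using T(1)[of k] i \<open>z \<in> T k\<close> by (intro connected_Un) auto
    moreover have "insert z V \<union> T k \<subseteq> - (A i \<union> A 2)"
    proof -
      have "T k \<inter> A i = {}" "T k \<inter> A 2 = {}"
        using TA[of k i] TA[of k 2] i by auto
      moreover have "V \<inter> A i = {}"
        using V(5) k by auto
      ultimately show ?thesis
        using A2V \<open>z \<in> T k\<close> by auto
    qed
    moreover have "w \<in> T k"
      using T(2)[of k] i by simp
    ultimately show ?thesis
      using a unfolding connected_component_def by blast
  qed
  \<comment> \<open>Janiszewski's theorem asks for a connected intersection of the two sets; here it
    is the arc \<open>A 2\<close>.\<close>
  have "(A 0 \<union> A 2) \<inter> (A 1 \<union> A 2) = A 2"
    using AA[of 0 1] uv[of 2] by auto
  moreover have "connected_component (- (A 0 \<union> A 2)) a w" "connected_component (- (A 1 \<union> A 2)) a w"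
    using *[of 0 1] *[of 1 0] by simp_all
  ultimately have "connected_component (- ((A 0 \<union> A 2) \<union> (A 1 \<union> A 2))) a w"
    using Janiszewski[of "A 0 \<union> A 2" "A 1 \<union> A 2" a w] compA[of 0] compA[of 1] compA[of 2] conA[of 2]
    by (simp add: compact_Un compact_imp_closed closed_Un)
  then obtain S where S: "connected S" "S \<subseteq> - ((A 0 \<union> A 2) \<union> (A 1 \<union> A 2))" "a \<in> S" "w \<in> S"
    unfolding connected_component_def by blast
  then have "S \<inter> frontier V \<noteq> {}"
    using a V(4) by (intro connected_Int_frontier) auto
  then show False
    using S(2) frV by auto
qed

text \<open>If the component of \<open>y\<close> missed the frontier of \<open>W'\<close>, the
  Sura-Bura theorem would enclose it in a compact relatively clopen part of
  \<open>F \<inter> closure W'\<close> inside \<open>W'\<close>, and that part would be clopen in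
  all of \<open>F\<close>. Compactness is asked only of the trace on \<open>closure W'\<close>,
  since \<open>F\<close> may be unbounded where this is applied.\<close>

lemma boundary_bumping:
  fixes F :: "'a::euclidean_space set"
  assumes "closed F" "connected F" "open W'" "compact (F \<inter> closure W')" "y \<in> F \<inter> W'" "\<not> F \<subseteq> W'"
  obtains F' where "connected F'" "compact F'" "F' \<subseteq> F \<inter> closure W'" "y \<in> F'" "F' \<inter> frontier W' \<noteq> {}"
proof -
  define X where "X = F \<inter> closure W'"
  define C where "C = connected_component_set X y"
  have y: "y \<in> X"
    using assms(5) closure_subset by (auto simp: X_def)
  have C: "C \<in> components X" "y \<in> C"
    using y by (auto simp: C_def components_def)
  have "compact X"
    using assms(4) by (simp add: X_def)
  have "compact C"
    using compact_components[OF \<open>compact X\<close> C(1)] .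
  have "C \<subseteq> X"
    using C in_components_subset by blast
  have "C \<inter> frontier W' \<noteq> {}"
  proof
    assume "C \<inter> frontier W' = {}"
    then have "C \<subseteq> W'"
      using \<open>C \<subseteq> X\<close> by (auto simp: X_def frontier_def interior_open[OF \<open>open W'\<close>])
    then obtain K where K: "openin (top_of_set X) K" "compact K" "C \<subseteq> K" "K \<subseteq> W'"
      using Sura_Bura_clopen_subset[OF _ C(1) \<open>compact C\<close> \<open>open W'\<close>]
        closed_imp_locally_compact[OF compact_imp_closed[OF \<open>compact X\<close>]] by blast
    obtain W where W: "open W" "K = X \<inter> W"
      using K(1) by (auto simp: openin_open)
    have "K = F \<inter> (W' \<inter> W)"
      using W(2) K(4) closure_subset[of W'] by (auto simp: X_def)
    then have "openin (top_of_set F) K"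
      using W(1) \<open>open W'\<close> by (simp add: openin_open_Int open_Int)
    moreover have "closedin (top_of_set F) K"
      using closed_subset[OF _ compact_imp_closed[OF K(2)]] \<open>K = F \<inter> (W' \<inter> W)\<close> by blast
    moreover have "K \<noteq> {}"
      using C K by blast
    ultimately have "K = F"
      using \<open>connected F\<close> by (auto simp: connected_clopen)
    then show False
      using K(4) assms(6) by blast
  qed
  moreover have "connected C"
    using C in_components_connected by blast
  ultimately show thesis
    using that[of C] \<open>compact C\<close> \<open>C \<subseteq> X\<close> C by (auto simp: X_def)
qed

text \<open>Boundary bumping is applied twice, to the exteriors of the two discs: the disc at
  \<open>u\<close> is cut away starting from a point near \<open>v\<close>, then the disc at
  \<open>v\<close> starting from the point gained on the circle around \<open>u\<close>. The emptied
  discs leave room for straight segments to the centres.\<close>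

lemma crossing_subcontinuum:
  fixes Q :: "'a::euclidean_space set"
  assumes Q: "compact Q" "connected Q" and meet: "Q \<inter> cball u \<rho> \<noteq> {}" "Q \<inter> cball v \<rho> \<noteq> {}"
    and "\<rho> > 0" "dist u v > 2 * \<rho>"
  obtains Q' where "compact Q'" "connected Q'" "Q' \<subseteq> Q" "Q' \<inter> ball u \<rho> = {}" "Q' \<inter> ball v \<rho> = {}"
    "Q' \<inter> sphere u \<rho> \<noteq> {}" "Q' \<inter> sphere v \<rho> \<noteq> {}"
proof -
  have disj: "cball u \<rho> \<inter> cball v \<rho> = {}"
    using assms(6) by (simp add: disjoint_cballI)
  have cl: "closure (- cball z \<rho>) = - ball z \<rho>" "frontier (- cball z \<rho>) = sphere z \<rho>" for z :: 'a
    using \<open>\<rho> > 0\<close> by (simp_all add: closure_complement frontier_complement)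
  obtain y where y: "y \<in> Q" "y \<in> cball v \<rho>"
    using meet by blast
  obtain F where F: "connected F" "compact F" "F \<subseteq> Q \<inter> closure (- cball u \<rho>)" "y \<in> F"
    "F \<inter> frontier (- cball u \<rho>) \<noteq> {}"
  proof (rule boundary_bumping[of Q "- cball u \<rho>" y])
    show "compact (Q \<inter> closure (- cball u \<rho>))"
      using Q by (intro compact_Int_closed) auto
    show "y \<in> Q \<inter> - cball u \<rho>" "\<not> Q \<subseteq> - cball u \<rho>"
      using y disj meet by blast+
  qed (use Q(2) compact_imp_closed[OF Q(1)] in auto)
  then obtain z where z: "z \<in> F" "z \<in> sphere u \<rho>"
    unfolding cl by blast
  obtain G where G: "connected G" "compact G" "G \<subseteq> F \<inter> closure (- cball v \<rho>)" "z \<in> G"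
    "G \<inter> frontier (- cball v \<rho>) \<noteq> {}"
  proof (rule boundary_bumping[of F "- cball v \<rho>" z])
    show "compact (F \<inter> closure (- cball v \<rho>))"
      using F by (intro compact_Int_closed) auto
    show "z \<in> F \<inter> - cball v \<rho>" "\<not> F \<subseteq> - cball v \<rho>"
      using y z disj F by (auto simp: sphere_cball subset_iff)
  qed (use F(1) compact_imp_closed[OF F(2)] in auto)
  show thesis
    using that[of G] G F z unfolding cl by blast
qed

text \<open>A continuum need not contain any arc; its thickening in the plane is open and connected,
  hence path connected. This is where the arcs of the theta graph come from.\<close>

definition nbhd :: "real \<Rightarrow> 'a::metric_space set \<Rightarrow> 'a set" where
  "nbhd k Q = (\<Union>q\<in>Q. ball q k)"

lemma nbhd_iff: "y \<in> nbhd k Q \<longleftrightarrow> (\<exists>q\<in>Q. dist q y < k)"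
  by (auto simp: nbhd_def)

lemma subset_nbhd: "k > 0 \<Longrightarrow> Q \<subseteq> nbhd k Q"
  by (force simp: nbhd_iff)

lemma open_nbhd: "open (nbhd k Q)"
  by (auto simp: nbhd_def)

text \<open>The thickening is the image of the connected set \<open>Q \<times> ball 0 k\<close>
  under addition.\<close>

lemma connected_nbhd:
  fixes Q :: "'a::real_normed_vector set"
  assumes "connected Q" "k > 0"
  shows "connected (nbhd k Q)"
proof -
  have "nbhd k Q = (\<lambda>(x, y). x + y) ` (Q \<times> ball 0 k)"
  proof (intro set_eqI iffI)
    fix z assume "z \<in> nbhd k Q"
    then obtain q where "q \<in> Q" "dist q z < k"
      by (auto simp: nbhd_iff)
    then show "z \<in> (\<lambda>(x, y). x + y) ` (Q \<times> ball 0 k)"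
      by (intro image_eqI[of _ _ "(q, z - q)"]) (simp_all add: dist_norm norm_minus_commute)
  next
    fix z assume "z \<in> (\<lambda>(x, y). x + y) ` (Q \<times> ball 0 k)"
    then obtain x y where "z = x + y" "x \<in> Q" "norm y < k"
      by auto
    then show "z \<in> nbhd k Q"
      unfolding nbhd_iff by (intro bexI[of _ x]) (simp_all add: dist_norm)
  qed
  then show ?thesis
    using assms by (auto intro!: connected_continuous_image connected_Times continuous_intros simp: case_prod_unfold)
qed

lemma disjoint_nbhds:
  fixes Q :: "'i \<Rightarrow> 'a::heine_borel set" and E :: "'i \<Rightarrow> 'a set"
  assumes "finite I" "\<And>i. i \<in> I \<Longrightarrow> compact (Q i)" "\<And>i. i \<in> I \<Longrightarrow> compact (E i)"
    and "\<And>i j. \<lbrakk>i \<in> I; j \<in> I; i \<noteq> j\<rbrakk> \<Longrightarrow> Q i \<inter> Q j = {}"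
    and "\<And>i j. \<lbrakk>i \<in> I; j \<in> I; i \<noteq> j\<rbrakk> \<Longrightarrow> E i \<inter> Q j = {}"
  obtains k where "k > 0" "\<And>i j. \<lbrakk>i \<in> I; j \<in> I; i \<noteq> j\<rbrakk> \<Longrightarrow> nbhd k (Q i) \<inter> nbhd k (Q j) = {}"
    "\<And>i j. \<lbrakk>i \<in> I; j \<in> I; i \<noteq> j\<rbrakk> \<Longrightarrow> E i \<inter> nbhd k (Q j) = {}"
proof -
  define P where "P = {p \<in> I \<times> I. fst p \<noteq> snd p}"
  have "\<exists>d>0. \<forall>x \<in> Q i \<union> E i. \<forall>y\<in>Q j. d \<le> dist x y" if "i \<in> I" "j \<in> I" "i \<noteq> j" for i j
  proof (rule separate_compact_closed)
    show "(Q i \<union> E i) \<inter> Q j = {}"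
      using assms(4,5)[OF that] by blast
  qed (use that assms(2,3) in \<open>auto intro: compact_Un compact_imp_closed\<close>)
  then have "\<exists>d>0. \<forall>x \<in> Q (fst p) \<union> E (fst p). \<forall>y\<in>Q (snd p). d \<le> dist x y" if "p \<in> P" for p
    using that by (auto simp: P_def)
  then obtain d where d: "\<And>p. p \<in> P \<Longrightarrow> d p > 0"
    "\<And>p x y. \<lbrakk>p \<in> P; x \<in> Q (fst p) \<union> E (fst p); y \<in> Q (snd p)\<rbrakk> \<Longrightarrow> d p \<le> dist x y"
    by metis
  \<comment> \<open>Half of the least distance, because two thickenings must stay apart. The 1 keeps
    the minimum defined when there are no pairs.\<close>
  define k where "k = Min (insert 1 (d ` P)) / 2"
  have fin: "finite (insert 1 (d ` P))"
    using assms(1) by (auto simp: P_def)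
  have "k > 0"
    unfolding k_def using fin d(1) by simp
  have k: "2 * k \<le> dist x y" if "i \<in> I" "j \<in> I" "i \<noteq> j" "x \<in> Q i \<union> E i" "y \<in> Q j" for i j x y
  proof -
    have p: "(i, j) \<in> P"
      using that by (simp add: P_def)
    then have "2 * k \<le> d (i, j)"
      unfolding k_def using fin by (simp add: Min_le)
    also have "\<dots> \<le> dist x y"
      using d(2)[OF p] that by simp
    finally show ?thesis .
  qed
  show thesis
  proof
    show "k > 0"
      by fact
    fix i j assume ij: "i \<in> I" "j \<in> I" "i \<noteq> j"
    show "nbhd k (Q i) \<inter> nbhd k (Q j) = {}"
    proof (rule ccontr)
      assume "nbhd k (Q i) \<inter> nbhd k (Q j) \<noteq> {}"
      then obtain z x y where "x \<in> Q i" "y \<in> Q j" "dist x z < k" "dist y z < k"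
        by (auto simp: nbhd_iff)
      then show False
        using k[OF ij, of x y] dist_triangle2[of x y z] by auto
    qed
    show "E i \<inter> nbhd k (Q j) = {}"
    proof (rule ccontr)
      assume "E i \<inter> nbhd k (Q j) \<noteq> {}"
      then obtain x y where "x \<in> E i" "y \<in> Q j" "dist y x < k"
        by (auto simp: nbhd_iff)
      then show False
        using k[OF ij, of x y] \<open>k > 0\<close> by (auto simp: dist_commute)
    qed
  qed
qed

text \<open>The distance to \<open>u\<close> determines the parameter on either segment, so a common
  point has equal parameters, and different end points then force it to be \<open>u\<close>.\<close>

lemma segments_from_centre_disjoint:
  fixes u :: "'a::real_inner"
  assumes "dist u a = \<rho>" "dist u b = \<rho>" "a \<noteq> b"
  shows "closed_segment u a \<inter> closed_segment u b = {u}"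
proof (intro equalityI subsetI)
  fix z assume "z \<in> closed_segment u a \<inter> closed_segment u b"
  then obtain s t where st: "z = (1 - s) *\<^sub>R u + s *\<^sub>R a" "0 \<le> s" "z = (1 - t) *\<^sub>R u + t *\<^sub>R b" "0 \<le> t"
    unfolding in_segment Int_iff by metis
  have s: "z = u + s *\<^sub>R (a - u)"
    unfolding st(1) by (simp add: algebra_simps)
  have t: "z = u + t *\<^sub>R (b - u)"
    unfolding st(3) by (simp add: algebra_simps)
  have "dist u z = s * \<rho>"
    using s st assms(1) by (simp add: dist_norm norm_minus_commute)
  moreover have "dist u z = t * \<rho>"
    using t st assms(2) by (simp add: dist_norm norm_minus_commute)
  ultimately have "s = t \<or> \<rho> = 0"
    by auto
  then show "z \<in> {u}"
    using s t assms by auto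
qed auto

text \<open>The sets \<open>Q i\<close> become the three edges joining \<open>u\<close> and \<open>v\<close> of a theta graph.\<close>

lemma no_K33:
  fixes Q E :: "nat \<Rightarrow> complex set"
  assumes "\<rho> > 0" "dist u v > 2 * \<rho>"
    and Q: "\<And>i. i < 3 \<Longrightarrow> compact (Q i)" "\<And>i. i < 3 \<Longrightarrow> connected (Q i)"
      "\<And>i. i < 3 \<Longrightarrow> Q i \<inter> ball u \<rho> = {}" "\<And>i. i < 3 \<Longrightarrow> Q i \<inter> ball v \<rho> = {}"
      "\<And>i. i < 3 \<Longrightarrow> Q i \<inter> sphere u \<rho> \<noteq> {}" "\<And>i. i < 3 \<Longrightarrow> Q i \<inter> sphere v \<rho> \<noteq> {}"
    and QQ: "\<And>i j. \<lbrakk>i < 3; j < 3; i \<noteq> j\<rbrakk> \<Longrightarrow> Q i \<inter> Q j = {}"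
    and E: "\<And>i. i < 3 \<Longrightarrow> compact (E i)" "\<And>i. i < 3 \<Longrightarrow> connected (E i)" "\<And>i. i < 3 \<Longrightarrow> w \<in> E i"
      "\<And>i. i < 3 \<Longrightarrow> E i \<inter> cball u \<rho> = {}" "\<And>i. i < 3 \<Longrightarrow> E i \<inter> cball v \<rho> = {}"
      "\<And>i. i < 3 \<Longrightarrow> E i \<inter> Q i \<noteq> {}"
    and EQ: "\<And>i j. \<lbrakk>i < 3; j < 3; i \<noteq> j\<rbrakk> \<Longrightarrow> E i \<inter> Q j = {}"
  shows False
proof -
  obtain k where "k > 0" and kQ: "\<And>i j. \<lbrakk>i < 3; j < 3; i \<noteq> j\<rbrakk> \<Longrightarrow> nbhd k (Q i) \<inter> nbhd k (Q j) = {}"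
    and kE: "\<And>i j. \<lbrakk>i < 3; j < 3; i \<noteq> j\<rbrakk> \<Longrightarrow> E i \<inter> nbhd k (Q j) = {}"
    using disjoint_nbhds[of "{..<3}" Q E] Q(1) E(1) QQ EQ by (auto simp: lessThan_iff)
  have "\<forall>i<3. \<exists>x. x \<in> Q i \<and> x \<in> sphere u \<rho>" "\<forall>i<3. \<exists>x. x \<in> Q i \<and> x \<in> sphere v \<rho>"
    using Q(5,6) by blast+
  then obtain a b where a: "\<And>i. i < 3 \<Longrightarrow> a i \<in> Q i" "\<And>i. i < 3 \<Longrightarrow> dist u (a i) = \<rho>"
    and b: "\<And>i. i < 3 \<Longrightarrow> b i \<in> Q i" "\<And>i. i < 3 \<Longrightarrow> dist v (b i) = \<rho>"
    by (metis mem_sphere)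
  define M where "M i = nbhd k (Q i)" for i
  \<comment> \<open>\<open>R i\<close> below is the thickened continuum with radii to both centres.
    \<open>T i\<close> is the same without \<open>u\<close> and \<open>v\<close>, enlarged by the
    connection \<open>E i\<close> to the third vertex.\<close>
  define T where "T i = M i \<union> E i \<union> (insert (a i) (open_segment u (a i)) \<union> insert (b i) (open_segment v (b i)))" for i
  define R where "R i = closed_segment u (a i) \<union> M i \<union> closed_segment v (b i)" for i
  have QM: "Q i \<subseteq> M i" for i
    unfolding M_def using \<open>k > 0\<close> by (rule subset_nbhd)
  have segu: "closed_segment u (a i) \<subseteq> cball u \<rho>" if "i < 3" for i
    using a(2)[OF that] \<open>\<rho> > 0\<close> by (intro closed_segment_subset) auto
  have segv: "closed_segment v (b i) \<subseteq> cball v \<rho>" if "i < 3" for i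
    using b(2)[OF that] \<open>\<rho> > 0\<close> by (intro closed_segment_subset) auto
  have cdisj: "cball u \<rho> \<inter> cball v \<rho> = {}"
    using assms(2) by (simp add: disjoint_cballI)
  \<comment> \<open>A radius that ends on \<open>Q j\<close> misses the other thickenings. Suppose
    \<open>z\<close> on it is within \<open>k\<close> of some \<open>q\<close> in
    \<open>Q i\<close>. As \<open>q\<close> is outside the open disc,
    \<open>dist z d = \<rho> - dist c z \<le> dist q z\<close>, so \<open>z\<close> is also within
    \<open>k\<close> of the end \<open>d\<close> and lies in two thickenings.\<close>
  have radial: "M i \<inter> closed_segment c d = {}"
    if ij: "i < 3" "j < 3" "i \<noteq> j" and c: "Q i \<inter> ball c \<rho> = {}" and d: "dist c d = \<rho>" "d \<in> Q j" for i j c d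
  proof (rule ccontr)
    assume "M i \<inter> closed_segment c d \<noteq> {}"
    then obtain z q where z: "z \<in> closed_segment c d" and q: "q \<in> Q i" "dist q z < k"
      by (auto simp: M_def nbhd_iff)
    have "dist c d = dist c z + dist z d"
      using z by (simp add: between_mem_segment[symmetric] between)
    moreover have "dist c q \<ge> \<rho>"
      using c q by (auto simp: disjoint_iff not_less)
    ultimately have "dist z d \<le> dist q z"
      using d dist_triangle[of c q z] by (simp add: dist_commute)
    then have "z \<in> nbhd k (Q j)"
      using q d by (auto simp: nbhd_iff dist_commute intro!: bexI[of _ d])
    moreover have "z \<in> nbhd k (Q i)"
      using q by (auto simp: nbhd_iff)
    ultimately show False
      using kQ[OF ij] by blast
  qed
  show False
  proof (rule no_theta_K33[of u v R T w])
    show "u \<noteq> v"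
      using assms(1,2) by auto
    fix i :: nat assume i: "i < 3"
    have aM: "a i \<in> M i" "b i \<in> M i"
      using a b i QM by blast+
    have cM: "connected (M i)"
      unfolding M_def using connected_nbhd Q(2)[OF i] \<open>k > 0\<close> .
    then have "path_connected (M i)"
      using open_nbhd by (intro connected_open_path_connected) (simp_all add: M_def)
    then have "path_connected (closed_segment u (a i) \<union> M i)"
      using aM by (intro path_connected_Un) auto
    then show "path_connected (R i)"
      unfolding R_def using aM by (intro path_connected_Un[of "_ \<union> _"]) auto
    show "u \<in> R i" "v \<in> R i"
      by (auto simp: R_def)
    \<comment> \<open>Half-open segments, because the closed ones would put \<open>u\<close> or
      \<open>v\<close> into \<open>T i\<close>.\<close>
    have half: "connected (insert d (open_segment c d))" for c d :: complex
    proof (cases "c = d")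
      case False
      then show ?thesis
        using segment_open_subset_closed[of c d] convex_connected[OF convex_open_segment[of c d]]
        by (rule_tac connected_intermediate_closure[of "open_segment c d"]) auto
    qed auto
    obtain y where "y \<in> E i" "y \<in> Q i"
      using E(6)[OF i] by blast
    then have "M i \<inter> E i \<noteq> {}"
      using QM by blast
    then have "connected (M i \<union> E i)"
      using cM E(2)[OF i] by (intro connected_Un)
    then have "connected ((M i \<union> E i) \<union> insert (a i) (open_segment u (a i)))"
      using half[of "a i" u] aM by (intro connected_Un[of "_ \<union> _"]) auto
    then have "connected ((M i \<union> E i \<union> insert (a i) (open_segment u (a i))) \<union> insert (b i) (open_segment v (b i)))"
      using half[of "b i" v] aM by (intro connected_Un[of "_ \<union> insert _ _"]) auto
    then show "connected (T i)"
      unfolding T_def by (simp only: Un_assoc)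
    show "w \<in> T i"
      using E(3)[OF i] by (simp add: T_def)
    show "R i - {u, v} \<subseteq> T i"
      by (auto simp: R_def T_def open_segment_def)
    fix j :: nat assume j: "j < 3" "i \<noteq> j"
    have ab: "a i \<noteq> a j" "b i \<noteq> b j"
      using a b i j QQ[OF i j] by (metis IntI empty_iff)+
    have sub: "insert (a i) (open_segment u (a i)) \<subseteq> closed_segment u (a i) - {u}"
      "insert (b i) (open_segment v (b i)) \<subseteq> closed_segment v (b i) - {v}"
      using a(2)[OF i] b(2)[OF i] \<open>\<rho> > 0\<close> by (auto simp: open_segment_def)
    have Mij: "M i \<inter> closed_segment u (a j) = {}" "M i \<inter> closed_segment v (b j) = {}"
      using radial[OF i j] Q(3,4)[OF i] a[OF j(1)] b[OF j(1)] by auto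
    have Mji: "M j \<inter> closed_segment u (a i) = {}" "M j \<inter> closed_segment v (b i) = {}"
      using radial[OF j(1) i] j Q(3,4)[OF j(1)] a[OF i] b[OF i] by auto
    have ME: "M i \<inter> M j = {}" "E i \<inter> M j = {}"
      using kQ[OF i j] kE[OF i j] by (auto simp: M_def)
    have Eij: "E i \<inter> closed_segment u (a j) = {}" "E i \<inter> closed_segment v (b j) = {}"
      using E(4,5)[OF i] segu[OF j(1)] segv[OF j(1)] by blast+
    have "(M i \<union> E i) \<inter> R j = {}"
      unfolding R_def using Mij ME Eij by blast
    moreover have "(closed_segment u (a i) - {u}) \<inter> R j = {}"
    proof -
      have "closed_segment u (a i) \<inter> closed_segment v (b j) = {}"
        using cdisj segu[OF i] segv[OF j(1)] by blast
      moreover have "closed_segment u (a i) \<inter> closed_segment u (a j) = {u}"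
        by (rule segments_from_centre_disjoint[OF a(2)[OF i] a(2)[OF j(1)] ab(1)])
      ultimately show ?thesis
        unfolding R_def using Mji(1) by blast
    qed
    moreover have "(closed_segment v (b i) - {v}) \<inter> R j = {}"
    proof -
      have "closed_segment v (b i) \<inter> closed_segment u (a j) = {}"
        using cdisj segv[OF i] segu[OF j(1)] by blast
      moreover have "closed_segment v (b i) \<inter> closed_segment v (b j) = {v}"
        by (rule segments_from_centre_disjoint[OF b(2)[OF i] b(2)[OF j(1)] ab(2)])
      ultimately show ?thesis
        unfolding R_def using Mji(2) by blast
    qed
    moreover have "T i \<subseteq> (M i \<union> E i) \<union> (closed_segment u (a i) - {u}) \<union> (closed_segment v (b i) - {v})"
      unfolding T_def using sub by blast
    ultimately show "T i \<inter> R j = {}"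
      by blast
  qed
qed

section \<open>Sequences of continua that accumulate at three points\<close>

lemma connected_dist_value:
  fixes S :: "'a::metric_space set"
  assumes "connected S" "x \<in> S" "y \<in> S" "dist p x \<le> t" "t \<le> dist p y"
  obtains z where "z \<in> S" "dist p z = t"
proof -
  have "connected (dist p ` S)"
    using assms(1) by (intro connected_continuous_image continuous_intros)
  then have "{dist p x..dist p y} \<subseteq> dist p ` S"
    using assms by (intro connected_contains_Icc) auto
  then have "t \<in> dist p ` S"
    using assms by auto
  then show thesis
    using that by auto
qed

lemma compact_convergent_subsequence:
  fixes X :: "nat \<Rightarrow> 'a::metric_space"
  assumes "compact K" "\<And>n. X n \<in> K"
  obtains l r where "l \<in> K" "strict_mono (r :: nat \<Rightarrow> nat)" "(\<lambda>n. X (r n)) \<longlonglongrightarrow> l"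
  using seq_compactE[OF compact_imp_seq_compact[OF assms(1)], of X] assms(2)
  by (auto simp: comp_def)

lemma LIMSEQ_subsequence:
  "\<lbrakk>X \<longlonglongrightarrow> l; strict_mono (r :: nat \<Rightarrow> nat)\<rbrakk> \<Longrightarrow> (\<lambda>n. X (r n)) \<longlonglongrightarrow> l"
  using LIMSEQ_subseq_LIMSEQ[of X l r] by (simp add: comp_def)

lemma LIMSEQ_in_open:
  assumes "X \<longlonglongrightarrow> l" "open U" "l \<in> U"
  obtains N :: nat where "\<And>n. n \<ge> N \<Longrightarrow> X n \<in> U"
  using topological_tendstoD[OF assms] by (auto simp: eventually_sequentially)

text \<open>A star of paths from one point of \<open>F\<close> to all the others.\<close>

lemma open_connected_compact_exhaustion:
  fixes G :: "'a::euclidean_space set"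
  assumes "open G" "connected G" "finite F" "F \<subseteq> G" "F \<noteq> {}"
  obtains C where "compact C" "connected C" "F \<subseteq> C" "C \<subseteq> G"
proof -
  have pc: "path_connected G"
    using assms connected_open_path_connected by blast
  obtain w where w: "w \<in> F"
    using assms by blast
  then have "\<exists>g. path g \<and> path_image g \<subseteq> G \<and> pathstart g = w \<and> pathfinish g = z" if "z \<in> F" for z
    using pc that assms(4) unfolding path_connected_def by blast
  then obtain g where g: "\<And>z. z \<in> F \<Longrightarrow> path (g z) \<and> path_image (g z) \<subseteq> G \<and> pathstart (g z) = w \<and> pathfinish (g z) = z"
    by metis
  define C where "C = (\<Union>z\<in>F. path_image (g z))"
  have gw: "w \<in> path_image (g z)" "z \<in> path_image (g z)" if "z \<in> F" for z
    using g[OF that] pathstart_in_path_image[of "g z"] pathfinish_in_path_image[of "g z"] by auto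
  have "compact C"
    using assms(3) g by (auto simp: C_def compact_path_image)
  moreover have "connected C"
    unfolding C_def
  proof (rule connected_Union)
    show "\<Inter> ((\<lambda>z. path_image (g z)) ` F) \<noteq> {}"
      using gw by blast
  qed (use g in \<open>auto simp: connected_path_image\<close>)
  moreover have "F \<subseteq> C" "C \<subseteq> G"
    using g gw by (auto simp: C_def)
  ultimately show thesis
    by (rule that)
qed

text \<open>
  Three of the sets \<open>P n\<close> and the union of the sets \<open>E i\<close> are branch sets of the
  excluded graph; its other two branch sets lie away from \<open>x\<close>.
\<close>

definition no_K33_near :: "(nat \<Rightarrow> complex set) \<Rightarrow> complex \<Rightarrow> real \<Rightarrow> bool" where
  "no_K33_near P x e \<longleftrightarrow>
     \<not> (\<exists>f E w. inj_on f {..<3::nat} \<and>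
          (\<forall>i<3. compact (E i) \<and> connected (E i) \<and> w \<in> E i \<and> E i \<subseteq> ball x e \<and> E i \<inter> P (f i) \<noteq> {} \<and>
            (\<forall>j<3. j \<noteq> i \<longrightarrow> E i \<inter> P (f j) = {})))"

lemma no_K33_nearD:
  assumes "no_K33_near P x e" "inj_on f {..<3::nat}"
    and "\<And>i. i < 3 \<Longrightarrow> compact (E i)" "\<And>i. i < 3 \<Longrightarrow> connected (E i)" "\<And>i. i < 3 \<Longrightarrow> w \<in> E i"
    and "\<And>i. i < 3 \<Longrightarrow> E i \<subseteq> ball x e" "\<And>i. i < 3 \<Longrightarrow> E i \<inter> P (f i) \<noteq> {}"
    and "\<And>i j. \<lbrakk>i < 3; j < 3; i \<noteq> j\<rbrakk> \<Longrightarrow> E i \<inter> P (f j) = {}"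
  shows False
proof -
  have "\<forall>i<3. compact (E i) \<and> connected (E i) \<and> w \<in> E i \<and> E i \<subseteq> ball x e \<and> E i \<inter> P (f i) \<noteq> {} \<and>
            (\<forall>j<3. j \<noteq> i \<longrightarrow> E i \<inter> P (f j) = {})"
    using assms(3-) by simp
  then show False
    using assms(1,2) unfolding no_K33_near_def by blast
qed

text \<open>Each continuum is cut down to a part outside the discs of radius \<open>\<rho>\<close>
  at \<open>u\<close> and \<open>v\<close>. This part has points at distance \<open>\<rho>\<close>
  and at least \<open>3 * \<rho>\<close> from \<open>u\<close>, hence one at distance
  \<open>2 * \<rho>\<close>, and these accumulate at some \<open>x\<close>. As \<open>x\<close> is
  at least \<open>2 * \<rho>\<close> away from both \<open>u\<close> and \<open>v\<close>,
  connections within \<open>ball x \<rho>\<close> do not meet the two discs, and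
  \<open>no_K33\<close> excludes them.\<close>

lemma continua_crossing_limit:
  fixes Q :: "nat \<Rightarrow> complex set"
  assumes Q: "\<And>n. compact (Q n)" "\<And>n. connected (Q n)"
    and disj: "\<And>m n. m \<noteq> n \<Longrightarrow> Q m \<inter> Q n = {}"
    and ab: "\<And>n. a n \<in> Q n" "\<And>n. b n \<in> Q n" "a \<longlonglongrightarrow> u" "b \<longlonglongrightarrow> v" "u \<noteq> v"
  obtains s P y x where "strict_mono (s :: nat \<Rightarrow> nat)"
    "\<And>n. compact (P n)" "\<And>n. connected (P n)" "\<And>n. P n \<subseteq> Q (s n)" "\<And>n. y n \<in> P n"
    "y \<longlonglongrightarrow> x" "dist u x = dist u v / 2"
    "no_K33_near P x (dist u v / 4)"
proof -
  define \<rho> where "\<rho> = dist u v / 4"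
  have \<rho>: "\<rho> > 0" "dist u v = 4 * \<rho>" "dist u v > 2 * \<rho>"
    using ab(5) by (simp_all add: \<rho>_def)
  obtain N1 where N1: "\<And>n. n \<ge> N1 \<Longrightarrow> a n \<in> ball u \<rho>"
    using LIMSEQ_in_open[OF ab(3) open_ball, of u \<rho>] \<rho> by auto
  obtain N2 where N2: "\<And>n. n \<ge> N2 \<Longrightarrow> b n \<in> ball v \<rho>"
    using LIMSEQ_in_open[OF ab(4) open_ball, of v \<rho>] \<rho> by auto
  define N where "N = max N1 N2"
  have "\<exists>P. compact P \<and> connected P \<and> P \<subseteq> Q (n + N) \<and> P \<inter> ball u \<rho> = {} \<and> P \<inter> ball v \<rho> = {} \<and>
      P \<inter> sphere u \<rho> \<noteq> {} \<and> P \<inter> sphere v \<rho> \<noteq> {}" for n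
  proof -
    have "n + N \<ge> N1" "n + N \<ge> N2"
      by (simp_all add: N_def)
    then have "a (n + N) \<in> Q (n + N) \<inter> cball u \<rho>" "b (n + N) \<in> Q (n + N) \<inter> cball v \<rho>"
      using N1 N2 ab(1,2) ball_subset_cball by blast+
    then show ?thesis
      using crossing_subcontinuum[OF Q(1) Q(2) _ _ \<rho>(1) \<rho>(3), of "n + N"] by (metis empty_iff)
  qed
  then obtain P where P: "\<And>n. compact (P n)" "\<And>n. connected (P n)" "\<And>n. P n \<subseteq> Q (n + N)"
    "\<And>n. P n \<inter> ball u \<rho> = {}" "\<And>n. P n \<inter> ball v \<rho> = {}"
    "\<And>n. P n \<inter> sphere u \<rho> \<noteq> {}" "\<And>n. P n \<inter> sphere v \<rho> \<noteq> {}"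
    by metis
  have "\<exists>y. y \<in> P n \<inter> sphere u (2 * \<rho>)" for n
  proof -
    obtain c d where c: "c \<in> P n" "dist u c = \<rho>" and d: "d \<in> P n" "dist v d = \<rho>"
      using P(6,7)[of n] by (metis disjoint_iff mem_sphere)
    have "2 * \<rho> \<le> dist u d"
      using dist_triangle2[of u v d] d \<rho> by (simp add: dist_commute)
    then obtain z where "z \<in> P n" "dist u z = 2 * \<rho>"
      using connected_dist_value[OF P(2) c(1) d(1), of u "2 * \<rho>"] c \<rho> by auto
    then show ?thesis
      by auto
  qed
  then obtain y0 where "\<And>n. y0 n \<in> P n \<inter> sphere u (2 * \<rho>)"
    by metis
  then have y0: "\<And>n. y0 n \<in> P n" "\<And>n. y0 n \<in> sphere u (2 * \<rho>)"
    by blast+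
  obtain x r where x: "x \<in> sphere u (2 * \<rho>)" and r: "strict_mono r" "(\<lambda>n. y0 (r n)) \<longlonglongrightarrow> x"
    using compact_convergent_subsequence[of _ y0, OF compact_sphere y0(2)] by blast
  have dux: "dist u x = 2 * \<rho>"
    using x by simp
  have dvx: "dist v x \<ge> 2 * \<rho>"
    using dist_triangle2[of u v x] dux \<rho> by simp
  show thesis
  proof (rule that[of "\<lambda>n. r n + N" "\<lambda>n. P (r n)" "\<lambda>n. y0 (r n)" x])
    show "strict_mono (\<lambda>n. r n + N)"
      using r(1) by (simp add: strict_mono_def)
    show "dist u x = dist u v / 2"
      using dux \<rho> by simp
    have sep: "ball x \<rho> \<inter> cball c \<rho> = {}" if c: "2 * \<rho> \<le> dist c x" for c
    proof (rule ccontr)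
      assume "ball x \<rho> \<inter> cball c \<rho> \<noteq> {}"
      then obtain z where "dist x z < \<rho>" "dist c z \<le> \<rho>"
        by auto
      then show False
        using c dist_triangle2[of c x z] by linarith
    qed
    show "no_K33_near (\<lambda>n. P (r n)) x (dist u v / 4)"
      unfolding no_K33_near_def
    proof (intro notI, elim exE conjE)
      fix f :: "nat \<Rightarrow> nat" and E w
      assume f: "inj_on f {..<3::nat}" and "\<forall>i<3. compact (E i) \<and> connected (E i) \<and> w \<in> E i \<and>
          E i \<subseteq> ball x (dist u v / 4) \<and> E i \<inter> P (r (f i)) \<noteq> {} \<and> (\<forall>j<3. j \<noteq> i \<longrightarrow> E i \<inter> P (r (f j)) = {})"
      then have E: "\<And>i. i < 3 \<Longrightarrow> compact (E i)" "\<And>i. i < 3 \<Longrightarrow> connected (E i)"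
        "\<And>i. i < 3 \<Longrightarrow> w \<in> E i" "\<And>i. i < 3 \<Longrightarrow> E i \<subseteq> ball x (dist u v / 4)"
        "\<And>i. i < 3 \<Longrightarrow> E i \<inter> P (r (f i)) \<noteq> {}"
        "\<And>i j. \<lbrakk>i < 3; j < 3; i \<noteq> j\<rbrakk> \<Longrightarrow> E i \<inter> P (r (f j)) = {}"
        by blast+
      show False
      proof (rule no_K33[of \<rho> u v "\<lambda>i. P (r (f i))" E w])
        fix i j :: nat assume ij: "i < 3" "j < 3" "i \<noteq> j"
        then have "f i \<noteq> f j"
          using f by (auto simp: inj_on_def)
        then have "r (f i) + N \<noteq> r (f j) + N"
          using strict_mono_eq[OF r(1)] by simp
        then show "P (r (f i)) \<inter> P (r (f j)) = {}"
          using disj P(3) by blast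
      next
        fix i :: nat assume i: "i < 3"
        have "E i \<subseteq> ball x \<rho>"
          using E(4)[OF i] by (simp add: \<rho>_def)
        then show "E i \<inter> cball u \<rho> = {}" "E i \<inter> cball v \<rho> = {}"
          using sep[of u] sep[of v] dux dvx by auto
      qed (use \<rho> P E in auto)
    qed
  qed (use P y0 r in auto)
qed

text \<open>Infinitely many such continua would contain pairs of distant points that accumulate at
  different \<open>u\<close> and \<open>v\<close>. Near the limit point \<open>x\<close>, finite
  connectedness gives a component \<open>G\<close> whose closure contains infinitely many of the
  \<open>y n\<close>. As a subset of \<Omega>, \<open>G\<close> meets none of the boundary continua,
  so a compact part of it, with short spurs to three of them, serves as the third vertex.\<close>

lemma finite_disjoint_boundary_continua:
  fixes \<Omega> :: "complex set"
  assumes "open \<Omega>" "compact (frontier \<Omega>)" and fc: "\<And>x. x \<in> frontier \<Omega> \<Longrightarrow> finitely_connected_at \<Omega> x"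
    and "e > 0" and \<Q>: "\<And>Q. Q \<in> \<Q> \<Longrightarrow> compact Q" "\<And>Q. Q \<in> \<Q> \<Longrightarrow> connected Q"
      "\<And>Q. Q \<in> \<Q> \<Longrightarrow> Q \<subseteq> frontier \<Omega>" "\<And>Q. Q \<in> \<Q> \<Longrightarrow> diameter Q > e"
    and disj: "\<And>A B. \<lbrakk>A \<in> \<Q>; B \<in> \<Q>; A \<noteq> B\<rbrakk> \<Longrightarrow> A \<inter> B = {}"
  shows "finite \<Q>"
proof (rule ccontr)
  assume "infinite \<Q>"
  then obtain q :: "nat \<Rightarrow> complex set" where q: "inj q" "range q \<subseteq> \<Q>"
    using infinite_countable_subset by blast
  then have q\<Q>: "q n \<in> \<Q>" for n
    by blast
  have "\<exists>c d. c \<in> q n \<and> d \<in> q n \<and> dist c d > e" for n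
    using diameter_lower_bounded[OF compact_imp_bounded[OF \<Q>(1)[OF q\<Q>]] \<open>e > 0\<close> \<Q>(4)[OF q\<Q>]] by blast
  then obtain c d where cd: "\<And>n. c n \<in> q n" "\<And>n. d n \<in> q n" "\<And>n. dist (c n) (d n) > e"
    by metis
  have cdK: "c n \<in> frontier \<Omega>" "d n \<in> frontier \<Omega>" for n
    using cd(1,2) \<Q>(3)[OF q\<Q>] by blast+
  obtain u r where r: "strict_mono r" "(\<lambda>n. c (r n)) \<longlonglongrightarrow> u"
    using compact_convergent_subsequence[of _ c, OF assms(2) cdK(1)] by blast
  obtain v t where t: "strict_mono t" "(\<lambda>n. d (r (t n))) \<longlonglongrightarrow> v"
    using compact_convergent_subsequence[OF assms(2), of "\<lambda>n. d (r n)"] cdK(2) by blast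
  have cl: "(\<lambda>n. c (r (t n))) \<longlonglongrightarrow> u"
    using LIMSEQ_subsequence[OF r(2) t(1)] .
  have "(\<lambda>n. dist (c (r (t n))) (d (r (t n)))) \<longlonglongrightarrow> dist u v"
    by (intro tendsto_intros cl t)
  then have "e \<le> dist u v"
    by (rule LIMSEQ_le_const) (use cd(3) in \<open>auto intro: less_imp_le exI[of _ 0]\<close>)
  then have "u \<noteq> v"
    using \<open>e > 0\<close> by auto
  have inj: "q (r (t m)) \<inter> q (r (t n)) = {}" if "m \<noteq> n" for m n
  proof -
    have "r (t m) \<noteq> r (t n)"
      using that strict_mono_eq[OF r(1)] strict_mono_eq[OF t(1)] by simp
    then show ?thesis
      using q(1) disj[OF q\<Q> q\<Q>] by (auto dest: injD)
  qed
  obtain s P y x where s: "strict_mono (s :: nat \<Rightarrow> nat)"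
    and P: "\<And>n. compact (P n)" "\<And>n. connected (P n)" "\<And>n. P n \<subseteq> q (r (t (s n)))" and y: "\<And>n. y n \<in> P n"
    "y \<longlonglongrightarrow> x" and no: "no_K33_near P x (dist u v / 4)"
    using continua_crossing_limit[of "\<lambda>n. q (r (t n))" "\<lambda>n. c (r (t n))" "\<lambda>n. d (r (t n))" u v,
        OF \<Q>(1)[OF q\<Q>] \<Q>(2)[OF q\<Q>] inj cd(1) cd(2) cl t(2) \<open>u \<noteq> v\<close>] by metis
  define \<rho> where "\<rho> = dist u v / 4"
  have "\<rho> > 0"
    using \<open>u \<noteq> v\<close> by (simp add: \<rho>_def)
  have PK: "P n \<subseteq> frontier \<Omega>" for n
    using P(3) \<Q>(3)[OF q\<Q>] by blast
  have PP: "P m \<inter> P n = {}" if "m \<noteq> n" for m n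
    using inj[of "s m" "s n"] that strict_mono_eq[OF s] P(3) by blast
  have "x \<in> frontier \<Omega>"
    using closed_sequentially[OF compact_imp_closed[OF assms(2)] _ y(2)] y(1) PK by blast
  then obtain U where U: "open U" "x \<in> U" "U \<subseteq> ball x \<rho>" "finite (components (U \<inter> \<Omega>))"
    using fc \<open>\<rho> > 0\<close> unfolding finitely_connected_at_def by blast
  obtain N where N: "\<And>n. n \<ge> N \<Longrightarrow> y n \<in> U"
    using LIMSEQ_in_open[OF y(2) U(1,2)] by blast
  \<comment> \<open>A boundary point in \<open>U\<close> is a limit of points of
    \<open>U \<inter> \<Omega>\<close>, and the closures of finitely many components form a closed
    set.\<close>
  have cover: "y n \<in> \<Union>(closure ` components (U \<inter> \<Omega>))" if "n \<ge> N" for n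
  proof -
    have "y n \<in> U \<inter> closure \<Omega>"
      using N[OF that] y(1)[of n] PK[of n] by (auto simp: frontier_def)
    then have "y n \<in> closure (U \<inter> \<Omega>)"
      using open_Int_closure_subset[OF U(1)] by blast
    moreover have "closure (U \<inter> \<Omega>) \<subseteq> \<Union>(closure ` components (U \<inter> \<Omega>))"
    proof (rule closure_minimal)
      show "U \<inter> \<Omega> \<subseteq> \<Union>(closure ` components (U \<inter> \<Omega>))"
        using Union_components[of "U \<inter> \<Omega>"] closure_subset by blast
      show "closed (\<Union>(closure ` components (U \<inter> \<Omega>)))"
        using U(4) by (intro closed_Union) auto
    qed
    ultimately show ?thesis
      by blast
  qed
  have "{N..} \<subseteq> (\<Union>G\<in>components (U \<inter> \<Omega>). {n. n \<ge> N \<and> y n \<in> closure G})"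
    using cover by fastforce
  then have "infinite (\<Union>G\<in>components (U \<inter> \<Omega>). {n. n \<ge> N \<and> y n \<in> closure G})"
    using infinite_Ici[of N] finite_subset by blast
  then obtain G where G: "G \<in> components (U \<inter> \<Omega>)" and inf: "infinite {n. n \<ge> N \<and> y n \<in> closure G}"
    using U(4) by auto
  define f where "f = enumerate {n. n \<ge> N \<and> y n \<in> closure G}"
  have f: "y (f i) \<in> closure G" "f i \<ge> N" for i
    using enumerate_in_set[OF inf, of i] by (auto simp: f_def)
  have injf: "f i \<noteq> f j" if "i \<noteq> j" for i j
    using strict_mono_eq[OF strict_mono_enumerate[OF inf]] that by (simp add: f_def)
  have "G \<subseteq> U \<inter> \<Omega>"
    using G by (rule in_components_subset)
  have "connected G"
    using G by (rule in_components_connected)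
  have "open G"
    using open_components[OF open_Int[OF U(1) \<open>open \<Omega>\<close>] G] .
  have GP: "G \<inter> P n = {}" for n
    using PK[of n] \<open>G \<subseteq> U \<inter> \<Omega>\<close> \<open>open \<Omega>\<close> by (auto simp: frontier_def interior_open)
  \<comment> \<open>\<open>W i\<close> avoids the competing continua, so that a short segment ending
    at \<open>y (f i)\<close> stays clear of them.\<close>
  define W where "W i = ball x \<rho> \<inter> (\<Inter>j\<in>{..<3} - {i}. - P (f j))" for i
  have "open (W i)" for i
    unfolding W_def using P(1) by (intro open_Int open_INT) (auto simp: compact_imp_closed)
  moreover have "y (f i) \<in> W i" for i
  proof -
    have "y (f i) \<notin> P (f j)" if "j \<noteq> i" for j
      using y(1)[of "f i"] PP[OF injf[OF that]] by blast
    then show ?thesis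
      using subsetD[OF U(3) N[OF f(2)]] by (auto simp: W_def)
  qed
  ultimately have "\<exists>e>0. ball (y (f i)) e \<subseteq> W i" for i
    by (meson openE)
  then obtain \<epsilon> where \<epsilon>: "\<And>i. \<epsilon> i > 0" "\<And>i. ball (y (f i)) (\<epsilon> i) \<subseteq> W i"
    by metis
  have "\<exists>g. g \<in> G \<and> dist g (y (f i)) < \<epsilon> i" for i
    using f(1)[of i] \<epsilon>(1)[of i] unfolding closure_approachable by blast
  then obtain g where g: "\<And>i. g i \<in> G" "\<And>i. dist (g i) (y (f i)) < \<epsilon> i"
    by metis
  obtain \<gamma> where \<gamma>: "compact \<gamma>" "connected \<gamma>" "g ` {..<3} \<subseteq> \<gamma>" "\<gamma> \<subseteq> G"
    using open_connected_compact_exhaustion[OF \<open>open G\<close> \<open>connected G\<close>, of "g ` {..<3}"] g(1)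
    by (metis finite_imageI finite_lessThan image_is_empty image_subsetI lessThan_empty_iff zero_neq_numeral)
  define E where "E i = \<gamma> \<union> closed_segment (g i) (y (f i))" for i
  have seg: "closed_segment (g i) (y (f i)) \<subseteq> W i" for i
  proof -
    have "closed_segment (g i) (y (f i)) \<subseteq> ball (y (f i)) (\<epsilon> i)"
      using g(2)[of i] \<epsilon>(1)[of i] by (intro closed_segment_subset) (auto simp: dist_commute)
    then show ?thesis
      using \<epsilon>(2) by blast
  qed
  show False
  proof (rule no_K33_nearD[OF no, of f E "g 0"])
    show "inj_on f {..<3}"
      using injf by (auto simp: inj_on_def)
    fix i :: nat assume i: "i < 3"
    show "compact (E i)"
      using \<gamma>(1) by (auto simp: E_def)
    show "connected (E i)"
      unfolding E_def using \<gamma>(2,3) i by (intro connected_Un) auto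
    show "g 0 \<in> E i"
      using \<gamma>(3) by (auto simp: E_def)
    show "E i \<subseteq> ball x (dist u v / 4)"
      using seg[of i] \<gamma>(4) \<open>G \<subseteq> U \<inter> \<Omega>\<close> U(3) by (auto simp: E_def W_def \<rho>_def)
    show "E i \<inter> P (f i) \<noteq> {}"
      using y(1)[of "f i"] by (auto simp: E_def)
    fix j :: nat assume "j < 3" "i \<noteq> j"
    then have "W i \<inter> P (f j) = {}"
      by (auto simp: W_def)
    then show "E i \<inter> P (f j) = {}"
      using seg[of i] \<gamma>(4) GP[of "f j"] by (auto simp: E_def)
  qed
qed

section \<open>Components near a point where sequential accessibility fails\<close>

lemma component_of_ball_reaches:
  fixes \<Omega> :: "'a::real_normed_vector set"
  assumes "open \<Omega>" "\<And>C. C \<in> components \<Omega> \<Longrightarrow> \<not> bounded C" "\<xi> \<in> \<Omega>" "dist p \<xi> \<le> t" "t < r"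
  obtains z where "z \<in> connected_component_set (\<Omega> \<inter> ball p r) \<xi>" "dist p z = t"
proof -
  define C where "C = connected_component_set (\<Omega> \<inter> ball p r) \<xi>"
  define D where "D = connected_component_set \<Omega> \<xi>"
  have C: "\<xi> \<in> C" "connected C" "open C" "C \<subseteq> \<Omega> \<inter> ball p r"
    using assms connected_component_subset[of "\<Omega> \<inter> ball p r" \<xi>] open_connected_component[of "\<Omega> \<inter> ball p r" \<xi>]
    by (simp_all add: C_def open_Int)
  have D: "\<xi> \<in> D" "connected D" "D \<in> components \<Omega>"
    using assms by (auto simp: D_def connected_component_refl componentsI)
  \<comment> \<open>If \<open>C\<close> stays within radius \<open>t < r\<close>, its limit points
    in \<open>D\<close> are still inside \<open>ball p r\<close> and so belong to \<open>C\<close>.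
    Then \<open>C\<close> is clopen in the component \<open>D\<close> of \<Omega>, and
    \<open>D\<close> would be bounded.\<close>
  have "\<exists>z\<in>C. dist p z \<ge> t"
  proof (rule ccontr)
    assume "\<not> (\<exists>z\<in>C. dist p z \<ge> t)"
    then have sub: "C \<subseteq> cball p t"
      by auto
    have "C \<subseteq> D"
      unfolding D_def using C by (intro connected_component_maximal) auto
    have "D \<inter> closure C \<subseteq> C"
    proof
      fix z assume z: "z \<in> D \<inter> closure C"
      then have "z \<in> cball p t"
        using closure_minimal[OF sub closed_cball] by blast
      then have "insert z C \<subseteq> \<Omega> \<inter> ball p r"
        using z C(4) in_components_subset[OF D(3)] \<open>t < r\<close> by auto
      moreover have "connected (insert z C)"
        using connected_intermediate_closure[OF C(2), of "insert z C"] z closure_subset[of C] by auto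
      ultimately have "insert z C \<subseteq> C"
        using connected_component_maximal[of \<xi> "insert z C"] C(1) by (simp add: C_def)
      then show "z \<in> C"
        by simp
    qed
    then have "C = D \<inter> closure C"
      using \<open>C \<subseteq> D\<close> closure_subset[of C] by blast
    then have "closedin (top_of_set D) C"
      by (metis closed_closure closedin_closed_Int)
    moreover have "openin (top_of_set D) C"
      using open_subset[OF \<open>C \<subseteq> D\<close> C(3)] .
    ultimately have "C = D"
      using D(2) C(1) unfolding connected_clopen by blast
    then have "bounded D"
      using sub bounded_cball bounded_subset by blast
    then show False
      using assms(2) D(3) by blast
  qed
  then obtain z where "z \<in> C" "dist p z \<ge> t"
    by blast
  then obtain z' where "z' \<in> C" "dist p z' = t"
    using connected_dist_value[OF C(2,1)] assms(4) by metis
  then show thesis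
    using that by (simp add: C_def)
qed

text \<open>The failing sequence sits in different components of
  \<open>\<Omega> \<inter> ball p r\<close>, and those that start inside radius \<open>r/2\<close>
  reach the circle of that radius. So the two end points are \<open>p\<close> and a point of this
  circle, which puts \<open>x\<close> at distance \<open>r/4\<close> and allows connections within
  \<open>r/8\<close>. The limit \<open>x\<close> is on the boundary because a point of \<Omega>
  would have a neighbourhood inside a single component.\<close>

lemma not_lsa_configuration:
  fixes \<Omega> :: "complex set"
  assumes "open \<Omega>" and unb: "\<And>C. C \<in> components \<Omega> \<Longrightarrow> \<not> bounded C"
    and "\<not> locally_sequentially_accessible \<Omega> p"
  obtains r C P y x where "r > 0"
    "\<And>n::nat. C n \<in> components (\<Omega> \<inter> ball p r)" "inj C" "\<And>n. C n \<inter> sphere p (r/2) \<noteq> {}"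
    "\<And>n. P n \<subseteq> C n" "\<And>n. compact (P n)" "\<And>n. y n \<in> P n" "y \<longlonglongrightarrow> x" "x \<in> frontier \<Omega>" "dist p x = r/4"
    "no_K33_near P x (r/8)"
proof -
  obtain r \<xi> where "r > 0" and \<xi>: "\<And>n. \<xi> n \<in> \<Omega> \<inter> ball p r" "\<xi> \<longlonglongrightarrow> p"
    and sep: "\<And>m n S. \<lbrakk>connected S; S \<subseteq> \<Omega> \<inter> ball p r; \<xi> m \<in> S; \<xi> n \<in> S\<rbrakk> \<Longrightarrow> m = n"
    using not_lsa_sequence[OF assms(3)] by metis
  define D where "D n = connected_component_set (\<Omega> \<inter> ball p r) (\<xi> n)" for n
  have D: "D n \<in> components (\<Omega> \<inter> ball p r)" "\<xi> n \<in> D n" for n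
    using \<xi>(1)[of n] by (auto simp: D_def componentsI connected_component_refl)
  have Dsub: "D n \<subseteq> \<Omega> \<inter> ball p r" and Dcon: "connected (D n)" for n
    using D(1) by (auto dest: in_components_subset in_components_connected)
  have Dop: "open (D n)" for n
    using open_components[OF open_Int[OF \<open>open \<Omega>\<close> open_ball] D(1)] .
  have Deq: "m = n" if "D m \<inter> D n \<noteq> {}" for m n
    using components_nonoverlap[OF D(1) D(1)] that sep[OF Dcon Dsub] D(2) by metis
  obtain N where N: "\<And>n. n \<ge> N \<Longrightarrow> \<xi> n \<in> ball p (r/2)"
    using LIMSEQ_in_open[OF \<xi>(2) open_ball, of p "r/2"] \<open>r > 0\<close> by auto
  have "\<exists>v. v \<in> D (n + N) \<and> v \<in> sphere p (r/2)" for n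
    using component_of_ball_reaches[OF \<open>open \<Omega>\<close> unb, of "\<xi> (n + N)" p "r/2" r] \<xi>(1)[of "n + N"]
      N[of "n + N"] \<open>r > 0\<close> by (auto simp: D_def)
  then obtain v where v: "\<And>n. v n \<in> D (n + N)" "\<And>n. v n \<in> sphere p (r/2)"
    by metis
  obtain V t where V: "V \<in> sphere p (r/2)" and t: "strict_mono t" "(\<lambda>n. v (t n)) \<longlonglongrightarrow> V"
    using compact_convergent_subsequence[of _ v, OF compact_sphere v(2)] by blast
  have "\<exists>Q. compact Q \<and> connected Q \<and> {\<xi> (t n + N), v (t n)} \<subseteq> Q \<and> Q \<subseteq> D (t n + N)" for n
    using open_connected_compact_exhaustion[OF Dop Dcon, of "{\<xi> (t n + N), v (t n)}" "t n + N"] D(2) v(1)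
    by (metis empty_subsetI finite.emptyI finite_insert insert_not_empty insert_subset)
  then obtain Q where Q: "\<And>n. compact (Q n)" "\<And>n. connected (Q n)" "\<And>n. \<xi> (t n + N) \<in> Q n"
    "\<And>n. v (t n) \<in> Q n" "\<And>n. Q n \<subseteq> D (t n + N)"
    by (metis insert_subset)
  have tinj: "t m + N \<noteq> t n + N" if "m \<noteq> n" for m n
    using that strict_mono_eq[OF t(1)] by simp
  have QQ: "Q m \<inter> Q n = {}" if "m \<noteq> n" for m n
    using Deq tinj[OF that] Q(5) by blast
  have lim: "(\<lambda>n. \<xi> (t n + N)) \<longlonglongrightarrow> p"
    using LIMSEQ_subsequence[OF LIMSEQ_ignore_initial_segment[OF \<xi>(2), of N] t(1)] .
  have "p \<noteq> V" "dist p V = r/2"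
    using V \<open>r > 0\<close> by auto
  obtain s P y x where s: "strict_mono (s :: nat \<Rightarrow> nat)"
    and P: "\<And>n. compact (P n)" "\<And>n. connected (P n)" "\<And>n. P n \<subseteq> Q (s n)" and y: "\<And>n. y n \<in> P n"
    "y \<longlonglongrightarrow> x" and x: "dist p x = dist p V / 2" and no: "no_K33_near P x (dist p V / 4)"
    using continua_crossing_limit[of Q "\<lambda>n. \<xi> (t n + N)" "\<lambda>n. v (t n)" p V, OF Q(1,2) QQ Q(3,4) lim t(2) \<open>p \<noteq> V\<close>]
    by blast
  define C where "C n = D (t (s n) + N)" for n
  have injC: "m = n" if "C m = C n" for m n
  proof -
    have "t (s m) + N = t (s n) + N"
      using that D(2) by (intro Deq) (auto simp: C_def)
    then show ?thesis
      using strict_mono_eq[OF t(1)] strict_mono_eq[OF s] by simp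
  qed
  have PC: "P n \<subseteq> C n" for n
    using P(3) Q(5) by (auto simp: C_def)
  have xr: "dist p x = r/4"
    using x \<open>dist p V = r/2\<close> by simp
  have "x \<notin> \<Omega>"
  proof
    assume "x \<in> \<Omega>"
    then have xB: "x \<in> \<Omega> \<inter> ball p r"
      using xr \<open>r > 0\<close> by simp
    define X where "X = connected_component_set (\<Omega> \<inter> ball p r) x"
    have X: "X \<in> components (\<Omega> \<inter> ball p r)" "x \<in> X"
      using xB by (auto simp: X_def componentsI connected_component_refl)
    have "open X"
      using open_components[OF open_Int[OF \<open>open \<Omega>\<close> open_ball] X(1)] .
    then obtain M where M: "\<And>n. n \<ge> M \<Longrightarrow> y n \<in> X"
      using LIMSEQ_in_open[OF y(2)] X(2) by blast
    have "C n = X" if "n \<ge> M" for n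
    proof -
      have "y n \<in> C n \<inter> X"
        using M[OF that] y(1)[of n] PC[of n] by blast
      then show ?thesis
        using components_eq[OF _ X(1), of "C n"] D(1) by (auto simp: C_def)
    qed
    then show False
      using injC[of M "Suc M"] by simp
  qed
  moreover have "x \<in> closure \<Omega>"
  proof -
    have "y n \<in> \<Omega>" for n
      using y(1)[of n] PC[of n] Dsub[of "t (s n) + N"] unfolding C_def by blast
    then show ?thesis
      unfolding closure_sequential using y(2) by blast
  qed
  ultimately have "x \<in> frontier \<Omega>"
    using \<open>open \<Omega>\<close> by (simp add: frontier_def interior_open)
  show thesis
  proof (rule that[of r C P y x])
    show "inj C"
      using injC by (rule injI)
    show "C n \<inter> sphere p (r/2) \<noteq> {}" for n
      using v[of "t (s n)"] by (auto simp: C_def)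
    have "dist p V / 4 = r/8"
      using \<open>dist p V = r/2\<close> by simp
    then show "no_K33_near P x (r/8)"
      using no by metis
  qed (use \<open>r > 0\<close> D PC P y \<open>x \<in> frontier \<Omega>\<close> xr in \<open>auto simp: C_def\<close>)
qed

text \<open>The third vertex is \<open>x\<close> itself, connected by the sets \<open>E n\<close>.
  As \<open>E n - {x}\<close> is connected, inside \<Omega> and inside \<open>ball p r\<close>, it
  stays in the component of \<open>y (N + n)\<close> and so misses the other continua. Connectedness
  after removal of \<open>x\<close> is the property of an arc on which this rests.\<close>

lemma planar_accessible_imp_lsa:
  fixes \<Omega> :: "complex set"
  assumes "open \<Omega>" "\<And>C. C \<in> components \<Omega> \<Longrightarrow> \<not> bounded C"
    and acc: "\<And>x e. \<lbrakk>x \<in> frontier \<Omega>; e > 0\<rbrakk> \<Longrightarrow> \<exists>\<delta>>0. \<forall>y\<in>\<Omega> \<inter> ball x \<delta>.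
      \<exists>E. compact E \<and> connected E \<and> x \<in> E \<and> y \<in> E \<and> E \<subseteq> ball x e \<and> E - {x} \<subseteq> \<Omega> \<and> connected (E - {x})"
  shows "locally_sequentially_accessible \<Omega> p"
proof (rule ccontr)
  assume "\<not> locally_sequentially_accessible \<Omega> p"
  then obtain r C P y x where "r > 0"
    and C: "\<And>n::nat. C n \<in> components (\<Omega> \<inter> ball p r)" "inj C"
    and P: "\<And>n. P n \<subseteq> C n" "\<And>n. y n \<in> P n" and x: "y \<longlonglongrightarrow> x" "x \<in> frontier \<Omega>" "dist p x = r/4"
    and no: "no_K33_near P x (r/8)"
    using not_lsa_configuration[OF assms(1,2), of p] by metis
  obtain \<delta> where \<delta>: "\<delta> > 0" "\<And>y. y \<in> \<Omega> \<inter> ball x \<delta> \<Longrightarrow>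
      \<exists>E. compact E \<and> connected E \<and> x \<in> E \<and> y \<in> E \<and> E \<subseteq> ball x (r/8) \<and> E - {x} \<subseteq> \<Omega> \<and> connected (E - {x})"
    using acc[OF x(2), of "r/8"] \<open>r > 0\<close> by auto
  obtain N where N: "\<And>n. n \<ge> N \<Longrightarrow> y n \<in> ball x \<delta>"
    using LIMSEQ_in_open[OF x(1) open_ball, of x \<delta>] \<delta>(1) by auto
  have C': "C n \<subseteq> \<Omega> \<inter> ball p r" for n
    using C(1) by (rule in_components_subset)
  have "y n \<in> \<Omega>" for n
    using P C' by blast
  then have "\<exists>E. compact E \<and> connected E \<and> x \<in> E \<and> y (N + n) \<in> E \<and> E \<subseteq> ball x (r/8) \<and> E - {x} \<subseteq> \<Omega> \<and>
      connected (E - {x})" for n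
    using \<delta>(2)[of "y (N + n)"] N[of "N + n"] by simp
  then obtain E where E: "\<And>n. compact (E n)" "\<And>n. connected (E n)" "\<And>n. x \<in> E n" "\<And>n. y (N + n) \<in> E n"
    "\<And>n. E n \<subseteq> ball x (r/8)" "\<And>n. E n - {x} \<subseteq> \<Omega>" "\<And>n. connected (E n - {x})"
    by metis
  have "x \<notin> \<Omega>"
    using x(2) \<open>open \<Omega>\<close> by (simp add: frontier_def interior_open)
  have EC: "E n - {x} \<subseteq> C (N + n)" for n
  proof (rule component_between[OF E(7) _ C(1)])
    have "ball x (r/8) \<subseteq> ball p r"
      using x(3) \<open>r > 0\<close> by (intro ball_subset_ball_iff[THEN iffD2] disjI1) (simp add: dist_commute)
    then show "E n - {x} \<subseteq> \<Omega> \<inter> ball p r"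
      using E(5,6)[of n] by blast
    show "(E n - {x}) \<inter> C (N + n) \<noteq> {}"
      using E(4)[of n] P[of "N + n"] C'[of "N + n"] \<open>x \<notin> \<Omega>\<close> by blast
  qed
  show False
  proof (rule no_K33_nearD[OF no, of "\<lambda>i. N + i" E x])
    fix i j :: nat assume "i \<noteq> j"
    then have "C (N + i) \<noteq> C (N + j)"
      using injD[OF C(2), of "N + i" "N + j"] by auto
    then have "C (N + i) \<inter> C (N + j) = {}"
      using components_nonoverlap[OF C(1) C(1)] by blast
    then show "E i \<inter> P (N + j) = {}"
      using EC[of i] P(1)[of "N + j"] C'[of "N + j"] \<open>x \<notin> \<Omega>\<close> by blast
  next
    fix i :: nat
    show "E i \<inter> P (N + i) \<noteq> {}"
      using E(4)[of i] P(2)[of "N + i"] by blast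
  qed (use E in \<open>auto simp: inj_on_def\<close>)
qed

section \<open>Peano compact boundaries\<close>

lemma locally_connected_path_image:
  fixes g :: "real \<Rightarrow> 'a::t2_space"
  assumes "path g"
  shows "locally connected (path_image g)"
  unfolding path_image_def
\<comment> \<open>A continuous map of a compact interval onto a Hausdorff set is a quotient map, and
  these preserve local connectedness.\<close>
proof (rule locally_connected_quotient_image)
  show "locally connected {0..1::real}"
    by (simp add: convex_imp_locally_connected)
  show "openin (top_of_set {0..1}) ({0..1} \<inter> g -` T) \<longleftrightarrow> openin (top_of_set (g ` {0..1})) T"
    if "T \<subseteq> g ` {0..1}" for T
    using assms that by (intro Abstract_Topology_2.continuous_imp_quotient_map) (auto simp: path_def)
qed

text \<open>Of the finitely many components with diameter above \<open>e\<close>, those that avoid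
  \<open>x\<close> form a closed set and stay away from it. So a large connected piece of
  \<open>K\<close> that passes very near \<open>x\<close> lies in the component of \<open>x\<close>,
  which is locally connected as a Peano continuum.\<close>

lemma Peano_compactum_local:
  fixes K :: "'a::{heine_borel} set"
  assumes K: "Peano_compactum K" and "x \<in> K" "e > 0" "\<eta> > 0"
  obtains \<delta> where "\<delta> > 0"
    "\<And>F y. \<lbrakk>connected F; F \<subseteq> K; diameter F > e; y \<in> F; dist x y < \<delta>\<rbrakk>
       \<Longrightarrow> y \<in> connected_component_set (K \<inter> cball x \<eta>) x"
proof -
  have "compact K" and fin: "finite {C \<in> components K. diameter C > e}"
    using K \<open>e > 0\<close> by (auto simp: Peano_compactum_def)
  define K0 where "K0 = connected_component_set K x"
  have K0: "K0 \<in> components K" "x \<in> K0"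
    using \<open>x \<in> K\<close> by (auto simp: K0_def componentsI connected_component_refl)
  then have "Peano_continuum K0"
    using K by (simp add: Peano_compactum_def)
  then have "locally connected K0"
    using locally_connected_path_image unfolding Peano_continuum_def by metis
  moreover have "openin (top_of_set K0) (K0 \<inter> ball x \<eta>)"
    by (simp add: openin_open_Int)
  ultimately obtain u where u: "openin (top_of_set K0) u" "connected u" "x \<in> u" "u \<subseteq> K0 \<inter> ball x \<eta>"
    using K0(2) \<open>\<eta> > 0\<close> unfolding locally_connected by (metis IntI centre_in_ball)
  obtain V where V: "open V" "u = K0 \<inter> V"
    using u(1) by (auto simp: openin_open)
  define B where "B = \<Union>{C \<in> components K. diameter C > e \<and> x \<notin> C}"
  have "finite {C \<in> components K. diameter C > e \<and> x \<notin> C}"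
    by (rule finite_subset[OF _ fin]) auto
  then have "closed B"
    unfolding B_def using closed_components[OF compact_imp_closed[OF \<open>compact K\<close>]] by (intro closed_Union) auto
  then have "open (V - B)" "x \<in> V - B"
    using V u(3) by (auto simp: B_def)
  then obtain \<delta> where \<delta>: "\<delta> > 0" "ball x \<delta> \<subseteq> V - B"
    by (meson openE)
  show thesis
  proof (rule that[OF \<delta>(1)])
    fix F y assume F: "connected F" "F \<subseteq> K" "diameter F > e" "y \<in> F" "dist x y < \<delta>"
    then have y: "y \<in> V" "y \<notin> B"
      using \<delta>(2) by auto
    define C where "C = connected_component_set K y"
    have C: "C \<in> components K" "y \<in> C"
      using F by (auto simp: C_def componentsI connected_component_refl)
    have "F \<subseteq> C"
      unfolding C_def using F by (intro connected_component_maximal)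
    moreover have "bounded C"
      using compact_components[OF \<open>compact K\<close> C(1)] compact_imp_bounded by blast
    ultimately have "diameter C > e"
      using F(3) diameter_subset[of F C] by linarith
    then have "x \<in> C"
      using y(2) C by (auto simp: B_def)
    then have "C = K0"
      using components_eq[OF C(1) K0(1)] K0(2) by blast
    then have "y \<in> u"
      using C(2) y(1) V(2) by blast
    have "u \<subseteq> connected_component_set (K \<inter> cball x \<eta>) x"
      using u in_components_subset[OF K0(1)] by (intro connected_component_maximal) auto
    then show "y \<in> connected_component_set (K \<inter> cball x \<eta>) x"
      using \<open>y \<in> u\<close> by blast
  qed
qed

text \<open>The third vertex is \<open>Q\<close>, the component of \<open>x\<close> in a small
  disc's trace on the boundary. The key is that a connected set near \<open>x\<close> which joins
  two of the components \<open>C n\<close> has to meet \<open>Q\<close>; initial pieces of segments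
  between the continua then provide the connections.\<close>

lemma planar_Peano_compactum_imp_lsa:
  fixes \<Omega> :: "complex set"
  assumes "open \<Omega>" "\<And>C. C \<in> components \<Omega> \<Longrightarrow> \<not> bounded C" and Peano: "Peano_compactum (frontier \<Omega>)"
  shows "locally_sequentially_accessible \<Omega> p"
proof (rule ccontr)
  assume "\<not> locally_sequentially_accessible \<Omega> p"
  then obtain r C P y x where "r > 0"
    and C: "\<And>n::nat. C n \<in> components (\<Omega> \<inter> ball p r)" "inj C" "\<And>n. C n \<inter> sphere p (r/2) \<noteq> {}"
    and P: "\<And>n. P n \<subseteq> C n" "\<And>n. compact (P n)" "\<And>n. y n \<in> P n"
    and x: "y \<longlonglongrightarrow> x" "x \<in> frontier \<Omega>" "dist p x = r/4"
    and no: "no_K33_near P x (r/8)"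
    using not_lsa_configuration[OF assms(1,2), of p] by metis
  define K where "K = frontier \<Omega>"
  have "closed K"
    by (simp add: K_def)
  have "K \<inter> \<Omega> = {}"
    using \<open>open \<Omega>\<close> by (auto simp: K_def frontier_def interior_open)
  define Q where "Q = connected_component_set (K \<inter> cball x (r/16)) x"
  have "x \<in> K \<inter> cball x (r/16)"
    using x(2) \<open>r > 0\<close> by (simp add: K_def)
  then have Q: "Q \<in> components (K \<inter> cball x (r/16))" "x \<in> Q"
    by (auto simp: Q_def componentsI connected_component_refl)
  have "compact (K \<inter> cball x (r/16))"
    using \<open>closed K\<close> by (simp add: closed_Int_compact)
  then have "compact Q" "connected Q" "Q \<subseteq> K \<inter> cball x (r/16)"
    using compact_components Q(1) in_components_connected in_components_subset by blast+
  have "r/32 > 0" "r/16 > 0"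
    using \<open>r > 0\<close> by auto
  then obtain \<delta>0 where \<delta>0: "\<delta>0 > 0"
    "\<And>F y. \<lbrakk>connected F; F \<subseteq> K; diameter F > r/32; y \<in> F; dist x y < \<delta>0\<rbrakk> \<Longrightarrow> y \<in> Q"
    using Peano_compactum_local[OF Peano x(2), of "r/32" "r/16"] unfolding Q_def K_def by metis
  define \<delta> where "\<delta> = min \<delta>0 (r/16)"
  have \<delta>: "\<delta> > 0" "\<delta> \<le> \<delta>0" "\<delta> \<le> r/16"
    using \<delta>0(1) \<open>r > 0\<close> by (auto simp: \<delta>_def)
  have C': "C n \<subseteq> \<Omega> \<inter> ball p r" "connected (C n)" for n
    using C(1) in_components_subset in_components_connected by blast+
  \<comment> \<open>With the outside of the disc added, \<open>Z\<close> is a closed set that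
    separates the components \<open>C n\<close> from each other; in the plane a single component of
    \<open>Z\<close> then separates two given points.\<close>
  define Z where "Z = K \<union> - ball p r"
  have "closed Z"
    using \<open>closed K\<close> by (auto simp: Z_def)
  \<comment> \<open>The separating component \<open>F\<close> meets \<sigma> in some
    \<open>y'\<close>, and it meets the connected set formed by \<open>C m\<close>,
    \<open>C n\<close> and a circle around \<open>p\<close>. As it avoids all \<open>C k\<close>, it
    meets the circle, far from \<open>x\<close>. So its part near \<open>x\<close> is a large
    connected piece of the boundary, and the choice of \<open>\<delta>0\<close> puts
    \<open>y'\<close> into \<open>Q\<close>.\<close>
  have hit: "\<exists>q\<in>\<sigma>. q \<in> Q" if h: "m \<noteq> n" "connected \<sigma>" "\<sigma> \<subseteq> ball x \<delta>" "a \<in> \<sigma> \<inter> C m" "b \<in> \<sigma> \<inter> C n" for m n \<sigma> a b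
  proof -
    have "C m \<inter> C n = {}"
      using components_nonoverlap[OF C(1) C(1)] injD[OF C(2), of m n] h(1) by auto
    have "\<not> connected_component (- Z) a b"
    proof
      assume "connected_component (- Z) a b"
      then obtain S where S: "connected S" "S \<subseteq> - Z" "a \<in> S" "b \<in> S"
        unfolding connected_component_def by blast
      have "S \<subseteq> \<Omega>"
      proof (rule ccontr)
        assume "\<not> S \<subseteq> \<Omega>"
        then have "S \<inter> frontier \<Omega> \<noteq> {}"
          using S(1,3) C' h(4) by (intro connected_Int_frontier) blast+
        then show False
          using S(2) by (auto simp: Z_def K_def)
      qed
      then have "S \<subseteq> C m"
        using S h(4) by (intro component_between[OF S(1) _ C(1)]) (auto simp: Z_def)
      then show False
        using S(4) h(5) \<open>C m \<inter> C n = {}\<close> by blast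
    qed
    then obtain F where F: "F \<in> components Z" "\<not> connected_component (- F) a b"
      using separation_by_component_closed_pointwise[OF \<open>closed Z\<close>] by blast
    have F': "closed F" "connected F" "F \<subseteq> Z"
      using F(1) closed_components[OF \<open>closed Z\<close>] in_components_connected in_components_subset by blast+
    have meets: "S \<inter> F \<noteq> {}" if "connected S" "a \<in> S" "b \<in> S" for S
      using F(2) that unfolding connected_component_def by blast
    have CF: "C k \<inter> F = {}" for k
      using F'(3) C'(1)[of k] \<open>K \<inter> \<Omega> = {}\<close> by (auto simp: Z_def)
    obtain y' where y': "y' \<in> \<sigma>" "y' \<in> F"
      using meets[of \<sigma>] h by blast
    have "connected ((C m \<union> sphere p (r/2)) \<union> C n)"
      using C'(2) C(3)[of m] C(3)[of n] by (intro connected_Un) (auto simp: connected_sphere)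
    then have "((C m \<union> sphere p (r/2)) \<union> C n) \<inter> F \<noteq> {}"
      using h by (intro meets) auto
    then obtain z where "z \<in> F" "z \<in> sphere p (r/2)"
      using CF[of m] CF[of n] by blast
    then have z: "z \<in> F" "dist p z = r/2"
      by simp_all
    have "dist x z \<ge> r/4"
      using dist_triangle[of p z x] z(2) x(3) by simp
    have xy': "dist x y' < \<delta>"
      using y'(1) h(3) by auto
    obtain F1 where F1: "connected F1" "F1 \<subseteq> F \<inter> closure (ball x (r/8))" "y' \<in> F1"
      "F1 \<inter> frontier (ball x (r/8)) \<noteq> {}"
    proof (rule boundary_bumping[OF F'(1,2), of "ball x (r/8)" y'])
      show "compact (F \<inter> closure (ball x (r/8)))"
        using F'(1) by (intro closed_Int_compact) (auto simp: compact_closure)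
      show "y' \<in> F \<inter> ball x (r/8)"
        using y' xy' \<delta> \<open>r > 0\<close> by auto
      show "\<not> F \<subseteq> ball x (r/8)"
      proof
        assume "F \<subseteq> ball x (r/8)"
        then have "dist x z < r/8"
          using z(1) by auto
        then show False
          using \<open>dist x z \<ge> r/4\<close> \<open>r > 0\<close> by linarith
      qed
    qed auto
    have F1ball: "F1 \<subseteq> cball x (r/8)"
      using F1(2) \<open>r > 0\<close> by auto
    have "cball x (r/8) \<subseteq> ball p r"
    proof
      fix t assume "t \<in> cball x (r/8)"
      then have "dist p t \<le> r/4 + r/8"
        using dist_triangle[of p t x] x(3) by simp
      then show "t \<in> ball p r"
        using \<open>r > 0\<close> by simp
    qed
    then have "F1 \<subseteq> K"
      using F1(2) F1ball F'(3) by (auto simp: Z_def)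
    have "F1 \<inter> sphere x (r/8) \<noteq> {}"
      using F1(4) \<open>r > 0\<close> by simp
    then obtain z' where "z' \<in> F1" "z' \<in> sphere x (r/8)"
      by blast
    then have z': "z' \<in> F1" "dist x z' = r/8"
      by simp_all
    have "bounded F1"
      using F1ball bounded_subset by blast
    \<comment> \<open>\<open>F1\<close> runs from within \<open>r/16\<close> of \<open>x\<close> to
      distance \<open>r/8\<close>, so its diameter exceeds \<open>r/16\<close> and thus the
      threshold \<open>r/32\<close>.\<close>
    have "r/8 \<le> dist x y' + dist y' z'"
      using dist_triangle[of x z' y'] z'(2) by simp
    also have "dist y' z' \<le> diameter F1"
      using \<open>bounded F1\<close> F1(3) z'(1) by (rule diameter_bounded_bound)
    finally have "diameter F1 > r/32"
      using xy' \<delta> \<open>r > 0\<close> by linarith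
    then have "y' \<in> Q"
      using \<delta>0(2)[OF F1(1) \<open>F1 \<subseteq> K\<close> _ F1(3)] xy' \<delta> by simp
    with y'(1) show ?thesis
      by blast
  qed
  obtain N where N: "\<And>n. n \<ge> N \<Longrightarrow> y n \<in> ball x \<delta>"
    using LIMSEQ_in_open[OF x(1) open_ball, of x \<delta>] \<delta>(1) by auto
  \<comment> \<open>From \<open>y (N + i)\<close> head for another continuum and let
    \<open>z\<close> be the first point on either of the two others. The segment up to
    \<open>z\<close> joins two components and so contains a point \<open>q\<close> of
    \<open>Q\<close>, strictly before \<open>z\<close>; up to \<open>q\<close> no other continuum
    has been met.\<close>
  have "\<exists>q. q \<in> Q \<and> closed_segment (y (N + i)) q \<subseteq> ball x \<delta> \<and>
      (\<forall>j<3. j \<noteq> i \<longrightarrow> closed_segment (y (N + i)) q \<inter> P (N + j) = {})" if "i < 3" for i :: nat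
  proof -
    define a where "a = y (N + i)"
    define J where "J = {..<3::nat} - {i}"
    \<comment> \<open>Any index other than \<open>i\<close>, merely to have a target.\<close>
    have "(if i = 0 then 1 else 0) \<in> J"
      by (simp add: J_def)
    then obtain k where k: "k \<in> J"
      by blast
    define A where "A = closed_segment a (y (N + k)) \<inter> (\<Union>j\<in>J. P (N + j))"
    have "compact A"
      unfolding A_def using P(2) by (intro compact_Int compact_UN) (auto simp: J_def)
    moreover have "y (N + k) \<in> A"
      using k P(3)[of "N + k"] by (auto simp: A_def)
    ultimately obtain z where z: "z \<in> A" "\<And>t. t \<in> A \<Longrightarrow> dist a z \<le> dist a t"
      using distance_attains_inf[OF compact_imp_closed, of A a] by blast
    then obtain j where j: "j \<in> J" "z \<in> P (N + j)"
      by (auto simp: A_def)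
    have aB: "a \<in> ball x \<delta>" "y (N + k) \<in> ball x \<delta>"
      using N by (auto simp: a_def)
    have zseg: "z \<in> closed_segment a (y (N + k))"
      using z(1) by (auto simp: A_def)
    then have zB: "z \<in> ball x \<delta>"
      using closed_segment_subset[OF aB convex_ball] by blast
    have "closed_segment a z \<subseteq> ball x \<delta>"
      using closed_segment_subset[OF aB(1) zB convex_ball] .
    moreover have "a \<in> closed_segment a z \<inter> C (N + i)" "z \<in> closed_segment a z \<inter> C (N + j)"
      using P j(2) by (auto simp: a_def)
    moreover have "N + i \<noteq> N + j"
      using j by (auto simp: J_def)
    ultimately obtain q where q: "q \<in> closed_segment a z" "q \<in> Q"
      using hit[of "N + i" "N + j" "closed_segment a z" a z] by auto
    have "q \<noteq> z"
      using q(2) \<open>Q \<subseteq> K \<inter> _\<close> \<open>K \<inter> \<Omega> = {}\<close> P(1) j(2) C'(1) by blast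
    moreover have "dist a z = dist a q + dist q z"
      using q(1) by (simp add: between_mem_segment[symmetric] between)
    ultimately have "dist a q < dist a z"
      by simp
    have sub: "closed_segment a q \<subseteq> closed_segment a z" "closed_segment a z \<subseteq> closed_segment a (y (N + k))"
      using q(1) zseg by (simp_all add: subset_closed_segment)
    have "closed_segment a q \<inter> P (N + j') = {}" if "j' < 3" "j' \<noteq> i" for j'
    proof (rule ccontr)
      assume "closed_segment a q \<inter> P (N + j') \<noteq> {}"
      then obtain t where t: "t \<in> closed_segment a q" "t \<in> P (N + j')"
        by blast
      then have "t \<in> A"
        using that sub by (auto simp: A_def J_def)
      then have "dist a z \<le> dist a t"
        by (rule z(2))
      moreover have "dist a q = dist a t + dist t q"
        using t(1) by (simp add: between_mem_segment[symmetric] between)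
      ultimately show False
        using \<open>dist a q < dist a z\<close> zero_le_dist[of t q] by linarith
    qed
    moreover have "closed_segment a q \<subseteq> ball x \<delta>"
      using sub \<open>closed_segment a z \<subseteq> ball x \<delta>\<close> by blast
    ultimately show ?thesis
      using q(2) by (auto simp: a_def)
  qed
  then obtain q where q: "\<And>i. i < 3 \<Longrightarrow> q i \<in> Q" "\<And>i. i < 3 \<Longrightarrow> closed_segment (y (N + i)) (q i) \<subseteq> ball x \<delta>"
    "\<And>i j. \<lbrakk>i < 3; j < 3; j \<noteq> i\<rbrakk> \<Longrightarrow> closed_segment (y (N + i)) (q i) \<inter> P (N + j) = {}"
    by metis
  define E where "E i = closed_segment (y (N + i)) (q i) \<union> Q" for i
  show False
  proof (rule no_K33_nearD[OF no, of "\<lambda>i. N + i" E x])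
    fix i :: nat assume i: "i < 3"
    show "compact (E i)"
      using \<open>compact Q\<close> by (auto simp: E_def)
    show "connected (E i)"
      unfolding E_def using \<open>connected Q\<close> q(1)[OF i] by (intro connected_Un) auto
    show "x \<in> E i"
      using Q by (simp add: E_def)
    show "E i \<subseteq> ball x (r/8)"
    proof -
      have "ball x \<delta> \<subseteq> ball x (r/8)" "cball x (r/16) \<subseteq> ball x (r/8)"
        using \<delta> \<open>r > 0\<close> by auto
      then show ?thesis
        using q(2)[OF i] \<open>Q \<subseteq> K \<inter> _\<close> unfolding E_def by blast
    qed
    show "E i \<inter> P (N + i) \<noteq> {}"
      using P(3)[of "N + i"] by (auto simp: E_def)
    fix j :: nat assume "j < 3" "i \<noteq> j"
    moreover have "Q \<inter> P (N + j) = {}"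
      using \<open>Q \<subseteq> K \<inter> _\<close> \<open>K \<inter> \<Omega> = {}\<close> P(1) C'(1) by blast
    ultimately show "E i \<inter> P (N + j) = {}"
      using q(3)[OF i] by (auto simp: E_def)
  qed (auto simp: inj_on_def)
qed

section \<open>The Hahn-Mazurkiewicz theorem\<close>

text \<open>A chain of steps shorter than \<open>d\<close> that visits all of \<open>Y\<close>. The
  number of steps is exact, so that all edges of a polygon can later be replaced by equally
  many.\<close>

definition tour :: "'a::metric_space set \<Rightarrow> real \<Rightarrow> nat \<Rightarrow> 'a \<Rightarrow> 'a \<Rightarrow> 'a set \<Rightarrow> bool" where
  "tour E d n a b Y \<longleftrightarrow>
     (\<exists>f. f 0 = a \<and> f n = b \<and> (\<forall>i\<le>n. f i \<in> E) \<and> (\<forall>i<n. dist (f i) (f (Suc i)) < d) \<and> Y \<subseteq> f ` {..n})"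

lemma tour_append:
  assumes "tour E d m a b Y" "tour E d n b c Z"
  shows "tour E d (m + n) a c (Y \<union> Z)"
proof -
  obtain f where f: "f 0 = a" "f m = b" "\<forall>i\<le>m. f i \<in> E" "\<forall>i<m. dist (f i) (f (Suc i)) < d" "Y \<subseteq> f ` {..m}"
    using assms(1) unfolding tour_def by blast
  obtain g where g: "g 0 = b" "g n = c" "\<forall>i\<le>n. g i \<in> E" "\<forall>i<n. dist (g i) (g (Suc i)) < d" "Z \<subseteq> g ` {..n}"
    using assms(2) unfolding tour_def by blast
  define h where "h i = (if i < m then f i else g (i - m))" for i
  have hf: "h i = f i" if "i \<le> m" for i
    using that f(2) g(1) by (auto simp: h_def)
  have hg: "h (m + i) = g i" for i
    by (simp add: h_def)
  show ?thesis
    unfolding tour_def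
  proof (intro exI[of _ h] conjI allI impI)
    show "h 0 = a" "h (m + n) = c"
      using hf[of 0] hg[of n] f(1) g(2) by simp_all
    show "h i \<in> E" if "i \<le> m + n" for i
      using that f(3) g(3) by (auto simp: h_def)
    show "dist (h i) (h (Suc i)) < d" if "i < m + n" for i
    proof (cases "i < m")
      case True
      then show ?thesis
        using hf[of i] hf[of "Suc i"] f(4) by simp
    next
      case False
      with that have "i = m + (i - m)" "i - m < n"
        by auto
      then obtain j where "i = m + j" "j < n"
        by blast
      then show ?thesis
        using hg[of j] hg[of "Suc j"] g(4) by simp
    qed
    show "Y \<union> Z \<subseteq> h ` {..m + n}"
    proof (intro Un_least subsetI)
      fix y assume "y \<in> Y"
      then obtain i where "i \<le> m" "y = f i"
        using f(5) by auto
      then show "y \<in> h ` {..m + n}"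
        using hf by (intro image_eqI[of _ _ i]) auto
    next
      fix z assume "z \<in> Z"
      then obtain i where "i \<le> n" "z = g i"
        using g(5) by auto
      then show "z \<in> h ` {..m + n}"
        using hg by (intro image_eqI[of _ _ "m + i"]) auto
    qed
  qed
qed

lemma tour_const: "a \<in> E \<Longrightarrow> d > 0 \<Longrightarrow> tour E d n a a {a}"
  unfolding tour_def by (intro exI[of _ "\<lambda>i. a"]) auto

lemma tour_mono: "tour E d n a b Y \<Longrightarrow> Z \<subseteq> Y \<Longrightarrow> tour E d n a b Z"
  unfolding tour_def by blast

text \<open>The chain rests at \<open>b\<close>; constant steps are allowed since
  \<open>d > 0\<close>.\<close>

lemma tour_longer:
  assumes "tour E d m a b Y" "m \<le> n" "d > 0"
  shows "tour E d n a b Y"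
proof -
  have "b \<in> E"
    using assms(1) unfolding tour_def by blast
  then have "tour E d (m + (n - m)) a b (Y \<union> {b})"
    using assms by (intro tour_append[OF _ tour_const])
  then show ?thesis
    using assms(2) tour_mono by simp blast
qed

text \<open>The points that can be reached from \<open>a\<close> by chains form a set that is open
  and closed in \<open>E\<close>.\<close>

lemma connected_imp_tour:
  assumes E: "connected E" "a \<in> E" "b \<in> E" and "d > 0"
  shows "\<exists>n. tour E d n a b {}"
proof -
  define S where "S = {y \<in> E. \<exists>n. tour E d n a y {}}"
  have step: "\<exists>n. tour E d n a z {}" if "\<exists>n. tour E d n a y {}" "y \<in> E" "z \<in> E" "dist y z < d" for y z
  proof -
    have "tour E d 1 y z {}"
      unfolding tour_def using that by (intro exI[of _ "\<lambda>i. if i = 0 then y else z"]) auto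
    then show ?thesis
      using that(1) tour_append by fastforce
  qed
  have "openin (top_of_set E) S"
    unfolding openin_euclidean_subtopology_iff
  proof (intro conjI ballI)
    fix y assume "y \<in> S"
    then show "\<exists>e>0. \<forall>z\<in>E. dist z y < e \<longrightarrow> z \<in> S"
      using step[of y] \<open>d > 0\<close> by (intro exI[of _ d]) (simp add: S_def dist_commute)
  qed (simp add: S_def)
  moreover have "openin (top_of_set E) (E - S)"
    unfolding openin_euclidean_subtopology_iff
  proof (intro conjI ballI)
    fix y assume "y \<in> E - S"
    then show "\<exists>e>0. \<forall>z\<in>E. dist z y < e \<longrightarrow> z \<in> E - S"
      using step[of _ y] \<open>d > 0\<close> by (intro exI[of _ d]) (auto simp: S_def)
  qed simp
  then have "closedin (top_of_set E) S"
    by (simp add: closedin_def S_def subset_eq)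
  moreover have "a \<in> S"
    using tour_mono[OF tour_const[OF E(2) \<open>d > 0\<close>] empty_subsetI] E(2) by (auto simp: S_def)
  ultimately have "S = E"
    using E(1) unfolding connected_clopen by blast
  then show ?thesis
    using E(3) by (auto simp: S_def)
qed

text \<open>Each point of \<open>Y\<close> costs a detour from \<open>a\<close> and back. All
  sufficiently large lengths are provided, to let several sets agree on a common one.\<close>

lemma connected_imp_tour_visiting:
  assumes E: "connected E" "a \<in> E" "b \<in> E" and "d > 0" "finite Y" "Y \<subseteq> E"
  shows "\<exists>N. \<forall>n\<ge>N. tour E d n a b Y"
proof -
  have "\<exists>n. tour E d n a b Y"
    using assms(5,6)
  proof (induction Y)
    case empty
    then show ?case
      using connected_imp_tour assms by blast
  next
    case (insert y Y)
    then obtain l m n where "tour E d l a b Y" "tour E d m a y {}" "tour E d n y a {}"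
      using connected_imp_tour[OF E(1) E(2) _ \<open>d > 0\<close>, of y] connected_imp_tour[OF E(1) _ E(2) \<open>d > 0\<close>, of y] by auto
    moreover have "tour E d 0 y y {y}"
      using insert.prems \<open>d > 0\<close> by (intro tour_const) auto
    ultimately have "tour E d (m + (0 + (n + l))) a b ({} \<union> ({y} \<union> ({} \<union> Y)))"
      by (intro tour_append)
    moreover have "{} \<union> ({y} \<union> ({} \<union> Y)) = insert y Y"
      by simp
    ultimately show ?case
      by metis
  qed
  then show ?thesis
    using tour_longer \<open>d > 0\<close> by blast
qed

text \<open>Uniform connectedness im kleinen of \<open>K\<close> at the scale
  \<open>e\<close>.\<close>

definition small_steps_connect :: "'a::metric_space set \<Rightarrow> real \<Rightarrow> real \<Rightarrow> bool" where
  "small_steps_connect K e \<delta> \<longleftrightarrow>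
     (\<forall>x\<in>K. \<forall>y\<in>K. dist x y < \<delta> \<longrightarrow> y \<in> connected_component_set (K \<inter> cball x e) x)"

text \<open>
  The polygons are closed (\<open>p 0 = p N\<close>) so that each of their vertices occurs at an index below \<open>N\<close>.
\<close>

definition polygon :: "'a::metric_space set \<Rightarrow> real \<Rightarrow> nat \<times> (nat \<Rightarrow> 'a) \<Rightarrow> bool" where
  "polygon K \<delta> = (\<lambda>(N, p). N \<ge> 1 \<and> p 0 = p N \<and> (\<forall>i\<le>N. p i \<in> K) \<and> (\<forall>i<N. dist (p i) (p (Suc i)) < \<delta>) \<and>
     (\<forall>y\<in>K. \<exists>i<N. dist y (p i) < \<delta>))"

text \<open>Every edge is subdivided into the same number \<open>k\<close> of edges, so
  \<open>m div k\<close> is the index of the old edge. The uniform factor keeps the parametrisations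
  of both polygons by \<open>\<lfloor>t * N\<rfloor>\<close> in step.\<close>

definition refines :: "real \<Rightarrow> nat \<times> (nat \<Rightarrow> 'a::metric_space) \<Rightarrow> nat \<times> (nat \<Rightarrow> 'a) \<Rightarrow> bool" where
  "refines e = (\<lambda>(N, p) (N', q). \<exists>k\<ge>1. N' = N * k \<and> (\<forall>m\<le>N'. dist (p (m div k)) (q m) \<le> e))"

text \<open>The edge from \<open>p i\<close> to \<open>p (Suc i)\<close> has both ends in
  \<open>E i\<close>, the component of \<open>p i\<close> in the trace of a ball of radius
  \<open>e\<close>, and is replaced by a chain in \<open>E i\<close> that visits the points there of
  a finite \<open>\<delta>'\<close>-net \<open>Y\<close>. As the old vertices are
  \<open>\<delta>\<close>-dense, every point of the net lies in some \<open>E i\<close>, so the new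
  ones are \<open>\<delta>'\<close>-dense.\<close>

lemma polygon_refinement:
  assumes K: "compact K" and "small_steps_connect K e \<delta>" "e > 0" "\<delta>' > 0" and P: "polygon K \<delta> (N, p)"
  shows "\<exists>P'. polygon K \<delta>' P' \<and> refines e (N, p) P'"
proof -
  have N: "N \<ge> 1" "p 0 = p N" "\<And>i. i \<le> N \<Longrightarrow> p i \<in> K" "\<And>i. i < N \<Longrightarrow> dist (p i) (p (Suc i)) < \<delta>"
    "\<And>y. y \<in> K \<Longrightarrow> \<exists>i<N. dist y (p i) < \<delta>"
    using P by (auto simp: polygon_def)
  obtain Y where Y: "finite Y" "Y \<subseteq> K" "K \<subseteq> (\<Union>y\<in>Y. ball y \<delta>')"
    using compactE_image[OF K, of K "\<lambda>y. ball y \<delta>'"] \<open>\<delta>' > 0\<close> by (metis UN_I centre_in_ball open_ball subsetI)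
  define E where "E i = connected_component_set (K \<inter> cball (p i) e) (p i)" for i
  have E: "connected (E i)" "E i \<subseteq> K \<inter> cball (p i) e" for i
    by (auto simp: E_def dest: connected_component_in)
  have near: "y \<in> E i" if "i < N" "y \<in> K" "dist (p i) y < \<delta>" for i y
    using assms(2) that N(3)[of i] unfolding small_steps_connect_def E_def by auto
  have pE: "p i \<in> E i" "p (Suc i) \<in> E i" if "i < N" for i
    using near[OF that, of "p (Suc i)"] N(3)[of i] N(3)[of "Suc i"] N(4)[OF that] that \<open>e > 0\<close>
    by (auto simp: E_def intro!: connected_component_refl)
  have "\<exists>M. \<forall>n\<ge>M. tour (E i) \<delta>' n (p i) (p (Suc i)) (Y \<inter> E i)" if "i < N" for i
    using E(1) pE[OF that] \<open>\<delta>' > 0\<close> Y(1) by (intro connected_imp_tour_visiting) auto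
  then obtain M where M: "\<And>i n. \<lbrakk>i < N; n \<ge> M i\<rbrakk> \<Longrightarrow> tour (E i) \<delta>' n (p i) (p (Suc i)) (Y \<inter> E i)"
    by metis
  \<comment> \<open>A common length for all edges; \<open>Suc\<close> makes it positive.\<close>
  define k where "k = Suc (Max (M ` {..<N}))"
  have "M i \<le> k" if "i < N" for i
    using that by (auto simp: k_def intro!: le_SucI Max_ge)
  then have "\<exists>f. f 0 = p i \<and> f k = p (Suc i) \<and> (\<forall>j\<le>k. f j \<in> E i) \<and> (\<forall>j<k. dist (f j) (f (Suc j)) < \<delta>') \<and>
      Y \<inter> E i \<subseteq> f ` {..k}" if "i < N" for i
    using M[OF that] that unfolding tour_def by blast
  then have "\<exists>f. \<forall>i<N. f i 0 = p i \<and> f i k = p (Suc i) \<and> (\<forall>j\<le>k. f i j \<in> E i) \<and>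
      (\<forall>j<k. dist (f i j) (f i (Suc j)) < \<delta>') \<and> Y \<inter> E i \<subseteq> f i ` {..k}"
    by (intro choice[of "\<lambda>i g. i < N \<longrightarrow> g 0 = p i \<and> g k = p (Suc i) \<and> (\<forall>j\<le>k. g j \<in> E i) \<and>
      (\<forall>j<k. dist (g j) (g (Suc j)) < \<delta>') \<and> Y \<inter> E i \<subseteq> g ` {..k}"]) blast
  then obtain f where f: "\<And>i. i < N \<Longrightarrow> f i 0 = p i" "\<And>i. i < N \<Longrightarrow> f i k = p (Suc i)"
    "\<And>i j. \<lbrakk>i < N; j \<le> k\<rbrakk> \<Longrightarrow> f i j \<in> E i" "\<And>i j. \<lbrakk>i < N; j < k\<rbrakk> \<Longrightarrow> dist (f i j) (f i (Suc j)) < \<delta>'"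
    "\<And>i. i < N \<Longrightarrow> Y \<inter> E i \<subseteq> f i ` {..k}"
    by blast
  have "k \<ge> 1"
    by (simp add: k_def)
  define q where "q m = (if m < N * k then f (m div k) (m mod k) else p N)" for m
  have q: "q (i * k + j) = f i j" if "i < N" "j \<le> k" for i j
  proof (cases "j < k")
    case True
    have "i * k + j < Suc i * k"
      using True by simp
    also have "\<dots> \<le> N * k"
      using that by (intro mult_le_mono) auto
    finally show ?thesis
      using True by (simp add: q_def)
  next
    case False
    \<comment> \<open>The index \<open>i * k + k\<close> ends edge \<open>i\<close> but is looked up
      by \<open>q\<close> as the beginning of edge \<open>Suc i\<close>, or as the end of the
      polygon.\<close>
    then have j: "j = k"
      using that by simp
    show ?thesis
    proof (cases "Suc i < N")
      case True
      have "i * k + j = Suc i * k"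
        by (simp add: j)
      moreover have "Suc i * k < N * k"
        using True \<open>k \<ge> 1\<close> by (intro mult_strict_right_mono) auto
      ultimately have "q (i * k + j) = f (Suc i * k div k) (Suc i * k mod k)"
        by (simp only: q_def if_True)
      then show ?thesis
        using f(1)[OF True] f(2)[OF that(1)] \<open>k \<ge> 1\<close> by (simp add: j del: mult_Suc)
    next
      case False
      then have "N = Suc i"
        using that by simp
      then show ?thesis
        using f(2)[OF that(1)] by (simp add: q_def j)
    qed
  qed
  have split: "\<exists>i j. m = i * k + j \<and> i < N \<and> j < k" if m: "m < N * k" for m
    using m \<open>k \<ge> 1\<close> by (intro exI[of _ "m div k"] exI[of _ "m mod k"]) (auto simp: less_mult_imp_div_less)
  have qe: "dist (p (m div k)) (q m) \<le> e" if "m \<le> N * k" for m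
  proof (cases "m < N * k")
    case True
    then obtain i j where m: "m = i * k + j" "i < N" "j < k"
      using split by blast
    then have "q m \<in> E i"
      using q f(3) by simp
    then show ?thesis
      using m E(2)[of i] by auto
  next
    case False
    then show ?thesis
      using that \<open>k \<ge> 1\<close> \<open>e > 0\<close> by (auto simp: q_def)
  qed
  have "q m \<in> K" if "m \<le> N * k" for m
  proof (cases "m < N * k")
    case True
    then obtain i j where m: "m = i * k + j" "i < N" "j < k"
      using split by blast
    then have "q m \<in> E i"
      using q f(3) by simp
    then show ?thesis
      using E(2) by blast
  next
    case False
    then show ?thesis
      using N(3) by (simp add: q_def)
  qed
  moreover have "q 0 = q (N * k)"
    using q[of 0 0] f(1)[of 0] N by (simp add: q_def)
  moreover have "dist (q m) (q (Suc m)) < \<delta>'" if m: "m < N * k" for m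
  proof -
    obtain i j where m: "m = i * k + j" "i < N" "j < k"
      using split[OF m] by blast
    then show ?thesis
      using q[of i j] q[of i "Suc j"] f(4)[of i j] by simp
  qed
  moreover have "\<exists>m<N * k. dist y (q m) < \<delta>'" if y: "y \<in> K" for y
  proof -
    obtain z where z: "z \<in> Y" "dist z y < \<delta>'"
      using Y(3) y by auto
    then obtain i where i: "i < N" "dist z (p i) < \<delta>"
      using N(5) Y(2) by blast
    then have "z \<in> Y \<inter> E i"
      using near[OF i(1)] z(1) Y(2) by (auto simp: dist_commute)
    then obtain j where j: "j \<le> k" "z = f i j"
      using f(5)[OF i(1)] by auto
    then have eq: "z = q (i * k + j)"
      using q[OF i(1)] by simp
    have "i * k + j \<le> Suc i * k"
      using j by simp
    also have "\<dots> \<le> N * k"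
      using i by (intro mult_le_mono) auto
    finally have "i * k + j \<le> N * k" .
    \<comment> \<open>The last index is traded for 0, the polygon being closed.\<close>
    then have "\<exists>m<N * k. z = q m"
      using eq \<open>q 0 = q (N * k)\<close> N(1) \<open>k \<ge> 1\<close> by (metis le_neq_implies_less mult_is_0 neq0_conv not_one_le_zero)
    then show ?thesis
      using z(2) by (auto simp: dist_commute)
  qed
  moreover have "N * k \<ge> 1"
    using N(1) \<open>k \<ge> 1\<close> by simp
  ultimately have "polygon K \<delta>' (N * k, q)"
    by (simp add: polygon_def)
  moreover have "refines e (N, p) (N * k, q)"
    using qe \<open>k \<ge> 1\<close> by (auto simp: refines_def)
  ultimately show ?thesis
    by blast
qed

lemma floor_refinement:
  assumes "0 \<le> t" "k \<ge> (1::nat)"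
  shows "nat \<lfloor>t * real (N * k)\<rfloor> div k = nat \<lfloor>t * real N\<rfloor>"
proof -
  have "\<lfloor>(t * real (N * k)) / real_of_int (int k)\<rfloor> = \<lfloor>t * real (N * k)\<rfloor> div int k"
    by (rule floor_divide_real_eq_div) simp
  moreover have "(t * real (N * k)) / real_of_int (int k) = t * real N"
    using assms by simp
  ultimately have "\<lfloor>t * real N\<rfloor> = \<lfloor>t * real (N * k)\<rfloor> div int k"
    by simp
  then show ?thesis
    using assms by (simp add: nat_div_distrib)
qed

text \<open>The polygons are read as step functions \<open>F n\<close> on the unit interval.
  Consecutive ones differ by at most \<open>e n\<close>, a geometric sequence, so they converge
  uniformly. Neighbouring vertices are at most \<open>e n\<close> apart, which makes the limit
  continuous; their density makes its image dense and, by compactness, all of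
  \<open>K\<close>.\<close>

theorem Hahn_Mazurkiewicz:
  fixes K :: "'a::metric_space set"
  assumes K: "compact K" "connected K" "K \<noteq> {}"
    and loc: "\<And>e. e > 0 \<Longrightarrow> \<exists>\<delta>>0. small_steps_connect K e \<delta>"
  shows "Peano_continuum K"
proof -
  define D where "D = diameter K + 1"
  have "bounded K"
    using K compact_imp_bounded by blast
  then have "D > 0"
    using diameter_ge_0[of K] by (simp add: D_def)
  define e where "e n = D / 2 ^ n" for n :: nat
  have e: "e n > 0" "e (Suc n) = e n / 2" for n
    using \<open>D > 0\<close> by (simp_all add: e_def)
  have e_lim: "e \<longlonglongrightarrow> 0"
    unfolding e_def using LIMSEQ_divide_realpow_zero[of 2 D] by simp
  have dD: "dist x y < D" if "x \<in> K" "y \<in> K" for x y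
    using diameter_bounded_bound[OF \<open>bounded K\<close> that] by (simp add: D_def)
  have "\<exists>\<delta>. \<delta> > 0 \<and> \<delta> \<le> e n \<and> small_steps_connect K (e n) \<delta>" for n
  proof -
    obtain \<delta> where "\<delta> > 0" "small_steps_connect K (e n) \<delta>"
      using loc e(1) by blast
    then show ?thesis
      using e(1)[of n] by (intro exI[of _ "min \<delta> (e n)"]) (auto simp: small_steps_connect_def)
  qed
  then obtain \<delta>1 where \<delta>1: "\<And>n. \<delta>1 n > 0" "\<And>n. \<delta>1 n \<le> e n" "\<And>n. small_steps_connect K (e n) (\<delta>1 n)"
    by metis
  \<comment> \<open>At stage 0 the scale \<open>D\<close> exceeds the diameter: every ball of this
    radius about a point of \<open>K\<close> contains the connected set \<open>K\<close>, and a
    constant polygon serves as the start.\<close>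
  define \<delta> where "\<delta> n = (if n = 0 then D else \<delta>1 n)" for n
  have "K \<inter> cball x (e 0) = K" if "x \<in> K" for x
    using dD[OF that] by (auto simp: e_def less_imp_le)
  then have "small_steps_connect K (e 0) (\<delta> 0)"
    using K(2) unfolding small_steps_connect_def by (metis connected_component_eq_self)
  then have \<delta>: "\<delta> n > 0" "\<delta> n \<le> e n" "small_steps_connect K (e n) (\<delta> n)" for n
    using \<delta>1[of n] \<open>D > 0\<close> by (auto simp: \<delta>_def e_def)
  obtain x0 where "x0 \<in> K"
    using K(3) by blast
  then have base: "polygon K (\<delta> 0) (1, \<lambda>i. x0)"
    using dD \<open>D > 0\<close> by (auto simp: polygon_def \<delta>_def)
  have "\<exists>S. \<forall>n. polygon K (\<delta> n) (S n) \<and> refines (e n) (S n) (S (Suc n))"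
  proof (rule dependent_nat_choice)
    show "\<exists>S. polygon K (\<delta> 0) S"
      using base by blast
    show "\<exists>T. polygon K (\<delta> (Suc n)) T \<and> refines (e n) S T" if "polygon K (\<delta> n) S" for S n
      using polygon_refinement[OF K(1) \<delta>(3) e(1) \<delta>(1), of n "fst S" "snd S" "Suc n"] that by simp
  qed
  then obtain S where S: "\<And>n. polygon K (\<delta> n) (S n)" "\<And>n. refines (e n) (S n) (S (Suc n))"
    by blast
  define N p where "N n = fst (S n)" and "p n = snd (S n)" for n
  have N: "N n \<ge> 1" "\<And>i. i \<le> N n \<Longrightarrow> p n i \<in> K" "\<And>i. i < N n \<Longrightarrow> dist (p n i) (p n (Suc i)) < \<delta> n"
    "\<And>y. y \<in> K \<Longrightarrow> \<exists>i<N n. dist y (p n i) < \<delta> n" for n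
    using S(1)[of n] by (auto simp: polygon_def N_def p_def case_prod_unfold)
  define F where "F n t = p n (nat \<lfloor>t * real (N n)\<rfloor>)" for n t
  have idx: "nat \<lfloor>t * real (N n)\<rfloor> \<le> N n" if "t \<in> {0..1}" for n t
  proof -
    have "t * real (N n) \<le> 1 * real (N n)"
      using that by (intro mult_right_mono) auto
    then have "\<lfloor>t * real (N n)\<rfloor> \<le> int (N n)"
      by (simp add: floor_le_iff)
    then show ?thesis
      by simp
  qed
  have FK: "F n t \<in> K" if "t \<in> {0..1}" for n t
    using N(2)[OF idx[OF that]] by (simp add: F_def)
  have Fstep: "dist (F n t) (F (Suc n) t) \<le> e n" if "t \<in> {0..1}" for n t
  proof -
    obtain k where k: "k \<ge> 1" "N (Suc n) = N n * k" "\<And>m. m \<le> N (Suc n) \<Longrightarrow> dist (p n (m div k)) (p (Suc n) m) \<le> e n"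
      using S(2)[of n] by (auto simp: refines_def N_def p_def case_prod_unfold)
    have "nat \<lfloor>t * real (N (Suc n))\<rfloor> div k = nat \<lfloor>t * real (N n)\<rfloor>"
      using floor_refinement[of t k "N n"] that k by simp
    then show ?thesis
      using k(3)[OF idx[OF that, of "Suc n"]] by (simp add: F_def)
  qed
  \<comment> \<open>The bound telescopes because the scales are halved:
    \<open>e n = 2 * e n - 2 * e (Suc n)\<close>.\<close>
  have Fdist: "dist (F n t) (F (n + k) t) \<le> 2 * e n - 2 * e (n + k)" if "t \<in> {0..1}" for n k t
  proof (induction k)
    case (Suc k)
    have "dist (F n t) (F (n + Suc k) t) \<le> dist (F n t) (F (n + k) t) + dist (F (n + k) t) (F (Suc (n + k)) t)"
      using dist_triangle by simp
    also have "\<dots> \<le> (2 * e n - 2 * e (n + k)) + e (n + k)"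
      using Suc Fstep[OF that, of "n + k"] by linarith
    also have "\<dots> = 2 * e n - 2 * e (n + Suc k)"
      using e(2)[of "n + k"] by simp
    finally show ?case .
  qed simp
  have Fdist2: "dist (F n t) (F m t) \<le> 2 * e n" if "t \<in> {0..1}" "n \<le> m" for n m t
    using Fdist[OF that(1), of n "m - n"] that(2) e(1)[of m] by simp
  have "\<exists>l. l \<in> K \<and> (\<lambda>n. F n t) \<longlonglongrightarrow> l" if t: "t \<in> {0..1}" for t
  proof -
    have "Cauchy (\<lambda>n. F n t)"
    proof (rule metric_CauchyI)
      fix \<epsilon> :: real assume "\<epsilon> > 0"
      then obtain M where M: "e M < \<epsilon> / 4"
        using order_tendstoD(2)[OF e_lim, of "\<epsilon>/4"] by (auto simp: eventually_sequentially)
      have "dist (F m t) (F n t) < \<epsilon>" if "m \<ge> M" "n \<ge> M" for m n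
        using Fdist2[OF t that(1)] Fdist2[OF t that(2)] dist_triangle3[of "F m t" "F n t" "F M t"] M by linarith
      then show "\<exists>M. \<forall>m\<ge>M. \<forall>n\<ge>M. dist (F m t) (F n t) < \<epsilon>"
        by blast
    qed
    then show ?thesis
      using compact_imp_complete[OF K(1)] FK[OF t] unfolding complete_def by metis
  qed
  then obtain G where G: "\<And>t. t \<in> {0..1} \<Longrightarrow> G t \<in> K" "\<And>t. t \<in> {0..1} \<Longrightarrow> (\<lambda>n. F n t) \<longlonglongrightarrow> G t"
    by metis
  have FG: "dist (F n t) (G t) \<le> 2 * e n" if t: "t \<in> {0..1}" for n t
  proof -
    have "(\<lambda>m. dist (F n t) (F m t)) \<longlonglongrightarrow> dist (F n t) (G t)"
      by (intro tendsto_intros G t)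
    then show ?thesis
      by (rule LIMSEQ_le_const2) (use Fdist2[OF t] in blast)
  qed
  have "continuous_on {0..1} G"
    unfolding continuous_on_iff
  proof (intro ballI allI impI)
    fix t \<epsilon> :: real assume t: "t \<in> {0..1}" and "\<epsilon> > 0"
    \<comment> \<open>Two approximation errors of at most \<open>2 * e n\<close> and one step of at
      most \<open>e n\<close> add up to \<open>5 * e n\<close>.\<close>
    then obtain n where n: "e n < \<epsilon> / 5"
      using order_tendstoD(2)[OF e_lim, of "\<epsilon>/5"] by (auto simp: eventually_sequentially)
    have pos: "real (N n) > 0"
      using N(1)[of n] by simp
    have close: "dist (p n i) (p n j) \<le> e n" if "i \<le> N n" "j \<le> N n" "i \<le> j" "j \<le> Suc i" for i j
    proof (cases "i = j")
      case False
      then have "j = Suc i" "i < N n"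
        using that by auto
      then show ?thesis
        using N(3)[of i n] \<delta>(2)[of n] by simp
    qed (use e(1)[of n] in simp)
    have "dist (G s) (G t) < \<epsilon>" if s: "s \<in> {0..1}" "dist s t < 1 / real (N n)" for s
    proof -
      have "\<bar>s * real (N n) - t * real (N n)\<bar> < 1"
      proof -
        have "\<bar>s * real (N n) - t * real (N n)\<bar> = \<bar>s - t\<bar> * real (N n)"
          by (simp add: left_diff_distrib[symmetric] abs_mult)
        also have "\<dots> < 1 / real (N n) * real (N n)"
          using s(2) pos by (intro mult_strict_right_mono) (simp_all add: dist_real_def)
        finally show ?thesis
          using pos by simp
      qed
      then have "nat \<lfloor>s * real (N n)\<rfloor> \<le> Suc (nat \<lfloor>t * real (N n)\<rfloor>)" "nat \<lfloor>t * real (N n)\<rfloor> \<le> Suc (nat \<lfloor>s * real (N n)\<rfloor>)"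
        by linarith+
      then have "dist (F n s) (F n t) \<le> e n"
        using close[of "nat \<lfloor>s * real (N n)\<rfloor>" "nat \<lfloor>t * real (N n)\<rfloor>"]
          close[of "nat \<lfloor>t * real (N n)\<rfloor>" "nat \<lfloor>s * real (N n)\<rfloor>"] idx[OF s(1)] idx[OF t]
        unfolding F_def by (metis dist_commute le_cases)
      then show ?thesis
        using FG[OF s(1), of n] FG[OF t, of n] n dist_triangle[of "G s" "G t" "F n s"]
          dist_triangle[of "F n s" "G t" "F n t"] by (simp add: dist_commute)
    qed
    then show "\<exists>d>0. \<forall>s\<in>{0..1}. dist s t < d \<longrightarrow> dist (G s) (G t) < \<epsilon>"
      using pos by (intro exI[of _ "1 / real (N n)"]) auto
  qed
  moreover have "K \<subseteq> G ` {0..1}"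
  proof
    fix y assume y: "y \<in> K"
    have "y \<in> closure (G ` {0..1})"
      unfolding closure_approachable
    proof (intro allI impI)
      fix \<epsilon> :: real assume "\<epsilon> > 0"
      then obtain n where n: "e n < \<epsilon> / 3"
        using order_tendstoD(2)[OF e_lim, of "\<epsilon>/3"] by (auto simp: eventually_sequentially)
      obtain i where i: "i < N n" "dist y (p n i) < \<delta> n"
        using N(4)[OF y] by blast
      define t where "t = real i / real (N n)"
      have t: "t \<in> {0..1}"
        using i by (simp add: t_def)
      have "F n t = p n i"
        using i by (simp add: F_def t_def)
      then have "dist (G t) y < \<epsilon>"
        using FG[OF t, of n] i(2) \<delta>(2)[of n] n dist_triangle[of "G t" y "p n i"] by (simp add: dist_commute)
      then show "\<exists>z\<in>G ` {0..1}. dist z y < \<epsilon>"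
        using t by blast
    qed
    then show "y \<in> G ` {0..1}"
      using compact_imp_closed[OF compact_continuous_image[OF \<open>continuous_on {0..1} G\<close>]] by (simp add: closure_closed)
  qed
  ultimately show ?thesis
    using G(1) unfolding Peano_continuum_def path_def path_image_def by blast
qed

text \<open>A Lebesgue number of the cover by the local balls gives the uniform bound: close points
  lie in one \<open>ball z (\<delta> z)\<close> and hence in one connected set within
  \<open>e/2\<close> of \<open>z\<close>, which is within \<open>e\<close> of either of
  them.\<close>

lemma small_steps_connectI:
  fixes K :: "'a::metric_space set"
  assumes K: "compact K" "K \<noteq> {}" and "e > 0"
    and loc: "\<And>x e. \<lbrakk>x \<in> K; e > 0\<rbrakk> \<Longrightarrow> \<exists>\<delta>>0. \<forall>y\<in>K. dist x y < \<delta> \<longrightarrow> y \<in> connected_component_set (K \<inter> cball x e) x"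
  shows "\<exists>\<delta>>0. small_steps_connect K e \<delta>"
proof -
  have "\<exists>\<delta>. x \<in> K \<longrightarrow> \<delta> > 0 \<and> (\<forall>y\<in>K. dist x y < \<delta> \<longrightarrow> y \<in> connected_component_set (K \<inter> cball x (e/2)) x)" for x
    using loc[of x "e/2"] \<open>e > 0\<close> by auto
  then obtain \<delta> where \<delta>: "\<And>x. x \<in> K \<Longrightarrow> \<delta> x > 0"
    "\<And>x y. \<lbrakk>x \<in> K; y \<in> K; dist x y < \<delta> x\<rbrakk> \<Longrightarrow> y \<in> connected_component_set (K \<inter> cball x (e/2)) x"
    by metis
  obtain d where d: "d > 0" "\<And>T. \<lbrakk>T \<subseteq> K; diameter T < d\<rbrakk> \<Longrightarrow> \<exists>B\<in>(\<lambda>x. ball x (\<delta> x)) ` K. T \<subseteq> B"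
  proof (rule Lebesgue_number_lemma[OF K(1), of "(\<lambda>x. ball x (\<delta> x)) ` K"])
    show "K \<subseteq> \<Union>((\<lambda>x. ball x (\<delta> x)) ` K)"
      using \<delta>(1) by auto
  qed (use K(2) in auto)
  have "y \<in> connected_component_set (K \<inter> cball x e) x" if xy: "x \<in> K" "y \<in> K" "dist x y < d" for x y
  proof -
    have "diameter {x, y} \<le> dist x y"
      by (subst diameter_def, simp only: insert_not_empty if_False, rule cSUP_least) (auto simp: dist_commute)
    then obtain z where z: "z \<in> K" "{x, y} \<subseteq> ball z (\<delta> z)"
      using d(2)[of "{x, y}"] xy by auto
    define C where "C = connected_component_set (K \<inter> cball z (e/2)) z"
    have C: "x \<in> C" "y \<in> C" "connected C" "C \<subseteq> K \<inter> cball z (e/2)"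
      using \<delta>(2)[OF z(1)] z(2) xy connected_component_subset unfolding C_def by auto
    have "cball z (e/2) \<subseteq> cball x e"
    proof
      fix t assume "t \<in> cball z (e/2)"
      moreover have "dist z x \<le> e/2"
        using C(1,4) by auto
      ultimately show "t \<in> cball x e"
        using dist_triangle3[of x t z] by simp
    qed
    then have "C \<subseteq> connected_component_set (K \<inter> cball x e) x"
      using C by (intro connected_component_maximal) auto
    then show ?thesis
      using C(2) by blast
  qed
  with d(1) show ?thesis
    unfolding small_steps_connect_def by blast
qed

text \<open>Both requirements come from the finiteness of disjoint large boundary continua. If a
  component \<open>C\<close> failed to be connected im kleinen at \<open>x\<close>, points
  \<open>y n\<close> tending to \<open>x\<close> would lie in components of
  \<open>C \<inter> cball x e\<close> that avoid \<open>x\<close>. Each of these reaches the circle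
  of radius \<open>e\<close>, so there are finitely many, and their union is a closed set that
  contains all \<open>y n\<close> but not \<open>x\<close>.\<close>

lemma planar_finitely_connected_imp_Peano_compactum:
  fixes \<Omega> :: "complex set"
  assumes \<Omega>: "open \<Omega>" "compact (frontier \<Omega>)" "\<And>x. x \<in> frontier \<Omega> \<Longrightarrow> finitely_connected_at \<Omega> x"
  shows "Peano_compactum (frontier \<Omega>)"
  unfolding Peano_compactum_def
proof (intro conjI ballI allI impI)
  let ?K = "frontier \<Omega>"
  show "compact ?K"
    by fact
  have comp: "compact C" "connected C" "C \<subseteq> ?K" if "C \<in> components ?K" for C
    using that compact_components[OF \<Omega>(2)] in_components_connected in_components_subset by blast+
  show "finite {C \<in> components ?K. diameter C > e}" if "e > 0" for e
  proof (rule finite_disjoint_boundary_continua[OF \<Omega> that])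
    show "A \<inter> B = {}" if "A \<in> {C \<in> components ?K. diameter C > e}" "B \<in> {C \<in> components ?K. diameter C > e}" "A \<noteq> B" for A B
      using that components_nonoverlap by blast
  qed (use comp in auto)
  fix C assume C: "C \<in> components ?K"
  note C' = comp[OF C]
  have "C \<noteq> {}"
    using C by (rule in_components_nonempty)
  show "Peano_continuum C"
  proof (rule Hahn_Mazurkiewicz[OF C'(1,2) \<open>C \<noteq> {}\<close>], rule small_steps_connectI[OF C'(1) \<open>C \<noteq> {}\<close>])
    fix x :: complex and e :: real assume "x \<in> C" "e > 0"
    let ?cc = "\<lambda>y. connected_component_set (C \<inter> cball x e) y"
    show "\<exists>\<delta>>0. \<forall>y\<in>C. dist x y < \<delta> \<longrightarrow> y \<in> ?cc x"
    proof (rule ccontr)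
      assume neg: "\<not> (\<exists>\<delta>>0. \<forall>y\<in>C. dist x y < \<delta> \<longrightarrow> y \<in> ?cc x)"
      have "\<exists>y. y \<in> C \<and> dist x y < min (e/2) (inverse (real (Suc n))) \<and> y \<notin> ?cc x" for n
      proof -
        have "min (e/2) (inverse (real (Suc n))) > 0"
          using \<open>e > 0\<close> by simp
        then show ?thesis
          using neg by blast
      qed
      then obtain y where y: "\<And>n. y n \<in> C" "\<And>n. dist x (y n) < min (e/2) (inverse (real (Suc n)))" "\<And>n. y n \<notin> ?cc x"
        by metis
      have ye: "dist x (y n) < e/2" "dist x (y n) < e" for n
        using y(2)[of n] \<open>e > 0\<close> by simp_all
      have ycc: "y n \<in> ?cc (y n)" "?cc (y n) \<in> components (C \<inter> cball x e)" for n
        using y(1) ye(2)[of n] by (auto simp: componentsI connected_component_refl less_imp_le)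
      have xcc: "x \<notin> ?cc (y n)" for n
        using y(3)[of n] connected_component_sym by fast
      have "compact (C \<inter> cball x e)"
        using C'(1) by (intro compact_Int_closed) auto
      then have cpt: "compact (?cc (y n))" for n
        using compact_components ycc(2) by blast
      have "\<not> C \<subseteq> ball x e"
      proof
        assume "C \<subseteq> ball x e"
        then have "C \<inter> cball x e = C"
          using ball_subset_cball by blast
        then show False
          using y(1,3)[of 0] C'(2) \<open>x \<in> C\<close> by (simp add: connected_component_eq_self)
      qed
      have diam: "diameter (?cc (y n)) > e/3" for n
      proof -
        obtain F where F: "connected F" "F \<subseteq> C \<inter> closure (ball x e)" "y n \<in> F" "F \<inter> frontier (ball x e) \<noteq> {}"
        proof (rule boundary_bumping[of C "ball x e" "y n"])
          show "compact (C \<inter> closure (ball x e))"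
            using C'(1) by (intro compact_Int_closed) auto
        qed (use C' compact_imp_closed[OF C'(1)] y(1) ye(2) \<open>\<not> C \<subseteq> ball x e\<close> in auto)
        have "F \<inter> sphere x e \<noteq> {}"
          using F(4) \<open>e > 0\<close> by simp
        then obtain z where "z \<in> F" "z \<in> sphere x e"
          by blast
        have "F \<subseteq> ?cc (y n)"
          using F \<open>e > 0\<close> by (intro connected_component_maximal) auto
        then have "dist (y n) z \<le> diameter (?cc (y n))"
          using diameter_bounded_bound[OF compact_imp_bounded[OF cpt] ycc(1)] \<open>z \<in> F\<close> by blast
        moreover have "e \<le> dist x (y n) + dist (y n) z"
          using \<open>z \<in> sphere x e\<close> dist_triangle[of x z "y n"] by simp
        ultimately show ?thesis
          using ye(1)[of n] \<open>e > 0\<close> by linarith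
      qed
      have "finite (range (\<lambda>n. ?cc (y n)))"
      proof (rule finite_disjoint_boundary_continua[OF \<Omega>])
        show "e/3 > 0"
          using \<open>e > 0\<close> by simp
        show "A \<inter> B = {}" if "A \<in> range (\<lambda>n. ?cc (y n))" "B \<in> range (\<lambda>n. ?cc (y n))" "A \<noteq> B" for A B
          using that ycc(2) components_nonoverlap by blast
        fix Q assume "Q \<in> range (\<lambda>n. ?cc (y n))"
        then obtain n where Q: "Q = ?cc (y n)"
          by blast
        show "compact Q" "connected Q" "diameter Q > e/3"
          unfolding Q using cpt diam by simp_all
        show "Q \<subseteq> ?K"
          unfolding Q using connected_component_subset C'(3) by blast
      qed
      then have "closed (\<Union>(range (\<lambda>n. ?cc (y n))))"
        using cpt compact_imp_closed by (intro closed_Union) blast+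
      moreover have "y n \<in> \<Union>(range (\<lambda>n. ?cc (y n)))" for n
        using ycc(1) by blast
      moreover have "y \<longlonglongrightarrow> x"
        using y(2) by (intro LIMSEQ_of_dist_less_inverse_Suc) simp
      ultimately have "x \<in> \<Union>(range (\<lambda>n. ?cc (y n)))"
        by (metis closed_sequentially)
      then show False
        using xcc by blast
    qed
  qed
qed

section \<open>The extended complex plane\<close>

text \<open>The law of cosines compares chordal with great-circle distance; continuity of
  \<open>to_sphere\<close> follows from it.\<close>

lemma norm_to_sphere_diff:
  "(norm (to_sphere p - to_sphere q))\<^sup>2 = 2 - 2 * cos (dist p q)"
proof -
  have "\<bar>to_sphere p \<bullet> to_sphere q\<bar> \<le> 1"
    using Cauchy_Schwarz_ineq2[of "to_sphere p" "to_sphere q"] by simp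
  then have "cos (dist p q) = to_sphere p \<bullet> to_sphere q"
    by (simp add: dist_ext_complex_def cos_arccos_abs)
  moreover have "(norm (to_sphere p - to_sphere q))\<^sup>2
      = (norm (to_sphere p))\<^sup>2 - 2 * (to_sphere p \<bullet> to_sphere q) + (norm (to_sphere q))\<^sup>2"
    by (simp only: power2_norm_eq_inner inner_diff_left inner_diff_right inner_commute)
  ultimately show ?thesis
    by simp
qed

lemma continuous_to_sphere: "continuous_on UNIV to_sphere"
  unfolding continuous_on_def
proof
  fix p :: ext_complex
  have "((\<lambda>q. 2 - 2 * cos (dist q p)) \<longlongrightarrow> 2 - 2 * cos (dist p p)) (at p)"
    by (intro tendsto_intros)
  then have "((\<lambda>q. sqrt ((norm (to_sphere q - to_sphere p))\<^sup>2)) \<longlongrightarrow> sqrt 0) (at p)"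
    unfolding norm_to_sphere_diff by (intro tendsto_real_sqrt) simp
  then show "(to_sphere \<longlongrightarrow> to_sphere p) (at p within UNIV)"
    by (subst Lim_null) (simp add: tendsto_norm_zero_iff)
qed

lemma to_sphere_surj: "range to_sphere = sphere 0 1"
proof
  show "sphere 0 1 \<subseteq> range to_sphere"
  proof
    fix v :: "complex \<times> real" assume v: "v \<in> sphere 0 1"
    obtain w t where wt: "v = (w, t)"
      by fastforce
    have wt1: "(cmod w)\<^sup>2 + t\<^sup>2 = 1"
      using v by (simp add: wt norm_Pair)
    show "v \<in> range to_sphere"
    proof (cases "t = 1")
      case True
      then have "v = to_sphere Infty"
        using wt1 by (simp add: wt)
      then show ?thesis
        by blast
    next
      case False
      \<comment> \<open>Stereographic projection of \<open>(w, t)\<close> from the north pole, the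
        inverse of \<open>to_sphere\<close> off that pole.\<close>
      define z where "z = (1 / (1 - t)) *\<^sub>R w"
      have "(cmod z)\<^sup>2 = (1 - t\<^sup>2) / (1 - t)\<^sup>2"
      proof -
        have "(cmod w)\<^sup>2 = 1 - t\<^sup>2"
          using wt1 by simp
        then show ?thesis
          by (simp add: z_def power_mult_distrib power_divide)
      qed
      also have "\<dots> = (1 + t) / (1 - t)"
        using False by (simp add: power2_eq_square divide_simps) (simp add: algebra_simps)
      finally have z: "(cmod z)\<^sup>2 = (1 + t) / (1 - t)" .
      have "(cmod z)\<^sup>2 + 1 = 2 / (1 - t)" "(cmod z)\<^sup>2 - 1 = 2 * t / (1 - t)"
        unfolding z using False by (simp_all add: field_simps)
      then have "to_sphere (Fin z) = v"
        using False by (simp add: wt z_def)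
      then show ?thesis
        by blast
    qed
  qed
qed auto

lemma continuous_from_sphere: "continuous_on (sphere 0 1) (inv to_sphere)"
  unfolding continuous_on_def
proof
  fix v :: "complex \<times> real" assume v: "v \<in> sphere 0 1"
  have inv: "to_sphere (inv to_sphere a) = a" if "a \<in> sphere 0 1" for a
    using that to_sphere_surj by (metis f_inv_into_f)
  have "continuous_on {-1..1} arccos"
    by (rule continuous_on_arccos')
  then have "continuous_on (sphere 0 1) (\<lambda>a. arccos (a \<bullet> v))"
  proof (rule continuous_on_compose2)
    show "continuous_on (sphere 0 1) (\<lambda>a. a \<bullet> v)"
      by (intro continuous_intros)
    show "(\<lambda>a. a \<bullet> v) ` sphere 0 1 \<subseteq> {-1..1}"
    proof (rule image_subsetI)
      fix a :: "complex \<times> real" assume "a \<in> sphere 0 1"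
      then have "\<bar>a \<bullet> v\<bar> \<le> 1"
        using v Cauchy_Schwarz_ineq2[of a v] by simp
      then show "a \<bullet> v \<in> {-1..1}"
        by (simp add: abs_le_iff)
    qed
  qed
  then have "((\<lambda>a. arccos (a \<bullet> v)) \<longlongrightarrow> arccos (v \<bullet> v)) (at v within sphere 0 1)"
    using v by (auto simp: continuous_on_def)
  moreover have "v \<bullet> v = 1"
    using v by (simp add: dot_square_norm)
  ultimately have "((\<lambda>a. arccos (a \<bullet> v)) \<longlongrightarrow> 0) (at v within sphere 0 1)"
    by simp
  then have "((\<lambda>a. dist (inv to_sphere a) (inv to_sphere v)) \<longlongrightarrow> 0) (at v within sphere 0 1)"
  proof (rule Lim_transform_within[OF _ zero_less_one])
    fix a :: "complex \<times> real" assume "a \<in> sphere 0 1"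
    then show "arccos (a \<bullet> v) = dist (inv to_sphere a) (inv to_sphere v)"
      using inv v by (simp add: dist_ext_complex_def)
  qed
  then show "(inv to_sphere \<longlongrightarrow> inv to_sphere v) (at v within sphere 0 1)"
    by (rule tendsto_dist_iff[THEN iffD2])
qed

lemma homeomorphism_to_sphere: "homeomorphism UNIV (sphere 0 1) to_sphere (inv to_sphere)"
proof (rule homeomorphismI)
  show "to_sphere (inv to_sphere y) = y" if "y \<in> sphere 0 1" for y
    using that to_sphere_surj by (metis f_inv_into_f)
  show "inv to_sphere (to_sphere x) = x" for x
    by (simp add: inj_to_sphere)
qed (use continuous_to_sphere continuous_from_sphere in auto)

lemma homeomorphic_sphere: "(UNIV :: ext_complex set) homeomorphic (sphere 0 1 :: (complex \<times> real) set)"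
  using homeomorphism_to_sphere unfolding homeomorphic_def by blast

lemma compact_UNIV_ext_complex: "compact (UNIV :: ext_complex set)"
  using homeomorphic_compactness[OF homeomorphic_sphere] by simp

lemma closed_imp_compact_ext_complex: "closed S \<Longrightarrow> compact (S :: ext_complex set)"
  using compact_Int_closed[OF compact_UNIV_ext_complex] by auto

lemma locally_path_connected_UNIV_ext_complex: "locally path_connected (UNIV :: ext_complex set)"
  using homeomorphic_locally[OF homeomorphic_sphere, of path_connected path_connected]
    homeomorphic_path_connectedness locally_path_connected_sphere by blast

lemma locally_connected_UNIV_ext_complex: "locally connected (UNIV :: ext_complex set)"
  using locally_path_connected_imp_locally_connected[OF locally_path_connected_UNIV_ext_complex] .

section \<open>Paths and arcs to a boundary point, and the punctured sphere\<close>

lemma open_connected_imp_path_connected: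
  fixes S :: "'a::metric_space set"
  assumes lpc: "locally path_connected (UNIV :: 'a set)" and "open S" "connected S"
  shows "path_connected S"
proof -
  have "locally path_connected S"
    using locally_open_subset[OF lpc, of S] \<open>open S\<close> by simp
  then show ?thesis
    using \<open>connected S\<close> path_component_eq_connected_component[of S]
    by (auto simp: path_connected_component connected_iff_connected_component)
qed

text \<open>The path is carried by \<open>to_sphere\<close> into a Euclidean space, an arc is
  extracted there, and the injective inverse brings it back.\<close>

lemma path_contains_arc_ext_complex:
  fixes \<gamma> :: "real \<Rightarrow> ext_complex"
  assumes "path \<gamma>" "pathstart \<gamma> = a" "pathfinish \<gamma> = b" "a \<noteq> b"
  obtains g where "arc g" "path_image g \<subseteq> path_image \<gamma>" "pathstart g = a" "pathfinish g = b"
proof -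
  let ?j = "inv to_sphere"
  have inv: "?j (to_sphere x) = x" for x
    by (simp add: inj_to_sphere)
  have "path (to_sphere \<circ> \<gamma>)"
    using assms(1) continuous_to_sphere by (intro path_continuous_image continuous_on_subset[OF continuous_to_sphere]) auto
  moreover have "to_sphere a \<noteq> to_sphere b"
    using assms(4) inj_to_sphere by (simp add: inj_eq)
  ultimately obtain h where h: "arc h" "path_image h \<subseteq> path_image (to_sphere \<circ> \<gamma>)"
    "pathstart h = to_sphere a" "pathfinish h = to_sphere b"
    using path_contains_arc[of "to_sphere \<circ> \<gamma>" "to_sphere a" "to_sphere b"] assms(2,3)
    by (auto simp: pathstart_compose pathfinish_compose)
  have hs: "path_image h \<subseteq> range to_sphere"
    using h(2) by (auto simp: path_image_compose)
  have "continuous_on (path_image h) ?j"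
    using continuous_on_subset[OF continuous_from_sphere] hs to_sphere_surj by simp
  moreover have "inj_on ?j (path_image h)"
    using hs by (rule inj_on_inv_into)
  ultimately have "arc (?j \<circ> h)"
    using h(1) unfolding arc_def path_image_def by (auto intro: path_continuous_image comp_inj_on simp: path_image_def)
  moreover have "path_image (?j \<circ> h) \<subseteq> path_image \<gamma>"
    using h(2) inv by (force simp: path_image_compose)
  moreover have "pathstart (?j \<circ> h) = a" "pathfinish (?j \<circ> h) = b"
    using h(3,4) inv by (simp_all add: pathstart_compose pathfinish_compose)
  ultimately show thesis
    by (rule that)
qed

text \<open>The sphere without a point is homeomorphic to a hyperplane, here the one with second
  coordinate 0, which is a copy of the plane. The removed point is arbitrary, so that it can be
  chosen in \<Omega>.\<close>

lemma punctured_ext_complex_chart: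
  obtains f :: "complex \<Rightarrow> ext_complex" and g where "homeomorphism UNIV (UNIV - {\<omega>}) f g"
proof -
  have "sphere (0 :: complex \<times> real) 1 - {to_sphere \<omega>} homeomorphic (UNIV :: complex set)"
  proof -
    have "sphere (0 :: complex \<times> real) 1 - {to_sphere \<omega>} homeomorphic {x :: complex \<times> real. (0, 1) \<bullet> x = 0}"
    proof (rule homeomorphic_punctured_sphere_hyperplane)
      show "to_sphere \<omega> \<in> sphere 0 1"
        using to_sphere_surj by blast
    qed (auto simp: zero_prod_def)
    also have "{x :: complex \<times> real. (0, 1) \<bullet> x = 0} homeomorphic (UNIV :: complex set)"
      unfolding homeomorphic_minimal
      by (intro exI[of _ fst] exI[of _ "\<lambda>z. (z, 0)"]) (auto simp: inner_prod_def intro!: continuous_intros)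
    finally show ?thesis .
  qed
  moreover have "(UNIV - {\<omega>}) homeomorphic (sphere (0 :: complex \<times> real) 1 - {to_sphere \<omega>})"
    unfolding homeomorphic_def
  proof (intro exI)
    show "homeomorphism (UNIV - {\<omega>}) (sphere 0 1 - {to_sphere \<omega>}) to_sphere (inv to_sphere)"
    proof (rule homeomorphism_of_subsets[OF homeomorphism_to_sphere])
      show "to_sphere ` (UNIV - {\<omega>}) = sphere 0 1 - {to_sphere \<omega>}"
        using to_sphere_surj inj_to_sphere by (simp add: image_set_diff)
    qed auto
  qed
  ultimately have "(UNIV :: complex set) homeomorphic (UNIV - {\<omega>})"
    by (meson homeomorphic_sym homeomorphic_trans)
  then show thesis
    using that unfolding homeomorphic_def by blast
qed

text \<open>The paths are run one per unit of time on the half-line, which is compressed to a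
  bounded interval through \<open>t / (1 - t)\<close>; continuity at 1 holds because the images
  shrink to \<open>p\<close>.\<close>

lemma path_concat_sequence:
  fixes \<gamma> :: "nat \<Rightarrow> real \<Rightarrow> 'a::metric_space"
  assumes \<gamma>: "\<And>n. path (\<gamma> n)" "\<And>n. pathfinish (\<gamma> n) = pathstart (\<gamma> (Suc n))"
    and r: "\<And>n. path_image (\<gamma> n) \<subseteq> ball p (r n)" "r \<longlonglongrightarrow> 0"
  obtains h where "path h" "pathstart h = pathstart (\<gamma> 0)" "pathfinish h = p"
    "path_image h \<subseteq> insert p (\<Union>n. path_image (\<gamma> n))"
proof -
  define H where "H s = \<gamma> (nat \<lfloor>s\<rfloor>) (s - of_int \<lfloor>s\<rfloor>)" for s :: real
  have Hin: "H s \<in> path_image (\<gamma> (nat \<lfloor>s\<rfloor>))" for s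
    by (auto simp: H_def path_image_def intro!: imageI) linarith
  \<comment> \<open>At an integer time the floor already selects the next path, which starts where
    the previous one ended.\<close>
  have Heq: "H s = \<gamma> n (s - real n)" if "s \<in> {real n..real (Suc n)}" for n s
  proof (cases "s = real (Suc n)")
    case True
    then have "\<lfloor>s\<rfloor> = int (Suc n)"
      by simp
    then have "H s = \<gamma> (Suc n) 0"
      using True by (simp only: H_def nat_int) simp
    then show ?thesis
      using True \<gamma>(2)[of n] by (simp add: pathstart_def pathfinish_def)
  next
    case False
    then have "\<lfloor>s\<rfloor> = int n"
      using that by (intro floor_unique) auto
    then show ?thesis
      by (simp add: H_def)
  qed
  have Hn: "continuous_on {real n..real (Suc n)} H" for n
  proof (rule continuous_on_eq[of _ "\<lambda>s. \<gamma> n (s - real n)"])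
    show "continuous_on {real n..real (Suc n)} (\<lambda>s. \<gamma> n (s - real n))"
      using \<gamma>(1)[of n] unfolding path_def
      by (rule continuous_on_compose2) (auto intro!: continuous_intros)
  qed (use Heq in simp)
  have H0: "continuous_on {0..real n} H" for n
  proof (induction n)
    case (Suc n)
    have "{0..real (Suc n)} = {0..real n} \<union> {real n..real (Suc n)}"
      by auto
    then show ?case
      using continuous_on_closed_Un[OF _ _ Suc Hn[of n]] by simp
  qed simp
  define h where "h t = (if t < 1 then H (t / (1 - t)) else p)" for t
  have hcont: "continuous_on {0..a} h" if "a < 1" for a
  proof -
    obtain n where n: "a / (1 - a) \<le> real n"
      using real_arch_simple by blast
    have "continuous_on {0..a} (\<lambda>t. H (t / (1 - t)))"
    proof (rule continuous_on_compose2[OF H0[of n]])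
      show "continuous_on {0..a} (\<lambda>t. t / (1 - t))"
        using that by (intro continuous_intros) auto
      have "t / (1 - t) \<le> a / (1 - a)" if "t \<in> {0..a}" for t
        using that \<open>a < 1\<close> by (intro frac_le) auto
      then show "(\<lambda>t. t / (1 - t)) ` {0..a} \<subseteq> {0..real n}"
        using n \<open>a < 1\<close> by force
    qed
    then show ?thesis
      by (rule continuous_on_eq) (use that in \<open>simp add: h_def\<close>)
  qed
  have "continuous_on {0..1} h"
    unfolding continuous_on_iff
  proof (intro ballI allI impI)
    fix t e :: real assume t: "t \<in> {0..1}" and "e > 0"
    show "\<exists>d>0. \<forall>s\<in>{0..1}. dist s t < d \<longrightarrow> dist (h s) (h t) < e"
    proof (cases "t < 1")
      case True
      define a where "a = (t + 1) / 2"
      have a: "a < 1" "t < a"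
        using True by (simp_all add: a_def)
      have "t \<in> {0..a}"
        using a t by simp
      then obtain d where d: "d > 0" "\<And>s. \<lbrakk>s \<in> {0..a}; dist s t < d\<rbrakk> \<Longrightarrow> dist (h s) (h t) < e"
        using hcont[OF a(1)] \<open>e > 0\<close> unfolding continuous_on_iff by blast
      show ?thesis
      proof (intro exI[of _ "min d (a - t)"] conjI ballI impI)
        show "0 < min d (a - t)"
          using d a by simp
        fix s assume "s \<in> {0..1}" "dist s t < min d (a - t)"
        then show "dist (h s) (h t) < e"
          by (intro d(2)) (auto simp: dist_real_def abs_if split: if_splits)
      qed
    next
      case False
      then have "t = 1"
        using t by simp
      obtain M where M: "\<And>n. n \<ge> M \<Longrightarrow> r n < e"
        using order_tendstoD(2)[OF r(2) \<open>e > 0\<close>] by (auto simp: eventually_sequentially)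
      show ?thesis
      \<comment> \<open>For \<open>s < 1\<close>, \<open>1 - s < 1 / (M + 1)\<close> says exactly
        that the time \<open>s / (1 - s)\<close> exceeds \<open>M\<close>.\<close>
      proof (intro exI[of _ "1 / (real M + 1)"] conjI ballI impI)
        fix s assume s: "s \<in> {0..1}" "dist s t < 1 / (real M + 1)"
        show "dist (h s) (h t) < e"
        proof (cases "s < 1")
          case True
          have "(1 - s) * (real M + 1) < 1"
            using s True \<open>t = 1\<close> by (simp add: dist_real_def field_simps)
          then have "real M * (1 - s) \<le> s"
            using True by (simp add: algebra_simps)
          then have "real M \<le> s / (1 - s)"
            using True by (simp add: pos_le_divide_eq)
          then have "M \<le> nat \<lfloor>s / (1 - s)\<rfloor>"
            by (simp add: le_nat_floor)
          moreover have "h s \<in> ball p (r (nat \<lfloor>s / (1 - s)\<rfloor>))"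
            using subsetD[OF r(1) Hin[of "s / (1 - s)"]] True by (simp add: h_def del: mem_ball)
          ultimately show ?thesis
            using M[of "nat \<lfloor>s / (1 - s)\<rfloor>"] \<open>t = 1\<close> by (simp add: h_def dist_commute)
        next
          case False
          then show ?thesis
            using \<open>t = 1\<close> \<open>e > 0\<close> by (simp add: h_def)
        qed
      qed simp
    qed
  qed
  then have "path h"
    by (simp add: path_def)
  moreover have "pathstart h = pathstart (\<gamma> 0)" "pathfinish h = p"
    by (simp_all add: pathstart_def pathfinish_def h_def H_def)
  moreover have "path_image h \<subseteq> insert p (\<Union>n. path_image (\<gamma> n))"
    using Hin by (auto simp: path_image_def h_def)
  ultimately show thesis
    by (rule that)
qed

text \<open>Otherwise some sequence tends to \<open>p\<close> while the component of each term has
  \<open>p\<close> outside its closure; but one connected set contains infinitely many terms and so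
  accumulates at \<open>p\<close>.\<close>

lemma lsa_component_closure:
  assumes lsa: "locally_sequentially_accessible \<Omega> p" and "r > 0"
  obtains \<delta> where "\<delta> > 0" "\<delta> \<le> r" "\<And>x. \<lbrakk>x \<in> \<Omega>; dist p x < \<delta>\<rbrakk> \<Longrightarrow> p \<in> closure (connected_component_set (\<Omega> \<inter> ball p r) x)"
proof (rule ccontr)
  assume neg: "\<not> thesis"
  have "\<exists>x. x \<in> \<Omega> \<and> dist p x < min r (inverse (real (Suc n))) \<and> p \<notin> closure (connected_component_set (\<Omega> \<inter> ball p r) x)" for n
  proof (rule ccontr)
    assume "\<not> ?thesis"
    then show False
      using neg that[of "min r (inverse (real (Suc n)))"] \<open>r > 0\<close> by auto
  qed
  then obtain x where x: "\<And>n. x n \<in> \<Omega>" "\<And>n. dist p (x n) < min r (inverse (real (Suc n)))"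
    "\<And>n. p \<notin> closure (connected_component_set (\<Omega> \<inter> ball p r) (x n))"
    by metis
  have "x \<longlonglongrightarrow> p"
    using x(2) by (intro LIMSEQ_of_dist_less_inverse_Suc) simp
  then obtain C where C: "connected C" "C \<subseteq> \<Omega> \<inter> ball p r" "infinite {n. x n \<in> C}"
    using lsaD[of \<Omega> p "ball p r" x] lsa x(1) \<open>r > 0\<close> by auto
  obtain m where m: "x m \<in> C"
    using C(3) not_finite_existsD by blast
  have "p \<in> closure C"
    unfolding closure_approachable
  proof (intro allI impI)
    fix e :: real assume "e > 0"
    then obtain M where "\<And>n. n \<ge> M \<Longrightarrow> dist (x n) p < e"
      using metric_LIMSEQ_D[OF \<open>x \<longlonglongrightarrow> p\<close>] by blast
    moreover obtain n where "n \<ge> M" "x n \<in> C"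
      using C(3) unfolding infinite_nat_iff_unbounded_le by blast
    ultimately show "\<exists>y\<in>C. dist y p < e"
      by blast
  qed
  moreover have "C \<subseteq> connected_component_set (\<Omega> \<inter> ball p r) (x m)"
    using C m by (intro connected_component_maximal) auto
  ultimately show False
    using x(3)[of m] closure_mono by blast
qed

text \<open>Along radii \<open>e / 2 ^ n\<close> one moves from \<open>X n\<close> to a point
  \<open>X (Suc n)\<close> of the same component of \<open>\<Omega> \<inter> ball p (r n)\<close>
  that is already close enough to \<open>p\<close> for the next radius; it exists because
  \<open>p\<close> is in the closure of that component. The paths between them, inside these
  components, are concatenated.\<close>

lemma lsa_imp_small_path:
  fixes \<Omega> :: "'a::metric_space set"
  assumes lpc: "locally path_connected (UNIV :: 'a set)" and "open \<Omega>"
    and lsa: "locally_sequentially_accessible \<Omega> p" and "e > 0"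
  obtains \<delta> where "\<delta> > 0" "\<And>x. \<lbrakk>x \<in> \<Omega>; dist p x < \<delta>\<rbrakk> \<Longrightarrow>
    \<exists>h. path h \<and> pathstart h = x \<and> pathfinish h = p \<and> path_image h \<subseteq> insert p (\<Omega> \<inter> ball p e)"
proof -
  define r where "r n = e / 2 ^ n" for n :: nat
  have r: "r n > 0" "r n \<le> e" for n
    using \<open>e > 0\<close> by (simp_all add: r_def divide_le_eq)
  have "r \<longlonglongrightarrow> 0"
    unfolding r_def using LIMSEQ_divide_realpow_zero[of 2 e] by simp
  let ?cc = "\<lambda>n x. connected_component_set (\<Omega> \<inter> ball p (r n)) x"
  have "\<exists>\<delta>. \<delta> > 0 \<and> \<delta> \<le> r n \<and> (\<forall>x. x \<in> \<Omega> \<longrightarrow> dist p x < \<delta> \<longrightarrow> p \<in> closure (?cc n x))" for n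
    using lsa_component_closure[OF lsa r(1), of n] by metis
  then obtain \<delta> where \<delta>: "\<And>n. \<delta> n > 0" "\<And>n. \<delta> n \<le> r n"
    "\<And>n x. \<lbrakk>x \<in> \<Omega>; dist p x < \<delta> n\<rbrakk> \<Longrightarrow> p \<in> closure (?cc n x)"
    by metis
  show thesis
  proof (rule that[OF \<delta>(1)[of 0]])
    fix x assume x: "x \<in> \<Omega>" "dist p x < \<delta> 0"
    \<comment> \<open>The clause for \<open>n = 0\<close> fixes the starting point within the
      dependent choice.\<close>
    have "\<exists>X. (\<forall>n. X n \<in> \<Omega> \<and> dist p (X n) < \<delta> n \<and> (n = 0 \<longrightarrow> X n = x)) \<and> (\<forall>n. X (Suc n) \<in> ?cc n (X n))"
    proof -
      have "\<exists>X. \<forall>n. (X n \<in> \<Omega> \<and> dist p (X n) < \<delta> n \<and> (n = 0 \<longrightarrow> X n = x)) \<and> X (Suc n) \<in> ?cc n (X n)"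
      proof (rule dependent_nat_choice)
        show "\<exists>y. y \<in> \<Omega> \<and> dist p y < \<delta> 0 \<and> (0 = (0::nat) \<longrightarrow> y = x)"
          using x by blast
        fix y and n :: nat assume "y \<in> \<Omega> \<and> dist p y < \<delta> n \<and> (n = 0 \<longrightarrow> y = x)"
        then have "p \<in> closure (?cc n y)"
          using \<delta>(3) by blast
        then obtain z where "z \<in> ?cc n y" "dist z p < \<delta> (Suc n)"
          using \<delta>(1) unfolding closure_approachable by blast
        moreover from this have "z \<in> \<Omega>"
          using connected_component_subset by blast
        ultimately show "\<exists>z. (z \<in> \<Omega> \<and> dist p z < \<delta> (Suc n) \<and> (Suc n = 0 \<longrightarrow> z = x)) \<and> z \<in> ?cc n y"
          by (auto simp: dist_commute)
      qed
      then show ?thesis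
        by blast
    qed
    then obtain X where X: "\<And>n. X n \<in> \<Omega>" "\<And>n. dist p (X n) < \<delta> n" "X 0 = x" "\<And>n. X (Suc n) \<in> ?cc n (X n)"
      by blast
    have "\<exists>g. path g \<and> path_image g \<subseteq> \<Omega> \<inter> ball p (r n) \<and> pathstart g = X n \<and> pathfinish g = X (Suc n)" for n
    proof -
      have in_cc: "X n \<in> ?cc n (X n)" "?cc n (X n) \<in> components (\<Omega> \<inter> ball p (r n))"
        using X(1)[of n] X(2)[of n] \<delta>(2)[of n] by (auto simp: componentsI connected_component_refl)
      have "open (?cc n (X n))"
        using open_component[OF locally_path_connected_imp_locally_connected[OF lpc] _ in_cc(2)] \<open>open \<Omega>\<close> by blast
      then have "path_connected (?cc n (X n))"
        by (intro open_connected_imp_path_connected[OF lpc]) auto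
      then obtain g where "path g" "path_image g \<subseteq> ?cc n (X n)" "pathstart g = X n" "pathfinish g = X (Suc n)"
        using in_cc(1) X(4)[of n] unfolding path_connected_def by blast
      then show ?thesis
        using in_components_subset[OF in_cc(2)] by blast
    qed
    then obtain \<gamma> where \<gamma>: "\<And>n. path (\<gamma> n)" "\<And>n. path_image (\<gamma> n) \<subseteq> \<Omega> \<inter> ball p (r n)"
      "\<And>n. pathstart (\<gamma> n) = X n" "\<And>n. pathfinish (\<gamma> n) = X (Suc n)"
      by metis
    obtain h where h: "path h" "pathstart h = pathstart (\<gamma> 0)" "pathfinish h = p"
      "path_image h \<subseteq> insert p (\<Union>n. path_image (\<gamma> n))"
    proof (rule path_concat_sequence[of \<gamma> p r])
      show "path_image (\<gamma> n) \<subseteq> ball p (r n)" for n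
        using \<gamma>(2) by blast
    qed (use \<gamma> \<open>r \<longlonglongrightarrow> 0\<close> in auto)
    have "ball p (r n) \<subseteq> ball p e" for n
      using r(2) by (rule subset_ball)
    then have "path_image h \<subseteq> insert p (\<Omega> \<inter> ball p e)"
      using h(4) \<gamma>(2) by blast
    then show "\<exists>h. path h \<and> pathstart h = x \<and> pathfinish h = p \<and> path_image h \<subseteq> insert p (\<Omega> \<inter> ball p e)"
      using h \<gamma>(3) X(3) by metis
  qed
qed

text \<open>A path with different end points contains an arc, and \<open>x \<noteq> p\<close> since
  \<open>p\<close> is not in \<Omega>. The radius \<open>e/3\<close> keeps the diameter below
  \<open>e\<close>.\<close>

lemma lsa_imp_locally_accessible:
  fixes \<Omega> :: "ext_complex set"
  assumes "open \<Omega>" "p \<notin> \<Omega>" and lsa: "locally_sequentially_accessible \<Omega> p"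
  shows "locally_accessible \<Omega> p"
  unfolding locally_accessible_def
proof (intro allI impI)
  fix e :: real assume "e > 0"
  then have "e/3 > 0"
    by simp
  then obtain \<delta> where \<delta>: "\<delta> > 0" "\<And>x. \<lbrakk>x \<in> \<Omega>; dist p x < \<delta>\<rbrakk> \<Longrightarrow>
    \<exists>h. path h \<and> pathstart h = x \<and> pathfinish h = p \<and> path_image h \<subseteq> insert p (\<Omega> \<inter> ball p (e/3))"
    using lsa_imp_small_path[OF locally_path_connected_UNIV_ext_complex \<open>open \<Omega>\<close> lsa] by metis
  have "\<exists>g. arc g \<and> path_image g \<subseteq> \<Omega> \<union> {p} \<and> pathstart g = x \<and> pathfinish g = p \<and> diameter (path_image g) < e"
    if x: "x \<in> \<Omega>" "dist x p < \<delta>" for x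
  proof -
    obtain h where h: "path h" "pathstart h = x" "pathfinish h = p" "path_image h \<subseteq> insert p (\<Omega> \<inter> ball p (e/3))"
      using \<delta>(2)[of x] x by (auto simp: dist_commute)
    moreover have "x \<noteq> p"
      using x(1) \<open>p \<notin> \<Omega>\<close> by blast
    ultimately obtain g where g: "arc g" "path_image g \<subseteq> path_image h" "pathstart g = x" "pathfinish g = p"
      using path_contains_arc_ext_complex by metis
    have "path_image g \<subseteq> cball p (e/3)"
      using g(2) h(4) \<open>e > 0\<close> by auto
    then have "diameter (path_image g) < e"
      using diameter_le_of_subset_ball[of "path_image g" p "e/3"] \<open>e > 0\<close> by simp
    moreover have "path_image g \<subseteq> \<Omega> \<union> {p}"
      using g(2) h(4) by blast
    ultimately show ?thesis
      using g by blast
  qed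
  then show "\<exists>\<delta>>0. \<forall>x\<in>\<Omega>. dist x p < \<delta> \<longrightarrow>
      (\<exists>g. arc g \<and> path_image g \<subseteq> \<Omega> \<union> {p} \<and> pathstart g = x \<and> pathfinish g = p \<and> diameter (path_image g) < e)"
    using \<delta>(1) by blast
qed

section \<open>Transfer through homeomorphisms and the chart\<close>

lemma components_homeomorphic_image:
  assumes hom: "homeomorphism K L h k" and "D \<in> components L"
  obtains C where "C \<in> components K" "D = h ` C"
proof -
  have h: "continuous_on K h" "h ` K = L" "\<And>x. x \<in> K \<Longrightarrow> k (h x) = x"
    and k: "continuous_on L k" "k ` L = K" "\<And>y. y \<in> L \<Longrightarrow> h (k y) = y"
    using hom by (auto simp: homeomorphism_def)
  have D: "D \<subseteq> L" "connected D" "D \<noteq> {}"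
    using assms(2) in_components_subset in_components_connected in_components_nonempty by blast+
  then obtain y where y: "y \<in> D"
    by blast
  then have "k y \<in> K"
    using D(1) k(2) by blast
  define C where "C = connected_component_set K (k y)"
  have C: "C \<in> components K" "k y \<in> C" "C \<subseteq> K" "connected C"
    using \<open>k y \<in> K\<close> by (auto simp: C_def componentsI connected_component_refl connected_component_in)
  have "connected (k ` D)"
    using connected_continuous_image continuous_on_subset k(1) D by blast
  then have "k ` D \<subseteq> C"
    using C(1,2) y D(1) k(2) by (intro component_between[of "k ` D" K C]) auto
  then have "h ` k ` D \<subseteq> h ` C"
    by blast
  moreover have "h ` k ` D = D"
    using k(3) D(1) by (force simp: image_image)
  moreover have "h ` C \<subseteq> D"
  proof (rule component_between[OF _ _ assms(2)])
    show "connected (h ` C)"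
      using connected_continuous_image continuous_on_subset h(1) C by blast
    show "h ` C \<subseteq> L"
      using C(3) h(2) by blast
    show "h ` C \<inter> D \<noteq> {}"
      using C(2) y k(3)[of y] D(1) by (metis IntI empty_iff image_eqI subsetD)
  qed
  ultimately show thesis
    using that[OF C(1)] by blast
qed

text \<open>Finiteness survives because \<open>h\<close> is uniformly continuous on the compact set
  \<open>K\<close>: a component of diameter at most \<open>d/2\<close> has an image of diameter at
  most \<open>e\<close>.\<close>

lemma Peano_compactum_homeomorphic_image:
  fixes h :: "'a::metric_space \<Rightarrow> 'b::metric_space"
  assumes K: "Peano_compactum K" and hom: "homeomorphism K L h k"
  shows "Peano_compactum L"
  unfolding Peano_compactum_def
proof (intro conjI ballI allI impI)
  have h: "continuous_on K h" "h ` K = L"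
    using hom by (auto simp: homeomorphism_def)
  have "compact K"
    using K by (simp add: Peano_compactum_def)
  then show "compact L"
    using compact_continuous_image[OF h(1)] h(2) by simp
  show "Peano_continuum D" if D: "D \<in> components L" for D
  proof -
    obtain C where C: "C \<in> components K" "D = h ` C"
      using components_homeomorphic_image[OF hom D] by blast
    then obtain \<gamma> where \<gamma>: "path \<gamma>" "path_image \<gamma> = C"
      using K unfolding Peano_compactum_def Peano_continuum_def by blast
    have "path (h \<circ> \<gamma>)"
      using \<gamma> continuous_on_subset[OF h(1) in_components_subset[OF C(1)]] by (intro path_continuous_image) auto
    moreover have "path_image (h \<circ> \<gamma>) = D"
      using \<gamma>(2) C(2) by (simp add: path_image_compose)
    ultimately show ?thesis
      unfolding Peano_continuum_def by blast
  qed
  fix e :: real assume "e > 0"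
  obtain d where d: "d > 0" "\<And>x y. \<lbrakk>x \<in> K; y \<in> K; dist y x < d\<rbrakk> \<Longrightarrow> dist (h y) (h x) < e"
    using compact_uniformly_continuous[OF h(1) \<open>compact K\<close>] \<open>e > 0\<close>
    unfolding uniformly_continuous_on_def by metis
  have "{D \<in> components L. diameter D > e} \<subseteq> (`) h ` {C \<in> components K. diameter C > d/2}"
  proof
    fix D assume D: "D \<in> {D \<in> components L. diameter D > e}"
    then obtain C where C: "C \<in> components K" "D = h ` C"
      using components_homeomorphic_image[OF hom, of D] by blast
    have "diameter C > d/2"
    proof (rule ccontr)
      assume small: "\<not> diameter C > d/2"
      have "bounded C"
        using bounded_subset[OF compact_imp_bounded[OF \<open>compact K\<close>] in_components_subset[OF C(1)]] .
      have "dist (h x) (h y) \<le> e" if "x \<in> C" "y \<in> C" for x y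
        using d(2)[of y x] diameter_bounded_bound[OF \<open>bounded C\<close> that] small d(1) that
          in_components_subset[OF C(1)] by fastforce
      then have "diameter D \<le> e"
        unfolding C(2) using \<open>e > 0\<close> by (auto simp: diameter_def intro!: cSUP_least)
      then show False
        using D by simp
    qed
    then show "D \<in> (`) h ` {C \<in> components K. diameter C > d/2}"
      using C by blast
  qed
  moreover have "finite {C \<in> components K. diameter C > d/2}"
    using K half_gt_zero[OF d(1)] unfolding Peano_compactum_def by blast
  ultimately show "finite {D \<in> components L. diameter D > e}"
    using finite_subset finite_imageI by blast
qed

text \<open>The removed point \<open>\<omega>\<close> will be taken in \<Omega>, so that the whole
  boundary lies in the range of \<open>f\<close>.\<close>

locale punctured_chart =
  fixes f :: "complex \<Rightarrow> ext_complex" and g and \<omega>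
  assumes chart: "homeomorphism UNIV (UNIV - {\<omega>}) f g"
begin

lemma continuous_f: "continuous_on S f"
  and continuous_g: "\<omega> \<notin> T \<Longrightarrow> continuous_on T g"
  using chart continuous_on_subset by (auto simp: homeomorphism_def)

lemma gf [simp]: "g (f z) = z"
  and fg: "p \<noteq> \<omega> \<Longrightarrow> f (g p) = p"
  and f_ne [simp]: "f z \<noteq> \<omega>"
  using chart by (auto simp: homeomorphism_def)

lemma open_f_image:
  assumes "open U"
  shows "open (f ` U)"
proof -
  have "openin (top_of_set (UNIV - {\<omega>})) (f ` U)"
    using homeomorphism_imp_open_map[OF chart, of U] assms by simp
  then show ?thesis
    using openin_open_eq[OF open_delete[OF open_UNIV, of \<omega>], of "f ` U"] by blast
qed

lemma open_f_vimage: "open V \<Longrightarrow> open (f -` V)"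
  using continuous_f[of UNIV] by (simp add: continuous_on_open_vimage)

lemma tendsto_f: "x \<longlonglongrightarrow> z \<Longrightarrow> (\<lambda>n. f (x n)) \<longlonglongrightarrow> f z"
  using continuous_f[of UNIV] by (auto simp: continuous_on_def intro: tendsto_compose)

lemma tendsto_g: "p \<longlonglongrightarrow> f z \<Longrightarrow> (\<lambda>n. g (p n)) \<longlonglongrightarrow> z"
  using continuous_on_tendsto_compose[OF continuous_g, of "UNIV - {\<omega>}" p "f z" sequentially]
    topological_tendstoD[of p "f z" sequentially "UNIV - {\<omega>}"] by (simp add: open_delete)

lemma closure_vimage: "z \<in> closure (f -` A) \<longleftrightarrow> f z \<in> closure A"
proof
  assume "z \<in> closure (f -` A)"
  then show "f z \<in> closure A"
    unfolding closure_sequential using tendsto_f by fastforce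
next
  assume fz: "f z \<in> closure A"
  show "z \<in> closure (f -` A)"
    unfolding closure_iff_nhds_not_empty
  proof (intro allI impI)
    fix B V assume "V \<subseteq> B" "open V" "z \<in> V"
    then have "f ` V \<inter> A \<noteq> {}"
      using fz open_f_image[of V] unfolding closure_iff_nhds_not_empty by blast
    then show "f -` A \<inter> B \<noteq> {}"
      using \<open>V \<subseteq> B\<close> by blast
  qed
qed

lemma frontier_vimage: "open \<Omega> \<Longrightarrow> frontier (f -` \<Omega>) = f -` frontier \<Omega>"
  using closure_vimage open_f_vimage by (auto simp: frontier_def interior_open)

text \<open>Discs do not correspond under the chart, but a spherical disc pulls back to an open set
  and a Euclidean one has an open image, and \<open>lsaD\<close> accepts both. A sequence on the
  sphere is shortened to a tail that avoids \<open>\<omega>\<close>.\<close>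

lemma lsa_vimage:
  "locally_sequentially_accessible (f -` \<Omega>) z \<longleftrightarrow> locally_sequentially_accessible \<Omega> (f z)"
proof
  assume lsa: "locally_sequentially_accessible (f -` \<Omega>) z"
  show "locally_sequentially_accessible \<Omega> (f z)"
  proof (rule lsaI)
    fix r :: real and \<xi> assume "r > 0" and \<xi>: "\<And>n. \<xi> n \<in> \<Omega>" "\<xi> \<longlonglongrightarrow> f z"
    obtain N where N: "\<And>n. n \<ge> N \<Longrightarrow> \<xi> n \<in> UNIV - {\<omega>}"
      using LIMSEQ_in_open[OF \<xi>(2), of "UNIV - {\<omega>}"] by (auto simp: open_delete)
    define \<zeta> where "\<zeta> n = g (\<xi> (n + N))" for n
    have f\<zeta>: "f (\<zeta> n) = \<xi> (n + N)" for n
      using N[of "n + N"] by (simp add: \<zeta>_def fg)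
    have "\<zeta> \<longlonglongrightarrow> z"
      unfolding \<zeta>_def using tendsto_g[OF \<xi>(2)] by (rule LIMSEQ_ignore_initial_segment)
    moreover have "\<zeta> n \<in> f -` \<Omega>" for n
      using \<xi>(1) f\<zeta> by simp
    moreover have "open (f -` ball (f z) r)" "z \<in> f -` ball (f z) r"
      using open_f_vimage \<open>r > 0\<close> by auto
    ultimately obtain C where C: "connected C" "C \<subseteq> f -` \<Omega> \<inter> f -` ball (f z) r" "infinite {n. \<zeta> n \<in> C}"
      using lsaD[OF lsa, of "f -` ball (f z) r" \<zeta>] by metis
    have "connected (f ` C)"
      using C(1) continuous_f by (rule connected_continuous_image[rotated])
    moreover have "infinite {n. \<xi> n \<in> f ` C}"
    proof -
      have "(\<lambda>n. n + N) ` {n. \<zeta> n \<in> C} \<subseteq> {n. \<xi> n \<in> f ` C}"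
        by (auto simp: f\<zeta>[symmetric])
      moreover have "infinite ((\<lambda>n. n + N) ` {n. \<zeta> n \<in> C})"
        using C(3) by (simp add: finite_image_iff)
      ultimately show ?thesis
        using finite_subset by blast
    qed
    ultimately show "\<exists>C. connected C \<and> C \<subseteq> \<Omega> \<inter> ball (f z) r \<and> infinite {n. \<xi> n \<in> C}"
      using C(2) by (intro exI[of _ "f ` C"]) auto
  qed
next
  assume lsa: "locally_sequentially_accessible \<Omega> (f z)"
  show "locally_sequentially_accessible (f -` \<Omega>) z"
  proof (rule lsaI)
    fix r :: real and \<zeta> assume "r > 0" and \<zeta>: "\<And>n. \<zeta> n \<in> f -` \<Omega>" "\<zeta> \<longlonglongrightarrow> z"
    have "f z \<in> f ` ball z r" "open (f ` ball z r)" "\<And>n. f (\<zeta> n) \<in> \<Omega>"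
      using \<open>r > 0\<close> open_f_image \<zeta>(1) by auto
    then obtain C where C: "connected C" "C \<subseteq> \<Omega> \<inter> f ` ball z r" "infinite {n. f (\<zeta> n) \<in> C}"
      using lsaD[OF lsa, of "f ` ball z r" "\<lambda>n. f (\<zeta> n)"] tendsto_f[OF \<zeta>(2)] by metis
    have "\<omega> \<notin> C"
      using C(2) f_ne by (metis IntD2 imageE subsetD)
    then have "connected (g ` C)"
      using C(1) continuous_g by (intro connected_continuous_image)
    moreover have "g ` C \<subseteq> f -` \<Omega> \<inter> ball z r"
      using C(2) by fastforce
    moreover have "{n. f (\<zeta> n) \<in> C} \<subseteq> {n. \<zeta> n \<in> g ` C}"
      by (force intro: image_eqI[of _ g "f _"])
    ultimately show "\<exists>C. connected C \<and> C \<subseteq> f -` \<Omega> \<inter> ball z r \<and> infinite {n. \<zeta> n \<in> C}"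
      using C(3) finite_subset by blast
  qed
qed

lemma homeomorphism_vimage:
  assumes "\<omega> \<notin> K"
  shows "homeomorphism (f -` K) K f g"
proof (rule homeomorphism_of_subsets[OF chart _ empty_subsetI])
  have "p = f (g p)" if "p \<in> K" for p
    using that assms fg by metis
  then show "f ` (f -` K) = K"
    by force
qed auto

text \<open>The image of a bounded component would be open, and closed in \<Omega> by compactness of
  the closure, hence all of the connected set \<Omega>; but it misses
  \<open>\<omega>\<close>.\<close>

lemma component_vimage_unbounded:
  assumes "open \<Omega>" "connected \<Omega>" "\<omega> \<in> \<Omega>" and C: "C \<in> components (f -` \<Omega>)"
  shows "\<not> bounded C"
proof
  assume "bounded C"
  then have "closed (f ` closure C)"
    using compact_continuous_image[OF continuous_f] by (simp add: compact_closure compact_imp_closed)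
  have C': "C \<subseteq> f -` \<Omega>" "connected C" "C \<noteq> {}"
    using C in_components_subset in_components_connected in_components_nonempty by blast+
  have "open C"
    using open_components[OF open_f_vimage[OF \<open>open \<Omega>\<close>] C] .
  have "closure C \<inter> f -` \<Omega> \<subseteq> C"
  proof (rule component_between[OF _ _ C])
    show "connected (closure C \<inter> f -` \<Omega>)"
      using C'(1) closure_subset by (intro connected_intermediate_closure[OF C'(2)]) auto
    show "(closure C \<inter> f -` \<Omega>) \<inter> C \<noteq> {}"
      using C'(1,3) closure_subset[of C] by blast
  qed simp
  then have "f ` C = \<Omega> \<inter> f ` closure C"
    using C'(1) closure_subset[of C] by blast
  then have "closedin (top_of_set \<Omega>) (f ` C)"
    using \<open>closed (f ` closure C)\<close> by (simp add: closedin_closed_Int)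
  moreover have "openin (top_of_set \<Omega>) (f ` C)"
    using open_f_image[OF \<open>open C\<close>] C'(1) by (intro open_subset) auto
  ultimately have "f ` C = \<Omega>"
    using \<open>connected \<Omega>\<close> C'(3) unfolding connected_clopen by blast
  then show False
    using \<open>\<omega> \<in> \<Omega>\<close> f_ne by (metis imageE)
qed

text \<open>Diameter below \<open>\<epsilon>\<close> keeps the arc in the image of
  \<open>ball z e\<close>, away from \<open>\<omega>\<close>, so \<open>g\<close> pulls it back.
  Without its end point an arc is the image of a half-open interval and thus connected.\<close>

lemma accessible_vimage:
  assumes la: "locally_accessible \<Omega> (f z)" and "f z \<notin> \<Omega>" "e > 0"
  shows "\<exists>\<delta>>0. \<forall>y\<in>f -` \<Omega> \<inter> ball z \<delta>. \<exists>E. compact E \<and> connected E \<and> z \<in> E \<and> y \<in> E \<and> E \<subseteq> ball z e \<and>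
           E - {z} \<subseteq> f -` \<Omega> \<and> connected (E - {z})"
proof -
  have "open (f ` ball z e)" "f z \<in> f ` ball z e"
    using open_f_image \<open>e > 0\<close> by auto
  then obtain \<epsilon> where \<epsilon>: "\<epsilon> > 0" "ball (f z) \<epsilon> \<subseteq> f ` ball z e"
    by (meson openE)
  obtain \<delta>1 where \<delta>1: "\<delta>1 > 0" "\<And>x. \<lbrakk>x \<in> \<Omega>; dist x (f z) < \<delta>1\<rbrakk> \<Longrightarrow> \<exists>\<gamma>. arc \<gamma> \<and> path_image \<gamma> \<subseteq> \<Omega> \<union> {f z} \<and>
      pathstart \<gamma> = x \<and> pathfinish \<gamma> = f z \<and> diameter (path_image \<gamma>) < \<epsilon>"
    using la \<epsilon>(1) unfolding locally_accessible_def by metis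
  have "open (f -` ball (f z) \<delta>1)" "z \<in> f -` ball (f z) \<delta>1"
    using open_f_vimage \<delta>1(1) by auto
  then obtain \<delta> where \<delta>: "\<delta> > 0" "ball z \<delta> \<subseteq> f -` ball (f z) \<delta>1"
    by (meson openE)
  have "\<exists>E. compact E \<and> connected E \<and> z \<in> E \<and> y \<in> E \<and> E \<subseteq> ball z e \<and> E - {z} \<subseteq> f -` \<Omega> \<and> connected (E - {z})"
    if y: "y \<in> f -` \<Omega> \<inter> ball z \<delta>" for y
  proof -
    have "f y \<in> \<Omega>" "f y \<in> ball (f z) \<delta>1"
      using y \<delta>(2) by blast+
    then have "f y \<in> \<Omega>" "dist (f y) (f z) < \<delta>1"
      by (simp_all add: dist_commute)
    then obtain \<gamma> where \<gamma>: "arc \<gamma>" "path_image \<gamma> \<subseteq> \<Omega> \<union> {f z}" "pathstart \<gamma> = f y" "pathfinish \<gamma> = f z"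
      "diameter (path_image \<gamma>) < \<epsilon>"
      using \<delta>1(2) by blast
    have "path \<gamma>"
      using \<gamma>(1) by (rule arc_imp_path)
    define A where "A = path_image \<gamma>"
    have A: "compact A" "connected A" "f y \<in> A" "f z \<in> A"
      using \<open>path \<gamma>\<close> \<gamma>(3,4) pathstart_in_path_image[of \<gamma>] pathfinish_in_path_image[of \<gamma>]
      by (auto simp: A_def compact_path_image connected_path_image)
    have "A \<subseteq> ball (f z) \<epsilon>"
    proof
      fix a assume "a \<in> A"
      then have "dist (f z) a \<le> diameter A"
        using diameter_bounded_bound[OF bounded_ext_complex] A(4) by blast
      then show "a \<in> ball (f z) \<epsilon>"
        using \<gamma>(5) by (simp add: A_def)
    qed
    then have Aball: "A \<subseteq> f ` ball z e"
      using \<epsilon>(2) by blast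
    then have "\<omega> \<notin> A"
      using f_ne by blast
    have "A - {f z} = \<gamma> ` {0..<1}"
    proof -
      have "\<gamma> t = f z \<longleftrightarrow> t = 1" if "t \<in> {0..1}" for t
        using \<gamma>(1,4) that inj_onD[of \<gamma> "{0..1}" t 1] by (auto simp: arc_def pathfinish_def)
      then show ?thesis
        by (force simp: A_def path_image_def)
    qed
    moreover have "connected (\<gamma> ` {0..<1})"
      using \<open>path \<gamma>\<close> by (intro connected_continuous_image) (auto simp: path_def intro: continuous_on_subset)
    ultimately have "connected (A - {f z})"
      by simp
    show ?thesis
    proof (intro exI[of _ "g ` A"] conjI)
      show "compact (g ` A)" "connected (g ` A)"
        using A continuous_g[OF \<open>\<omega> \<notin> A\<close>] by (simp_all add: compact_continuous_image connected_continuous_image)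
      show "z \<in> g ` A" "y \<in> g ` A"
        using A(3,4) by (metis gf image_eqI)+
      show "g ` A \<subseteq> ball z e"
        using Aball by fastforce
      have eq: "g ` A - {z} = g ` (A - {f z})"
        using Aball by force
      show "connected (g ` A - {z})"
        unfolding eq using \<open>connected (A - {f z})\<close> continuous_g[of "A - {f z}"] \<open>\<omega> \<notin> A\<close>
        by (intro connected_continuous_image) auto
      show "g ` A - {z} \<subseteq> f -` \<Omega>"
        unfolding eq using \<gamma>(2) fg \<open>\<omega> \<notin> A\<close> by (force simp: A_def[symmetric])
    qed
  qed
  with \<delta>(1) show ?thesis
    by blast
qed

end

section \<open>The equivalences\<close>

theorem theorem4:
  fixes \<Omega> :: "ext_complex set"
  assumes "open \<Omega>" and "connected \<Omega>"
  shows "(Peano_compactum (frontier \<Omega>) \<longleftrightarrow> property_S \<Omega>) \<and>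
         (property_S \<Omega> \<longleftrightarrow> (\<forall>p\<in>frontier \<Omega>. locally_accessible \<Omega> p)) \<and>
         ((\<forall>p\<in>frontier \<Omega>. locally_accessible \<Omega> p) \<longleftrightarrow>
          (\<forall>p\<in>frontier \<Omega>. locally_sequentially_accessible \<Omega> p)) \<and>
         ((\<forall>p\<in>frontier \<Omega>. locally_sequentially_accessible \<Omega> p) \<longleftrightarrow>
          finitely_connected_at_boundary \<Omega>) \<and>
         (finitely_connected_at_boundary \<Omega> \<longleftrightarrow>
          Metric_space.compact_completion \<Omega> (mazurkiewicz_dist \<Omega>))"
proof -
  let ?Peano = "Peano_compactum (frontier \<Omega>)"
  let ?la = "\<forall>p\<in>frontier \<Omega>. locally_accessible \<Omega> p"
  let ?lsa = "\<forall>p\<in>frontier \<Omega>. locally_sequentially_accessible \<Omega> p"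
  note lc = locally_connected_UNIV_ext_complex
  have off: "p \<notin> \<Omega>" if "p \<in> frontier \<Omega>" for p
    using that \<open>open \<Omega>\<close> by (simp add: frontier_def interior_open)
  have completion: "property_S \<Omega> \<longleftrightarrow> Metric_space.compact_completion \<Omega> (mazurkiewicz_dist \<Omega>)"
    using property_S_iff_compact_completion[OF bounded_ext_complex \<open>connected \<Omega>\<close>] .
  have fc: "property_S \<Omega> \<longleftrightarrow> finitely_connected_at_boundary \<Omega>"
    using property_S_imp_finitely_connected[OF lc \<open>open \<Omega>\<close> bounded_ext_complex]
      finitely_connected_imp_property_S[OF lc \<open>open \<Omega>\<close> closed_imp_compact_ext_complex[OF closed_closure]]
    unfolding finitely_connected_at_boundary_def by blast
  have lsa: "?lsa \<longleftrightarrow> finitely_connected_at_boundary \<Omega>"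
    using finitely_connected_imp_lsa lsa_imp_finitely_connected[OF lc \<open>open \<Omega>\<close>]
    unfolding finitely_connected_at_boundary_def by blast
  have la: "?la" if "?lsa"
    using that lsa_imp_locally_accessible[OF \<open>open \<Omega>\<close>] off by blast
  have "(?la \<longrightarrow> ?lsa) \<and> (?Peano \<longleftrightarrow> ?lsa)"
  \<comment> \<open>The empty set has no point to puncture at, but its boundary is empty as
    well.\<close>
  proof (cases "\<Omega> = {}")
    case True
    then show ?thesis
      by (simp add: Peano_compactum_def)
  next
    case False
    then obtain \<omega> where \<omega>: "\<omega> \<in> \<Omega>"
      by blast
    obtain f :: "complex \<Rightarrow> ext_complex" and g where "homeomorphism UNIV (UNIV - {\<omega>}) f g"
      using punctured_ext_complex_chart .
    then interpret punctured_chart f g \<omega>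
      by unfold_locales
    define \<Omega>' where "\<Omega>' = f -` \<Omega>"
    have open': "open \<Omega>'"
      using open_f_vimage[OF \<open>open \<Omega>\<close>] by (simp add: \<Omega>'_def)
    have fr: "frontier \<Omega>' = f -` frontier \<Omega>"
      using frontier_vimage[OF \<open>open \<Omega>\<close>] by (simp add: \<Omega>'_def)
    have unb: "\<not> bounded C" if "C \<in> components \<Omega>'" for C
      using component_vimage_unbounded[OF assms \<omega>] that by (simp add: \<Omega>'_def)
    have hom: "homeomorphism (frontier \<Omega>') (frontier \<Omega>) f g"
      unfolding fr using off \<omega> by (intro homeomorphism_vimage) blast
    have lsa': "locally_sequentially_accessible \<Omega>' z \<longleftrightarrow> locally_sequentially_accessible \<Omega> (f z)" for z
      unfolding \<Omega>'_def by (rule lsa_vimage)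
    have surj: "\<exists>z. p = f z" if "p \<in> frontier \<Omega>" for p
      using fg[of p] off[OF that] \<omega> by metis
    have "compact (frontier \<Omega>')"
      using closed_imp_compact_ext_complex[of "frontier \<Omega>"] homeomorphic_compactness[of "frontier \<Omega>'" "frontier \<Omega>"] hom
      unfolding homeomorphic_def by blast
    have "?lsa" if ?la
    proof
      fix p assume "p \<in> frontier \<Omega>"
      then obtain z where z: "p = f z"
        using surj by blast
      have "locally_sequentially_accessible \<Omega>' z"
      proof (rule planar_accessible_imp_lsa[OF open' unb])
        fix x :: complex and e :: real assume x: "x \<in> frontier \<Omega>'" and "e > 0"
        then have "f x \<in> frontier \<Omega>"
          by (simp add: fr)
        then show "\<exists>\<delta>>0. \<forall>y\<in>\<Omega>' \<inter> ball x \<delta>. \<exists>E. compact E \<and> connected E \<and> x \<in> E \<and> y \<in> E \<and> E \<subseteq> ball x e \<and>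
            E - {x} \<subseteq> \<Omega>' \<and> connected (E - {x})"
          unfolding \<Omega>'_def using accessible_vimage[of \<Omega> x e] that off \<open>e > 0\<close> by blast
      qed
      then show "locally_sequentially_accessible \<Omega> p"
        using lsa' z by simp
    qed
    moreover have ?lsa if ?Peano
    proof
      fix p assume "p \<in> frontier \<Omega>"
      then obtain z where z: "p = f z"
        using surj by blast
      have "Peano_compactum (frontier \<Omega>')"
        using Peano_compactum_homeomorphic_image[OF that] hom homeomorphism_sym by blast
      then have "locally_sequentially_accessible \<Omega>' z"
        using planar_Peano_compactum_imp_lsa[OF open' unb] by blast
      then show "locally_sequentially_accessible \<Omega> p"
        using lsa' z by simp
    qed
    moreover have ?Peano if ?lsa
    proof -
      \<comment> \<open>Finite connectedness of the preimage is derived afresh from its sequential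
        accessibility, which the chart does preserve.\<close>
      have "finitely_connected_at \<Omega>' z" if "z \<in> frontier \<Omega>'" for z
      proof (rule lsa_imp_finitely_connected[OF _ open'])
        show "locally connected (UNIV :: complex set)"
          by (simp add: convex_imp_locally_connected)
        show "locally_sequentially_accessible \<Omega>' z"
          using lsa' \<open>?lsa\<close> that fr by blast
      qed
      then have "Peano_compactum (frontier \<Omega>')"
        using planar_finitely_connected_imp_Peano_compactum[OF open' \<open>compact (frontier \<Omega>')\<close>] by blast
      then show ?thesis
        using Peano_compactum_homeomorphic_image hom by blast
    qed
    ultimately show ?thesis
      by blast
  qed
  then show ?thesis
    using completion fc lsa la by blast
qed

end
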